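(* Let $\Gamma\subset\mathbb R^N$ be a network with Hamiltonians $H_\gamma$ and a flux limiter $(c_x)_{x\in\mathbf V}$ as in the context, and let $L$ be the associated overall Lagrangian. Let $z_1,z_2\in\Gamma$ and $T>0$. Any admissible curve $\xi:[0,T]\to\Gamma$ with $\xi(0)=z_1$, $\xi(T)=z_2$ which minimizes the action $\int_0^TL(\zeta,\dot\zeta)\,d\tau$ among all absolutely continuous curves $\zeta$ defined in $[0,T]$ with $\zeta(0)=z_1$, $\zeta(T)=z_2$ is Lipschitz continuous.
   Context: Network. $\mathcal E$ is a finite collection of simple curves $\gamma:[0,1]\to\mathbb R^N$, called arcs, each $C^1$ up to the endpoints with nowhere vanishing derivative, and $\Gamma=\bigcup_{\gamma\in\mathcal E}\gamma([0,1])$. For each arc $\gamma$ the inverse arc $\widetilde\gamma(s)=\gamma(1-s)$ is also regarded as an arc. It is assumed that $\gamma((0,1))\cap\gamma'([0,1])=\emptyset$ whenever $\gamma\ne\gamma'$ and $\gamma\neq\widetilde{\gamma'}$. The set $\mathbf V$ of vertices is the set of initial and terminal points of arcs. $\Gamma$ is connected (any two vertices are linked by a finite concatenation of arcs) and there are no loops ($\gamma(0)\ne\gamma(1)$ for every arc). For $x\in\mathbf V$, $\Gamma_x=\{\gamma \text{ arc}: \gamma(1)=x\}$. The tangent bundle $T\Gamma$ is the set of $(x,q)\in\Gamma\times\mathbb R^N$ such that $q=\lambda\dot\gamma(s)$ for some arc $\gamma$, $s\in[0,1]$ with $x=\gamma(s)$, and $\lambda\in\mathbb R$. Hamiltonians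 and Lagrangians. For each arc $\gamma$, $H_\gamma:[0,1]\times\mathbb R\to\mathbb R$ is continuous, convex in the second variable $\mu$, satisfies $\lim_{|\mu|\to\infty}\inf_{s\in[0,1]}H_\gamma(s,\mu)/|\mu|=+\infty$, and $H_{\widetilde\gamma}(s,\mu)=H_\gamma(1-s,-\mu)$. Set $L_\gamma(s,\lambda)=\max_{\mu\in\mathbb R}(\lambda\mu-H_\gamma(s,\mu))$ and $c_\gamma=-\max_{s\in[0,1]}\min_{\mu\in\mathbb R}H_\gamma(s,\mu)=\min_{s\in[0,1]}L_\gamma(s,0)$. A flux limiter is a function $x\mapsto c_x$ from $\mathbf V$ to $\mathbb R$ with $c_x\le\min_{\gamma\in\Gamma_x}c_\gamma$ for every $x\in\mathbf V$. Overall Lagrangian. $L:T\Gamma\to\mathbb R$ is defined by: if $x\in\gamma((0,1))$, $L(x,q)=L_\gamma\big(\gamma^{-1}(x),\tfrac{q\cdot\dot\gamma(\gamma^{-1}(x))}{|\dot\gamma(\gamma^{-1}(x))|^2}\big)$; if $x\in\mathbf V$, $q\ne0$, $L(x,q)=\min L_\gamma\big(1,\tfrac{q\cdot\dot\gamma(1)}{|\dot\gamma(1)|^2}\big)$, the minimum being over those $\gamma\in\Gamma_x$ with $\dot\gamma(1)$ parallel to $q$; if $x\in\mathbf V$, $L(x,0)=c_x$. It is extended by $L=+\infty$ to $(\mathbb R^N\times\mathbb R^N)\setminus T\Gamma$. Admissible curves. An absolutely continuous curve $\xi:[0,T]\to\Gamma$ is admissible if there is a finite partition $0=t_1<\dots<t_m=T$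 of $[0,T]$ such that $\xi(t_i)\in\mathbf V$ for $i=2,\dots,m-1$ (if $m>2$) and, for every $i\in\{1,\dots,m-1\}$, either $\xi((t_i,t_{i+1}))\cap\mathbf V=\emptyset$ and $\xi(t_i)\neq\xi(t_{i+1})$, or $\xi$ is constantly equal to some vertex on $(t_i,t_{i+1})$. *)

theory Defs
  imports "HOL-Analysis.Analysis"
begin

text \<open>
  A curve on \<open>[0,1]\<close> is a total function \<open>real \<Rightarrow> real ^ 'n\<close> of which only the values on
  \<open>{0..1}\<close> matter. The separation condition in \<open>network\<close> excludes two distinct functions
  that agree on \<open>{0..1}\<close>, so equality of arcs as total functions is equality of arcs as curves.
\<close>

definition arcs :: "(real \<Rightarrow> real ^ 'n) set \<Rightarrow> (real \<Rightarrow> real ^ 'n) set" where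
  "arcs E = E \<union> reversepath ` E"

definition network_support :: "(real \<Rightarrow> real ^ 'n) set \<Rightarrow> (real ^ 'n) set" where
  "network_support E = (\<Union>\<gamma>\<in>E. \<gamma> ` {0..1})"

definition vertices :: "(real \<Rightarrow> real ^ 'n) set \<Rightarrow> (real ^ 'n) set" where
  "vertices E = pathstart ` arcs E \<union> pathfinish ` arcs E"

definition arcs_to :: "(real \<Rightarrow> real ^ 'n) set \<Rightarrow> real ^ 'n \<Rightarrow> (real \<Rightarrow> real ^ 'n) set" where
  "arcs_to E x = {\<gamma> \<in> arcs E. \<gamma> 1 = x}"

text \<open>One-sided at the endpoints 0 and 1.\<close>
definition arc_deriv :: "(real \<Rightarrow> real ^ 'n) \<Rightarrow> real \<Rightarrow> real ^ 'n" where
  "arc_deriv \<gamma> s = vector_derivative \<gamma> (at s within {0..1})"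

definition regular_C1 :: "(real \<Rightarrow> real ^ 'n) \<Rightarrow> bool" where
  "regular_C1 \<gamma> \<longleftrightarrow>
     (\<exists>D. continuous_on {0..1} D \<and>
          (\<forall>s\<in>{0..1}. (\<gamma> has_vector_derivative D s) (at s within {0..1}) \<and> D s \<noteq> 0))"

definition network :: "(real \<Rightarrow> real ^ 'n) set \<Rightarrow> bool" where
  "network E \<longleftrightarrow>
     finite E \<and>
     (\<forall>\<gamma>\<in>E. simple_path \<gamma> \<and> regular_C1 \<gamma>) \<and>
     (\<forall>\<gamma>\<in>arcs E. \<forall>\<gamma>'\<in>arcs E. \<gamma> \<noteq> \<gamma>' \<and> \<gamma> \<noteq> reversepath \<gamma>' \<longrightarrow>
        \<gamma> ` {0<..<1} \<inter> \<gamma>' ` {0..1} = {}) \<and>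
     (\<forall>x\<in>vertices E. \<forall>y\<in>vertices E.
        (x, y) \<in> {(pathstart \<gamma>, pathfinish \<gamma>) | \<gamma>. \<gamma> \<in> arcs E}\<^sup>*) \<and>
     (\<forall>\<gamma>\<in>arcs E. \<gamma> 0 \<noteq> \<gamma> 1)"

definition tangent_bundle :: "(real \<Rightarrow> real ^ 'n) set \<Rightarrow> ((real ^ 'n) \<times> (real ^ 'n)) set" where
  "tangent_bundle E =
     {(x, q). x \<in> network_support E \<and>
        (\<exists>\<gamma>\<in>arcs E. \<exists>s\<in>{0..1}. \<exists>l. x = \<gamma> s \<and> q = l *\<^sub>R arc_deriv \<gamma> s)}"

text \<open>\<open>H \<gamma> s \<mu>\<close> is \<open>H\<^sub>\<gamma>(s, \<mu>)\<close>; only \<open>\<gamma> \<in> arcs E\<close> and \<open>s \<in> {0..1}\<close> matter.\<close>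
definition hamiltonians ::
  "(real \<Rightarrow> real ^ 'n) set \<Rightarrow> ((real \<Rightarrow> real ^ 'n) \<Rightarrow> real \<Rightarrow> real \<Rightarrow> real) \<Rightarrow> bool" where
  "hamiltonians E H \<longleftrightarrow>
     (\<forall>\<gamma>\<in>arcs E.
        continuous_on ({0..1} \<times> UNIV) (\<lambda>(s, \<mu>). H \<gamma> s \<mu>) \<and>
        (\<forall>s\<in>{0..1}. convex_on UNIV (H \<gamma> s)) \<and>
        filterlim (\<lambda>\<mu>. INF s\<in>{0..1}. H \<gamma> s \<mu> / \<bar>\<mu>\<bar>) at_top at_infinity \<and>
        (\<forall>s\<in>{0..1}. \<forall>\<mu>. H (reversepath \<gamma>) s \<mu> = H \<gamma> (1 - s) (- \<mu>)))"

text \<open>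
  The maxima and minima over \<open>\<mu> \<in> \<real>\<close> and \<open>s \<in> [0,1]\<close> are attained by continuity and
  superlinearity of \<open>H\<close>, so they are the suprema and infima below.
\<close>
definition arc_lagrangian ::
  "((real \<Rightarrow> real ^ 'n) \<Rightarrow> real \<Rightarrow> real \<Rightarrow> real) \<Rightarrow> (real \<Rightarrow> real ^ 'n) \<Rightarrow> real \<Rightarrow> real \<Rightarrow> real" where
  "arc_lagrangian H \<gamma> s l = (SUP \<mu>. l * \<mu> - H \<gamma> s \<mu>)"

definition arc_const ::
  "((real \<Rightarrow> real ^ 'n) \<Rightarrow> real \<Rightarrow> real \<Rightarrow> real) \<Rightarrow> (real \<Rightarrow> real ^ 'n) \<Rightarrow> real" where
  "arc_const H \<gamma> = - (SUP s\<in>{0..1}. INF \<mu>. H \<gamma> s \<mu>)"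

definition flux_limiter ::
  "(real \<Rightarrow> real ^ 'n) set \<Rightarrow> ((real \<Rightarrow> real ^ 'n) \<Rightarrow> real \<Rightarrow> real \<Rightarrow> real) \<Rightarrow> (real ^ 'n \<Rightarrow> real) \<Rightarrow> bool" where
  "flux_limiter E H c \<longleftrightarrow> (\<forall>x\<in>vertices E. c x \<le> Min (arc_const H ` arcs_to E x))"

text \<open>
  \<open>L\<^sub>\<gamma>\<close> evaluated at the point \<open>\<gamma> s\<close> and the vector \<open>q\<close>, whose coordinate along
  \<open>\<gamma>\<close> is \<open>q \<bullet> \<gamma>'(s) / |\<gamma>'(s)|\<^sup>2\<close>.
\<close>
definition lagrangian_along ::
  "((real \<Rightarrow> real ^ 'n) \<Rightarrow> real \<Rightarrow> real \<Rightarrow> real) \<Rightarrow> (real \<Rightarrow> real ^ 'n) \<Rightarrow> real \<Rightarrow> real ^ 'n \<Rightarrow> real" where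
  "lagrangian_along H \<gamma> s q =
     arc_lagrangian H \<gamma> s ((q \<bullet> arc_deriv \<gamma> s) / (norm (arc_deriv \<gamma> s))\<^sup>2)"

text \<open>
  At a point that is not a vertex exactly two arcs pass, inverse to each other; the value does not
  depend on which one is selected, see \<open>lagrangian_interior\<close> below. At a vertex, ``parallel''
  means equality up to a nonzero factor of either sign: motions leaving \<open>x\<close> are also
  measured along arcs ending at \<open>x\<close>.
\<close>
definition lagrangian ::
  "(real \<Rightarrow> real ^ 'n) set \<Rightarrow> ((real \<Rightarrow> real ^ 'n) \<Rightarrow> real \<Rightarrow> real \<Rightarrow> real) \<Rightarrow> (real ^ 'n \<Rightarrow> real) \<Rightarrow>
   real ^ 'n \<Rightarrow> real ^ 'n \<Rightarrow> ereal" where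
  "lagrangian E H c x q =
     (if (x, q) \<notin> tangent_bundle E then \<infinity>
      else if x \<in> vertices E then
        (if q = 0 then ereal (c x)
         else ereal (Min {lagrangian_along H \<gamma> 1 q | \<gamma>.
                            \<gamma> \<in> arcs_to E x \<and> (\<exists>l. q = l *\<^sub>R arc_deriv \<gamma> 1)}))
      else (let \<gamma> = (SOME \<gamma>. \<gamma> \<in> arcs E \<and> x \<in> \<gamma> ` {0<..<1})
            in ereal (lagrangian_along H \<gamma> (inv_into {0..1} \<gamma> x) q)))"

definition absolutely_continuous_curve :: "real \<Rightarrow> real \<Rightarrow> (real \<Rightarrow> real ^ 'n) \<Rightarrow> bool" where
  "absolutely_continuous_curve a b f \<longleftrightarrow>
     (\<forall>e>0. \<exists>d>0. \<forall>n::nat. \<forall>u v.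
        (\<forall>i<n. a \<le> u i \<and> u i \<le> v i \<and> v i \<le> b) \<and>
        (\<forall>i<n. \<forall>j<n. i \<noteq> j \<longrightarrow> {u i<..<v i} \<inter> {u j<..<v j} = {}) \<and>
        (\<Sum>i<n. v i - u i) < d \<longrightarrow>
        (\<Sum>i<n. norm (f (v i) - f (u i))) < e)"

text \<open>
  Integral of an extended-real function as the difference of the integrals of its positive and
  negative parts (\<open>e2ennreal\<close> sends negative numbers to 0). The overall Lagrangian is bounded
  below, so the second term is finite in the action.
\<close>
definition ereal_integral :: "'a measure \<Rightarrow> ('a \<Rightarrow> ereal) \<Rightarrow> ereal" where
  "ereal_integral M f =
     enn2ereal (\<integral>\<^sup>+ t. e2ennreal (f t) \<partial>M) - enn2ereal (\<integral>\<^sup>+ t. e2ennreal (- f t) \<partial>M)"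

definition action ::
  "(real \<Rightarrow> real ^ 'n) set \<Rightarrow> ((real \<Rightarrow> real ^ 'n) \<Rightarrow> real \<Rightarrow> real \<Rightarrow> real) \<Rightarrow> (real ^ 'n \<Rightarrow> real) \<Rightarrow>
   real \<Rightarrow> (real \<Rightarrow> real ^ 'n) \<Rightarrow> ereal" where
  "action E H c T \<zeta> =
     ereal_integral (lebesgue_on {0..T})
       (\<lambda>t. lagrangian E H c (\<zeta> t) (vector_derivative \<zeta> (at t within {0..T})))"

definition admissible :: "(real \<Rightarrow> real ^ 'n) set \<Rightarrow> real \<Rightarrow> (real \<Rightarrow> real ^ 'n) \<Rightarrow> bool" where
  "admissible E T \<xi> \<longleftrightarrow>
     absolutely_continuous_curve 0 T \<xi> \<and> \<xi> ` {0..T} \<subseteq> network_support E \<and>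
     (\<exists>(m::nat) (t::nat \<Rightarrow> real).
        m \<ge> 2 \<and> t 1 = 0 \<and> t m = T \<and> (\<forall>i\<in>{1..<m}. t i < t (Suc i)) \<and>
        (\<forall>i\<in>{2..<m}. \<xi> (t i) \<in> vertices E) \<and>
        (\<forall>i\<in>{1..<m}.
           (\<xi> ` {t i<..<t (Suc i)} \<inter> vertices E = {} \<and> \<xi> (t i) \<noteq> \<xi> (t (Suc i))) \<or>
           (\<exists>x\<in>vertices E. \<forall>s\<in>{t i<..<t (Suc i)}. \<xi> s = x)))"

lemma arcs_inj_on:
  assumes "network E" "\<gamma> \<in> arcs E"
  shows "inj_on \<gamma> {0..1}"
proof -
  have "simple_path \<gamma>"
    using assms by (auto simp: network_def arcs_def simple_path_reversepath)
  moreover have "\<gamma> 0 \<noteq> \<gamma> 1" using assms by (auto simp: network_def)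
  ultimately have "arc \<gamma>"
    by (simp add: arc_simple_path pathstart_def pathfinish_def)
  then show ?thesis by (simp add: arc_def)
qed

lemma interior_not_vertex:
  assumes E: "network E" and g: "\<gamma> \<in> arcs E" and s: "s \<in> {0<..<1}"
  shows "\<gamma> s \<notin> vertices E"
proof
  assume "\<gamma> s \<in> vertices E"
  then obtain g' r where g': "g' \<in> arcs E" and r: "r = 0 \<or> r = 1" and eq: "\<gamma> s = g' r"
    by (auto simp: vertices_def pathstart_def pathfinish_def)
  have i: "inj_on \<gamma> {0..1}" by (rule arcs_inj_on[OF E g])
  consider "\<gamma> = g'" | "\<gamma> = reversepath g'" | "\<gamma> ` {0<..<1} \<inter> g' ` {0..1} = {}"
    using E g g' unfolding network_def by blast
  then show False
  proof cases
    case 1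
    with eq have "\<gamma> s = \<gamma> r" by simp
    then have "s = r" by (rule inj_onD[OF i]) (use s r in auto)
    with s r show False by auto
  next
    case 2
    then have "g' r = \<gamma> (1 - r)" by (simp add: reversepath_def)
    with eq have "\<gamma> s = \<gamma> (1 - r)" by simp
    then have "s = 1 - r" by (rule inj_onD[OF i]) (use s r in auto)
    with s r show False by auto
  next
    case 3
    moreover have "\<gamma> s \<in> \<gamma> ` {0<..<1}" using s by blast
    moreover have "\<gamma> s \<in> g' ` {0..1}" unfolding eq using r by auto
    ultimately show False by blast
  qed
qed

lemma arc_deriv_reversepath:
  assumes E: "network E" and g: "\<gamma> \<in> arcs E" and s: "s \<in> {0..1}"
  shows "arc_deriv (reversepath \<gamma>) s = - arc_deriv \<gamma> (1 - s)"
proof -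
  have rev: "(reversepath g has_vector_derivative - D) (at r within {0..1})"
    if "(g has_vector_derivative D) (at (1 - r) within {0..1})" for g :: "real \<Rightarrow> real ^ 'n" and D r
  proof -
    have "(g has_vector_derivative D) (at (1 - r) within (\<lambda>x. 1 - x) ` {0..1})"
      using that by simp
    then have "((g \<circ> (\<lambda>x. 1 - x)) has_vector_derivative (-1) *\<^sub>R D) (at r within {0..1})"
      by (intro vector_diff_chain_within) (auto intro!: derivative_eq_intros)
    then show ?thesis by (simp add: reversepath_def o_def)
  qed
  have diff: "\<exists>D. (\<gamma> has_vector_derivative D) (at r within {0..1})" if "r \<in> {0..1}" for r
  proof -
    from g consider "\<gamma> \<in> E" | g' where "g' \<in> E" "\<gamma> = reversepath g'"
      by (auto simp: arcs_def)
    then show ?thesis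
    proof cases
      case 1
      with E have "regular_C1 \<gamma>" by (simp add: network_def)
      with that show ?thesis unfolding regular_C1_def by blast
    next
      case 2
      with E have g': "regular_C1 g'" by (simp add: network_def)
      have "1 - r \<in> {0..1}" using that by auto
      then obtain D where "(g' has_vector_derivative D) (at (1 - r) within {0..1})"
        using g' unfolding regular_C1_def by blast
      with rev 2 show ?thesis by blast
    qed
  qed
  have s': "1 - s \<in> {0..1}" using s by auto
  then obtain D where D: "(\<gamma> has_vector_derivative D) (at (1 - s) within {0..1})"
    using diff by blast
  have "arc_deriv \<gamma> (1 - s) = D"
    unfolding arc_deriv_def
    using vector_derivative_within_closed_interval[OF _ _ D] s' by simp
  moreover have "arc_deriv (reversepath \<gamma>) s = - D"
    unfolding arc_deriv_def
    using vector_derivative_within_closed_interval[OF _ _ rev[OF D]] s by simp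
  ultimately show ?thesis by simp
qed

lemma lagrangian_along_reversepath:
  assumes E: "network E" and H: "hamiltonians E H" and g: "\<gamma> \<in> arcs E" and s: "s \<in> {0..1}"
  shows "lagrangian_along H (reversepath \<gamma>) s q = lagrangian_along H \<gamma> (1 - s) q"
proof -
  have *: "H (reversepath \<gamma>) s \<mu> = H \<gamma> (1 - s) (- \<mu>)" for \<mu>
    using H g s by (auto simp: hamiltonians_def)
  define k where "k = (q \<bullet> arc_deriv \<gamma> (1 - s)) / (norm (arc_deriv \<gamma> (1 - s)))\<^sup>2"
  have "range (\<lambda>\<mu>. (- k) * \<mu> - H \<gamma> (1 - s) (- \<mu>)) = range (\<lambda>\<mu>. k * \<mu> - H \<gamma> (1 - s) \<mu>)"
    (is "range ?f = range ?g")
  proof -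
    have "?f = ?g \<circ> uminus" by auto
    then have "range ?f = ?g ` range uminus" by (metis image_comp)
    then show ?thesis by simp
  qed
  then show ?thesis
    unfolding lagrangian_along_def arc_lagrangian_def arc_deriv_reversepath[OF E g s] *
    by (simp add: k_def)
qed

lemma lagrangian_interior:
  assumes E: "network E" and H: "hamiltonians E H" and g: "\<gamma> \<in> arcs E" and s: "s \<in> {0<..<1}"
    and q: "(\<gamma> s, q) \<in> tangent_bundle E"
  shows "lagrangian E H c (\<gamma> s) q = ereal (lagrangian_along H \<gamma> s q)"
proof -
  define g' where "g' = (SOME g'. g' \<in> arcs E \<and> \<gamma> s \<in> g' ` {0<..<1})"
  have "g' \<in> arcs E \<and> \<gamma> s \<in> g' ` {0<..<1}"
    unfolding g'_def by (rule someI[of _ \<gamma>]) (use g s in auto)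
  then obtain r where g': "g' \<in> arcs E" and r: "r \<in> {0<..<1}" and eq: "\<gamma> s = g' r" by auto
  have i: "inj_on \<gamma> {0..1}" and i': "inj_on g' {0..1}"
    by (rule arcs_inj_on[OF E g], rule arcs_inj_on[OF E g'])
  have inv: "inv_into {0..1} g' (\<gamma> s) = r"
    unfolding eq using i' r by (intro inv_into_f_f) auto
  have "\<gamma> ` {0<..<1} \<inter> g' ` {0..1} \<noteq> {}" using s r eq by force
  then consider "\<gamma> = g'" | "\<gamma> = reversepath g'"
    using E g g' unfolding network_def by blast
  then have "lagrangian_along H g' r q = lagrangian_along H \<gamma> s q"
  proof cases
    case 1
    with eq have "\<gamma> s = \<gamma> r" by simp
    then have "s = r" by (rule inj_onD[OF i]) (use s r in auto)
    with 1 show ?thesis by simp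
  next
    case 2
    then have "g' r = \<gamma> (1 - r)" by (simp add: reversepath_def)
    with eq have "\<gamma> s = \<gamma> (1 - r)" by simp
    then have "s = 1 - r" by (rule inj_onD[OF i]) (use s r in auto)
    with 2 lagrangian_along_reversepath[OF E H g', of s q] s show ?thesis by simp
  qed
  then show ?thesis
    using q interior_not_vertex[OF E g s] inv
    by (simp add: lagrangian_def g'_def[symmetric])
qed

end

theory Submission
  imports Defs
begin

text \<open>
  On a piece where an admissible minimizer \<open>\<xi>\<close> avoids the vertices it stays in one arc \<open>\<gamma>\<close>, so
  \<open>\<xi> = \<gamma> \<circ> s\<close> with \<open>s\<close> absolutely continuous, because \<open>\<gamma>\<close> is bi-Lipschitz. Suppose that \<open>s\<close> is not Lipschitz.
  Then there are arbitrarily short intervals \<open>[u,v]\<close> on which the increment \<open>\<Delta> = |s(v) - s(u)|\<close> is small but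
  much larger than \<open>v - u\<close>. The Lagrangian dominates every affine function \<open>l \<mapsto> p l - max H(\<cdot>, p)\<close>,
  so \<open>\<xi>\<close> spends on \<open>[u,v]\<close> at least about \<open>|p| \<Delta>\<close>, with \<open>|p|\<close> as large as we like. Running through the same
  increment at unit speed takes the time \<open>\<Delta>\<close> and costs only a fixed multiple of \<open>\<Delta>\<close>. The time lost, less than
  \<open>\<Delta>\<close>, is recovered on an interval of length \<open>2 \<Delta>\<close> next to a point where \<open>s\<close> is differentiable: there the
  mean speed is bounded, and moving at constant speed in the remaining time again costs a fixed multiple
  of \<open>\<Delta>\<close>. In between, \<open>\<xi>\<close> is only translated in time. For large \<open>|p|\<close> this contradicts minimality.
\<close>

section \<open>Absolutely continuous functions\<close>

text \<open>An inequality between two actions yields information about short intervals only after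
  the costs of the untouched stretches are cancelled, so the minimal action must first be known to
  be finite. This is what the partition in \<open>admissible\<close> provides: every piece off the
  vertices can be rerun at constant speed and every other piece is at rest, which gives a competitor
  of finite cost. The order of the constants is decisive: the speed bound \<open>R\<close> comes
  from difference quotients next to the point of differentiability, \<open>C\<close> bounds the
  Lagrangian for speeds up to \<open>R\<close>, and only then is the momentum chosen, of size
  \<open>1 + 2 * (C + K)\<close>, where \<open>- K\<close> is a lower bound of the Lagrangian.
  Measurability of the Lagrangian along a curve is never established; additivity over intervals,
  translation invariance and comparison suffice, and these hold for lower integrals. Turning the
  affine lower bound of the Lagrangian into an increment of \<open>s\<close> requires the
  fundamental theorem of calculus for absolutely continuous functions, hence the preliminary work
  with Vitali coverings.\<close>

definition subintervals :: "real \<Rightarrow> real \<Rightarrow> nat \<Rightarrow> (nat \<Rightarrow> real) \<Rightarrow> (nat \<Rightarrow> real) \<Rightarrow> bool" where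
  "subintervals a b n u v \<longleftrightarrow> (\<forall>i<n. a \<le> u i \<and> u i \<le> v i \<and> v i \<le> b) \<and>
     (\<forall>i<n. \<forall>j<n. i \<noteq> j \<longrightarrow> {u i<..<v i} \<inter> {u j<..<v j} = {})"

text \<open>Values in an arbitrary normed space let the same calculus serve the curve in the network
  and its real arc parameter.\<close>

definition ac_on :: "real \<Rightarrow> real \<Rightarrow> (real \<Rightarrow> 'a::real_normed_vector) \<Rightarrow> bool" where
  "ac_on a b f \<longleftrightarrow>
     (\<forall>e>0. \<exists>d>0. \<forall>n u v. subintervals a b n u v \<and> (\<Sum>i<n. v i - u i) < d \<longrightarrow>
        (\<Sum>i<n. norm (f (v i) - f (u i))) < e)"

lemma absolutely_continuous_curve_iff_ac_on: "absolutely_continuous_curve a b f \<longleftrightarrow> ac_on a b f"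
  by (simp add: absolutely_continuous_curve_def ac_on_def subintervals_def conj_assoc)

lemma ac_onD:
  assumes "ac_on a b f" "e > 0"
  shows "\<exists>d>0. \<forall>n u v. subintervals a b n u v \<and> (\<Sum>i<n. v i - u i) < d \<longrightarrow>
        (\<Sum>i<n. norm (f (v i) - f (u i))) < e"
  using assms unfolding ac_on_def by simp

text \<open>For a parameter recovered from its curve, \<open>B\<close> is the Lipschitz constant of
  the inverse of the arc; with \<open>f\<close> the identity, Lipschitz functions are seen to be
  absolutely continuous.\<close>

lemma ac_on_dominated:
  assumes f: "ac_on a b f"
    and le: "\<And>x y. x \<in> {a..b} \<Longrightarrow> y \<in> {a..b} \<Longrightarrow> norm (g x - g y) \<le> B * norm (f x - f y)"
  shows "ac_on a b g"
  unfolding ac_on_def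
proof (intro allI impI)
  fix e :: real assume e: "e > 0"
  \<comment> \<open>\<open>B\<close> may be zero or negative; replacing it by a number of at least 1
    makes \<open>e / B'\<close> a legitimate tolerance.\<close>
  define B' where "B' = max B 1"
  have B': "B' > 0" "B \<le> B'" by (auto simp: B'_def)
  have eB: "e / B' > 0" using e B' by simp
  obtain d where d: "d > 0" and *: "\<forall>n u v. subintervals a b n u v \<and> (\<Sum>i<n. v i - u i) < d \<longrightarrow>
      (\<Sum>i<n. norm (f (v i) - f (u i))) < e / B'"
    using ac_onD[OF f eB] by (elim exE conjE) (rule that)
  have "(\<Sum>i<n. norm (g (v i) - g (u i))) < e"
    if H: "subintervals a b n u v" "(\<Sum>i<n. v i - u i) < d" for n u v
  proof -
    have "(\<Sum>i<n. norm (g (v i) - g (u i))) \<le> (\<Sum>i<n. B' * norm (f (v i) - f (u i)))"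
    proof (rule sum_mono)
      fix i assume "i \<in> {..<n}"
      then have "u i \<in> {a..b}" "v i \<in> {a..b}" using H(1) by (force simp: subintervals_def)+
      then have "norm (g (v i) - g (u i)) \<le> B * norm (f (v i) - f (u i))" using le by blast
      also have "\<dots> \<le> B' * norm (f (v i) - f (u i))" using B' by (intro mult_right_mono) auto
      finally show "norm (g (v i) - g (u i)) \<le> B' * norm (f (v i) - f (u i))" .
    qed
    also have "\<dots> < e" using *[rule_format, OF conjI, OF H] B' by (simp add: sum_distrib_left[symmetric] field_simps)
    finally show ?thesis .
  qed
  with d show "\<exists>d>0. \<forall>n u v. subintervals a b n u v \<and> (\<Sum>i<n. v i - u i) < d \<longrightarrow>
        (\<Sum>i<n. norm (g (v i) - g (u i))) < e" by (intro exI[of _ d]) simp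
qed

lemma ac_on_cong:
  assumes "ac_on a b f" "\<And>x. x \<in> {a..b} \<Longrightarrow> g x = f x"
  shows "ac_on a b g"
  using assms(1) by (rule ac_on_dominated[where B=1]) (simp add: assms(2))

lemma ac_on_id: "ac_on a b (\<lambda>x::real. x)"
  unfolding ac_on_def
proof (intro allI impI)
  fix e :: real assume "e > 0"
  moreover have "(\<Sum>i<n. norm (v i - u i)) = (\<Sum>i<n. v i - u i)" if "subintervals a b n u v" for n u v
    using that by (intro sum.cong) (auto simp: subintervals_def)
  ultimately show "\<exists>d>0. \<forall>n u v. subintervals a b n u v \<and> (\<Sum>i<n. v i - u i) < d \<longrightarrow>
        (\<Sum>i<n. norm (v i - u i)) < e" by (intro exI[of _ e]) auto
qed

lemma ac_on_subset:
  assumes "ac_on a b f" "a \<le> c" "d \<le> b"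
  shows "ac_on c d f"
  unfolding ac_on_def
proof (intro allI impI)
  fix e :: real assume "e > 0"
  have *: "subintervals a b n u v" if "subintervals c d n u v" for n u v
    using that assms(2,3) unfolding subintervals_def by (meson order_trans)
  obtain \<delta> where "\<delta> > 0" and \<delta>: "\<forall>n u v. subintervals a b n u v \<and> (\<Sum>i<n. v i - u i) < \<delta> \<longrightarrow>
      (\<Sum>i<n. norm (f (v i) - f (u i))) < e"
    using ac_onD[OF assms(1) \<open>e > 0\<close>] by (elim exE conjE) (rule that)
  show "\<exists>\<delta>>0. \<forall>n u v. subintervals c d n u v \<and> (\<Sum>i<n. v i - u i) < \<delta> \<longrightarrow>
      (\<Sum>i<n. norm (f (v i) - f (u i))) < e"
    using \<open>\<delta> > 0\<close> \<delta> * by (intro exI[of _ \<delta>]) simp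
qed

lemma ac_on_shift:
  assumes "ac_on a b f"
  shows "ac_on (a + c) (b + c) (\<lambda>x. f (x - c))"
  unfolding ac_on_def
proof (intro allI impI)
  fix e :: real assume "e > 0"
  obtain d where "d > 0" and *: "\<forall>n u v. subintervals a b n u v \<and> (\<Sum>i<n. v i - u i) < d \<longrightarrow>
      (\<Sum>i<n. norm (f (v i) - f (u i))) < e"
    using ac_onD[OF assms \<open>e > 0\<close>] by (elim exE conjE) (rule that)
  moreover have "(\<Sum>i<n. norm (f (v i - c) - f (u i - c))) < e"
    if H: "subintervals (a + c) (b + c) n u v" "(\<Sum>i<n. v i - u i) < d" for n u v
  proof (rule *[rule_format], intro conjI)
    show "subintervals a b n (\<lambda>i. u i - c) (\<lambda>i. v i - c)"
      unfolding subintervals_def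
    proof (intro conjI allI impI)
      fix i j assume ij: "i < n" "j < n" "i \<noteq> j"
      then have "{u i<..<v i} \<inter> {u j<..<v j} = {}" using H(1) by (simp add: subintervals_def)
      then have "x + c \<notin> {u i<..<v i} \<inter> {u j<..<v j}" for x by blast
      then have "x \<notin> {u i - c<..<v i - c} \<inter> {u j - c<..<v j - c}" for x
        by (simp add: diff_less_eq less_diff_eq)
      then show "{u i - c<..<v i - c} \<inter> {u j - c<..<v j - c} = {}" by blast
    next
      fix i assume "i < n"
      with H(1) have "a + c \<le> u i" "u i \<le> v i" "v i \<le> b + c" by (simp_all add: subintervals_def)
      then show "a \<le> u i - c" "u i - c \<le> v i - c" "v i - c \<le> b" by simp_all
    qed
  qed (use H in simp)
  ultimately show "\<exists>d>0. \<forall>n u v. subintervals (a + c) (b + c) n u v \<and> (\<Sum>i<n. v i - u i) < d \<longrightarrow>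
        (\<Sum>i<n. norm (f (v i - c) - f (u i - c))) < e" by (intro exI[of _ d]) simp
qed

text \<open>Every interval is cut at \<open>b\<close> with \<open>min\<close> and
  \<open>max\<close>. An interval on one side leaves a degenerate one on the other, which
  contributes nothing; an interval across \<open>b\<close> is estimated by the triangle inequality
  through \<open>f b\<close>.\<close>

lemma ac_on_join:
  assumes f: "ac_on a b f" and g: "ac_on b c f" and ab: "a \<le> b" "b \<le> c"
  shows "ac_on a c f"
  unfolding ac_on_def
proof (intro allI impI)
  fix e :: real assume "e > 0"
  then have e2: "e / 2 > 0" by simp
  obtain d1 where "d1 > 0" and 1: "\<forall>n u v. subintervals a b n u v \<and> (\<Sum>i<n. v i - u i) < d1 \<longrightarrow>
      (\<Sum>i<n. norm (f (v i) - f (u i))) < e / 2"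
    using ac_onD[OF f e2] by (elim exE conjE) (rule that)
  obtain d2 where "d2 > 0" and 2: "\<forall>n u v. subintervals b c n u v \<and> (\<Sum>i<n. v i - u i) < d2 \<longrightarrow>
      (\<Sum>i<n. norm (f (v i) - f (u i))) < e / 2"
    using ac_onD[OF g e2] by (elim exE conjE) (rule that)
  have "(\<Sum>i<n. norm (f (v i) - f (u i))) < e"
    if H: "subintervals a c n u v" "(\<Sum>i<n. v i - u i) < min d1 d2" for n u v
  proof -
    have le: "a \<le> u i" "u i \<le> v i" "v i \<le> c" if "i < n" for i
      using H(1) that by (auto simp: subintervals_def)
    have dj: "{u i<..<v i} \<inter> {u j<..<v j} = {}" if "i < n" "j < n" "i \<noteq> j" for i j
      using H(1) that by (auto simp: subintervals_def)
    have A: "(\<Sum>i<n. norm (f (min (v i) b) - f (min (u i) b))) < e / 2"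
    proof (rule 1[rule_format], intro conjI)
      have "{min (u k) b<..<min (v k) b} \<subseteq> {u k<..<v k}" for k by (auto simp: min_less_iff_disj)
      with dj have "{min (u i) b<..<min (v i) b} \<inter> {min (u j) b<..<min (v j) b} = {}"
        if "i < n" "j < n" "i \<noteq> j" for i j using that by blast
      moreover have "a \<le> min (u i) b \<and> min (u i) b \<le> min (v i) b \<and> min (v i) b \<le> b" if "i < n" for i
        using le[OF that] ab by auto
      ultimately show "subintervals a b n (\<lambda>i. min (u i) b) (\<lambda>i. min (v i) b)"
        unfolding subintervals_def by blast
      have "(\<Sum>i<n. min (v i) b - min (u i) b) \<le> (\<Sum>i<n. v i - u i)"
      proof (rule sum_mono)
        fix i assume "i \<in> {..<n}"
        then have "u i \<le> v i" using le by auto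
        then show "min (v i) b - min (u i) b \<le> v i - u i" by (auto simp: min_def)
      qed
      then show "(\<Sum>i<n. min (v i) b - min (u i) b) < d1" using H(2) by simp
    qed
    have B: "(\<Sum>i<n. norm (f (max (v i) b) - f (max (u i) b))) < e / 2"
    proof (rule 2[rule_format], intro conjI)
      have "{max (u k) b<..<max (v k) b} \<subseteq> {u k<..<v k}" for k by (auto simp: less_max_iff_disj)
      with dj have "{max (u i) b<..<max (v i) b} \<inter> {max (u j) b<..<max (v j) b} = {}"
        if "i < n" "j < n" "i \<noteq> j" for i j using that by blast
      moreover have "b \<le> max (u i) b \<and> max (u i) b \<le> max (v i) b \<and> max (v i) b \<le> c" if "i < n" for i
        using le[OF that] ab by auto
      ultimately show "subintervals b c n (\<lambda>i. max (u i) b) (\<lambda>i. max (v i) b)"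
        unfolding subintervals_def by blast
      have "(\<Sum>i<n. max (v i) b - max (u i) b) \<le> (\<Sum>i<n. v i - u i)"
      proof (rule sum_mono)
        fix i assume "i \<in> {..<n}"
        then have "u i \<le> v i" using le by auto
        then show "max (v i) b - max (u i) b \<le> v i - u i" by (auto simp: max_def)
      qed
      then show "(\<Sum>i<n. max (v i) b - max (u i) b) < d2" using H(2) by simp
    qed
    have "(\<Sum>i<n. norm (f (v i) - f (u i))) \<le>
        (\<Sum>i<n. norm (f (min (v i) b) - f (min (u i) b)) + norm (f (max (v i) b) - f (max (u i) b)))"
    proof (rule sum_mono)
      fix i assume "i \<in> {..<n}"
      then have "u i \<le> v i" using le by auto
      then consider "v i \<le> b" | "b \<le> u i" | "u i \<le> b" "b \<le> v i" by linarith
      then show "norm (f (v i) - f (u i)) \<le>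
         norm (f (min (v i) b) - f (min (u i) b)) + norm (f (max (v i) b) - f (max (u i) b))"
      proof cases
        case 3
        then show ?thesis
          using norm_triangle_ineq[of "f b - f (u i)" "f (v i) - f b"] by (simp add: min_def max_def)
      qed (use \<open>u i \<le> v i\<close> in auto)
    qed
    also have "\<dots> < e" using A B by (simp add: sum.distrib)
    finally show ?thesis .
  qed
  then show "\<exists>d>0. \<forall>n u v. subintervals a c n u v \<and> (\<Sum>i<n. v i - u i) < d \<longrightarrow>
        (\<Sum>i<n. norm (f (v i) - f (u i))) < e"
    by (intro exI[of _ "min d1 d2"]) (simp add: \<open>d1 > 0\<close> \<open>d2 > 0\<close>)
qed

text \<open>Vitali coverings and tagged divisions supply sets of closed intervals instead of indexed
  endpoints. Enumerating a division gives a family admissible for \<open>subintervals\<close>,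
  because the interiors are disjoint.\<close>

lemma ac_on_division:
  assumes f: "ac_on a b f" and "e > 0"
  shows "\<exists>d>0. \<forall>D. D division_of \<Union>D \<and> \<Union>D \<subseteq> {a..b} \<and> sum (measure lborel) D < d \<longrightarrow>
       (\<Sum>K\<in>D. norm (f (Sup K) - f (Inf K))) < e"
proof -
  obtain d where "d > 0" and *: "\<forall>n u v. subintervals a b n u v \<and> (\<Sum>i<n. v i - u i) < d \<longrightarrow>
      (\<Sum>i<n. norm (f (v i) - f (u i))) < e"
    using ac_onD[OF assms] by (elim exE conjE) (rule that)
  show ?thesis
  proof (intro exI[of _ d] conjI allI impI \<open>d > 0\<close>, elim conjE)
    fix D assume D: "D division_of \<Union>D" and sub: "\<Union>D \<subseteq> {a..b}" and small: "sum (measure lborel) D < d"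
    note D' = division_ofD[OF D]
    obtain h where h: "bij_betw h {..<card D} D"
      using ex_bij_betw_nat_finite[OF D'(1)] by (auto simp: atLeast0LessThan)
    have int: "\<exists>x y. x \<le> y \<and> K = {x..y} \<and> Inf K = x \<and> Sup K = y" if "K \<in> D" for K
    proof -
      obtain x y where "K = cbox x y" "K \<noteq> {}" using D'(3,4)[OF \<open>K \<in> D\<close>] by blast
      then show ?thesis by (auto simp: cbox_interval)
    qed
    have hD: "h i \<in> D" if "i < card D" for i using h that by (auto simp: bij_betw_def)
    have "(\<Sum>i<card D. norm (f (Sup (h i)) - f (Inf (h i)))) < e"
    proof (rule *[rule_format], intro conjI)
      have "a \<le> Inf (h i) \<and> Inf (h i) \<le> Sup (h i) \<and> Sup (h i) \<le> b" if i: "i < card D" for i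
      proof -
        have "h i \<subseteq> {a..b}" using hD[OF i] sub by blast
        moreover obtain x y where "x \<le> y" "h i = {x..y}" "Inf (h i) = x" "Sup (h i) = y"
          using int[OF hD[OF i]] by (elim exE conjE) (rule that)
        ultimately show ?thesis by simp
      qed
      moreover have "{Inf (h i)<..<Sup (h i)} \<inter> {Inf (h j)<..<Sup (h j)} = {}"
        if ij: "i < card D" "j < card D" "i \<noteq> j" for i j
      proof -
        have "h i \<noteq> h j" using h ij by (auto simp: bij_betw_def inj_on_def)
        then have dj: "interior (h i) \<inter> interior (h j) = {}" using D'(5) hD ij by blast
        have "interior (h k) = {Inf (h k)<..<Sup (h k)}" if k: "k < card D" for k
        proof -
          obtain x y where "x \<le> y" "h k = {x..y}" "Inf (h k) = x" "Sup (h k) = y"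
            using int[OF hD[OF k]] by (elim exE conjE) (rule that)
          then show ?thesis by simp
        qed
        with ij have "interior (h i) = {Inf (h i)<..<Sup (h i)}" "interior (h j) = {Inf (h j)<..<Sup (h j)}" by auto
        with dj show ?thesis by simp
      qed
      ultimately show "subintervals a b (card D) (\<lambda>i. Inf (h i)) (\<lambda>i. Sup (h i))"
        unfolding subintervals_def by blast
      have "(\<Sum>i<card D. Sup (h i) - Inf (h i)) = (\<Sum>K\<in>D. Sup K - Inf K)"
        using h by (rule sum.reindex_bij_betw)
      also have "\<dots> = sum (measure lborel) D"
      proof (rule sum.cong[OF refl])
        fix K assume "K \<in> D"
        then obtain x y where "x \<le> y" "K = {x..y}" "Inf K = x" "Sup K = y"
          using int[of K] by blast
        then show "Sup K - Inf K = measure lborel K" by simp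
      qed
      finally show "(\<Sum>i<card D. Sup (h i) - Inf (h i)) < d" using small by simp
    qed
    moreover have "(\<Sum>i<card D. norm (f (Sup (h i)) - f (Inf (h i)))) = (\<Sum>K\<in>D. norm (f (Sup K) - f (Inf K)))"
      using h by (rule sum.reindex_bij_betw)
    ultimately show "(\<Sum>K\<in>D. norm (f (Sup K) - f (Inf K))) < e" by simp
  qed
qed

lemma ac_on_imp_continuous_on:
  assumes "ac_on a b f"
  shows "continuous_on {a..b} f"
  unfolding continuous_on_iff
proof (intro ballI allI impI)
  fix x e :: real assume x: "x \<in> {a..b}" and "e > 0"
  obtain d where "d > 0" and *: "\<forall>n u v. subintervals a b n u v \<and> (\<Sum>i<n. v i - u i) < d \<longrightarrow>
      (\<Sum>i<n. norm (f (v i) - f (u i))) < e"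
    using ac_onD[OF assms \<open>e > 0\<close>] by (elim exE conjE) (rule that)
  have lt: "norm (f v - f u) < e" if "a \<le> u" "u \<le> v" "v \<le> b" "v - u < d" for u v
    using *[rule_format, of 1 "\<lambda>_. u" "\<lambda>_. v"] that by (simp add: subintervals_def)
  show "\<exists>d>0. \<forall>x'\<in>{a..b}. dist x' x < d \<longrightarrow> dist (f x') (f x) < e"
  proof (intro exI[of _ d] conjI ballI impI \<open>d > 0\<close>)
    fix y assume y: "y \<in> {a..b}" "dist y x < d"
    show "dist (f y) (f x) < e"
    proof (cases "x \<le> y")
      case True with lt[of x y] x y show ?thesis by (simp add: dist_norm)
    next
      case False with lt[of y x] x y show ?thesis by (simp add: dist_norm norm_minus_commute)
    qed
  qed
qed

section \<open>Differentiability almost everywhere and the fundamental theorem of calculus\<close>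

text \<open>Vitali's theorem yields a countable disjoint subfamily missing only a null set of
  \<open>S\<close>. Its union lies in \<open>{a..b}\<close>, so the measure is finite and finitely
  many members exhaust it up to \<open>e\<close>; the other members and the null set are collected
  in \<open>W\<close>. Finiteness of \<open>C\<close> makes absolute continuity applicable.\<close>

lemma vitali_finite_intervals:
  fixes F :: "real set set"
  assumes F: "\<And>K. K \<in> F \<Longrightarrow> \<exists>u v. u < v \<and> K = {u..v} \<and> K \<subseteq> {a..b}"
    and S: "\<And>x d. x \<in> S \<Longrightarrow> 0 < d \<Longrightarrow> \<exists>K\<in>F. x \<in> K \<and> measure lborel K < d"
    and "0 < e"
  obtains C W where "C \<subseteq> F" "finite C" "pairwise disjnt C" "W \<in> lmeasurable" "measure lebesgue W < e"
    "S \<subseteq> \<Union>C \<union> W"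
proof -
  \<comment> \<open>The covering theorem is about balls: midpoint and half-length present each
    interval as one.\<close>
  define m where "m K = (Inf K + Sup K) / 2" for K :: "real set"
  define r where "r K = (Sup K - Inf K) / 2" for K :: "real set"
  have FK: "cball (m K) (r K) = K \<and> 0 < r K \<and> measure lborel K = 2 * r K \<and> K \<in> lmeasurable \<and> K \<subseteq> {a..b}"
    if K: "K \<in> F" for K
  proof -
    obtain u v where uv: "u < v" "K = {u..v}" "K \<subseteq> {a..b}" using F[OF K] by auto
    then show ?thesis by (simp add: m_def r_def cball_eq_atLeastAtMost field_simps)
  qed
  have "0 < r K" if "K \<in> F" for K using FK[OF that] by simp
  moreover have "\<exists>K. K \<in> F \<and> x \<in> cball (m K) (r K) \<and> r K < d" if x: "x \<in> S" "0 < d" for x d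
  proof -
    obtain K where "K \<in> F" "x \<in> K" "measure lborel K < d" using S[OF x] by blast
    with FK[of K] \<open>0 < d\<close> show ?thesis by (intro exI[of _ K]) auto
  qed
  ultimately obtain C where C: "countable C" "C \<subseteq> F"
      "pairwise (\<lambda>i j. disjnt (cball (m i) (r i)) (cball (m j) (r j))) C"
      "negligible (S - (\<Union>i\<in>C. cball (m i) (r i)))"
    by (rule Vitali_covering_theorem_cballs)
  have dj: "pairwise disjnt C"
    using C(2,3) FK by (auto simp: pairwise_def subset_eq)
  have eqU: "(\<Union>i\<in>C. cball (m i) (r i)) = (\<Union>i\<in>C. i)"
    using C(2) FK by (intro SUP_cong) auto
  have Csub: "\<Union>C \<subseteq> {a..b}" using C(2) FK by blast
  have meas: "K \<in> lmeasurable" if "K \<in> C" for K using C(2) FK that by blast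
  have bound: "measure lebesgue (\<Union>D) \<le> measure lebesgue {a..b}" if "D \<subseteq> C" "finite D" for D
    using that meas Csub by (intro measure_mono_fmeasurable) (auto intro!: fmeasurableD sets.finite_Union)
  obtain D where D: "D \<subseteq> C" "finite D" "measure lebesgue (\<Union>C) - e < measure lebesgue (\<Union>D)"
    by (rule measure_countable_Union_approachable[OF C(1) \<open>0 < e\<close> meas bound])
  have "C \<subseteq> sets lebesgue" using meas by (blast dest: fmeasurableD)
  then have "\<Union>C \<in> sets lebesgue" using C(1) by (rule sets.countable_Union[rotated])
  then have UC: "\<Union>C \<in> lmeasurable"
    by (rule fmeasurableI2[OF _ Csub, rotated]) simp
  have "D \<subseteq> lmeasurable" using D(1) meas by blast
  with D(2) have UD: "\<Union>D \<in> lmeasurable" by (rule fmeasurable.finite_Union)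
  define N where "N = S - \<Union>C"
  have N: "negligible N" using C(4) by (simp add: N_def eqU[simplified])
  have "\<Union>D \<subseteq> \<Union>C" using D(1) by blast
  then have "measure lebesgue (\<Union>C - \<Union>D) = measure lebesgue (\<Union>C) - measure lebesgue (\<Union>D)"
    by (rule measurable_measure_Diff[OF UC fmeasurableD[OF UD]])
  with D have lt: "measure lebesgue (\<Union>C - \<Union>D) < e" by simp
  have CD: "\<Union>C - \<Union>D \<in> lmeasurable" using UC UD by (rule fmeasurable.Diff)
  then have W: "(\<Union>C - \<Union>D) \<union> N \<in> lmeasurable"
    using negligible_imp_measurable[OF N] by (rule fmeasurable.Un)
  have "N \<in> null_sets lebesgue" using N by (simp add: negligible_iff_null_sets)
  then have "measure lebesgue ((\<Union>C - \<Union>D) \<union> N) = measure lebesgue (\<Union>C - \<Union>D)"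
    by (rule measure_Un_null_set[OF fmeasurableD[OF CD]])
  with lt have lt': "measure lebesgue ((\<Union>C - \<Union>D) \<union> N) < e" by simp
  show ?thesis
  proof (rule that[OF _ D(2) _ W lt'])
    show "S \<subseteq> \<Union>D \<union> ((\<Union>C - \<Union>D) \<union> N)" by (auto simp: N_def)
    show "D \<subseteq> F" using D(1) C(2) by (rule subset_trans)
    show "pairwise disjnt D" using dj D(1) by (rule pairwise_subset)
  qed
qed

lemma disjnt_intervals_division_of:
  fixes C :: "real set set"
  assumes "finite C" "pairwise disjnt C" "\<And>K. K \<in> C \<Longrightarrow> \<exists>u v. u < v \<and> K = {u..v} \<and> K \<subseteq> {a..b}"
  shows "C division_of \<Union>C"
proof (rule division_ofI)
  fix K1 K2 assume "K1 \<in> C" "K2 \<in> C" "K1 \<noteq> K2"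
  then have "K1 \<inter> K2 = {}" using assms(2) by (auto simp: pairwise_def disjnt_def)
  then show "interior K1 \<inter> interior K2 = {}" using interior_subset by blast
next
  fix K assume "K \<in> C"
  then obtain u v where "u < v" "K = {u..v}" using assms(3) by blast
  then show "K \<noteq> {}" "\<exists>a b. K = cbox a b" by (auto simp: cbox_interval)
qed (use assms(1) in auto)

lemma sum_measure_division:
  fixes D :: "real set set"
  assumes "D division_of \<Union>D"
  shows "(\<Sum>K\<in>D. measure lborel K) = measure lebesgue (\<Union>D)" "\<Union>D \<in> lmeasurable"
proof -
  note D = division_ofD[OF assms]
  have K: "K \<in> lmeasurable \<and> measure lborel K = measure lebesgue K \<and> convex K" if K: "K \<in> D" for K
    using D(4)[OF K] by auto
  have "negligible (K1 \<inter> K2)" if "K1 \<in> D" "K2 \<in> D" "K1 \<noteq> K2" for K1 K2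
  proof -
    have "convex (K1 \<inter> K2)" using K that by (intro convex_Int) auto
    moreover have "interior (K1 \<inter> K2) = {}" using D(5)[OF that] by simp
    ultimately show ?thesis by (simp add: negligible_convex_interior)
  qed
  then have "pairwise (\<lambda>S T. negligible (S \<inter> T)) D" by (simp add: pairwise_def)
  then have "measure lebesgue (\<Union>D) = (\<Sum>K\<in>D. measure lebesgue K)"
    using D(1) K by (intro measure_negligible_finite_Union) auto
  also have "\<dots> = (\<Sum>K\<in>D. measure lborel K)" using K by (intro sum.cong) auto
  finally show "(\<Sum>K\<in>D. measure lborel K) = measure lebesgue (\<Union>D)" ..
  have "D \<subseteq> lmeasurable" using K by blast
  with D(1) show "\<Union>D \<in> lmeasurable" by (rule fmeasurable.finite_Union)
qed

lemma division_telescope: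
  fixes f :: "real \<Rightarrow> real"
  assumes "q division_of {u..v}" "u \<le> v"
  shows "(\<Sum>K\<in>q. f (Sup K) - f (Inf K)) = f v - f u"
proof -
  note q = division_ofD[OF assms(1)]
  define p where "p = (\<lambda>K. (Inf K, K)) ` q"
  have "p tagged_division_of {u..v}"
  proof (rule tagged_division_ofI)
    show "finite p" using q(1) by (simp add: p_def)
    show "\<Union> {K. \<exists>x. (x, K) \<in> p} = {u..v}"
      unfolding p_def q(6)[symmetric] by (auto intro: imageI)
  next
    fix x K assume "(x, K) \<in> p"
    then have K: "K \<in> q" "x = Inf K" by (auto simp: p_def)
    then show "K \<subseteq> {u..v}" "\<exists>a b. K = cbox a b" using q(2,4) by auto
    obtain c d where "K = cbox c d" using q(4) K(1) by blast
    then show "x \<in> K" using q(3)[OF K(1)] K(2) by (auto simp: cbox_interval)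
  next
    fix x1 K1 x2 K2 assume "(x1, K1) \<in> p" "(x2, K2) \<in> p" "(x1, K1) \<noteq> (x2, K2)"
    then show "interior K1 \<inter> interior K2 = {}" using q(5)[of K1 K2] by (auto simp: p_def)
  qed
  then have "(\<Sum>(x, K)\<in>p. f (Sup K) - f (Inf K)) = f v - f u"
    by (rule additive_tagged_division_1[OF assms(2)])
  moreover have "(\<Sum>(x, K)\<in>p. f (Sup K) - f (Inf K)) = (\<Sum>K\<in>q. f (Sup K) - f (Inf K))"
    unfolding p_def by (subst sum.reindex) (auto intro: inj_onI)
  ultimately show ?thesis by simp
qed

text \<open>The intervals contain \<open>t\<close> but need not start or end there, so over a set of
  such \<open>t\<close> they form a Vitali cover. With a slope condition for \<open>P\<close> this
  takes the place of statements about Dini derivates.\<close>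

definition frequently_near :: "real \<Rightarrow> real \<Rightarrow> (real \<Rightarrow> real \<Rightarrow> bool) \<Rightarrow> real \<Rightarrow> bool" where
  "frequently_near a b P t \<longleftrightarrow>
     (\<forall>d>0. \<exists>u v. a \<le> u \<and> u \<le> t \<and> t \<le> v \<and> v \<le> b \<and> u < v \<and> v - u < d \<and> P u v)"

lemma frequently_nearD:
  "frequently_near a b P t \<Longrightarrow> 0 < d \<Longrightarrow>
     \<exists>u v. a \<le> u \<and> u \<le> t \<and> t \<le> v \<and> v \<le> b \<and> u < v \<and> v - u < d \<and> P u v"
  by (simp add: frequently_near_def)

text \<open>Short intervals around a point of \<open>S\<close> stay in the open set
  \<open>U\<close>; the measure of \<open>U\<close> therefore bounds the total length of the
  disjoint family.\<close>

lemma vitali_frequently_near: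
  assumes S: "\<And>t. t \<in> S \<Longrightarrow> frequently_near a b P t"
    and U: "open U" "S \<subseteq> U" and "e > 0"
  obtains C W where "finite C" "pairwise disjnt C" "W \<in> lmeasurable" "measure lebesgue W < e"
    "S \<subseteq> \<Union>C \<union> W"
    "\<forall>K\<in>C. \<exists>u v. u < v \<and> K = {u..v} \<and> K \<subseteq> {a..b} \<and> K \<subseteq> U \<and> P u v"
proof -
  define F where "F = {K. \<exists>u v. u < v \<and> K = {u..v} \<and> K \<subseteq> {a..b} \<and> K \<subseteq> U \<and> P u v}"
  have "\<exists>u v. u < v \<and> K = {u..v} \<and> K \<subseteq> {a..b}" if "K \<in> F" for K
    using that unfolding F_def by blast
  moreover have "\<exists>K\<in>F. x \<in> K \<and> measure lborel K < d" if x: "x \<in> S" "0 < d" for x d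
  proof -
    obtain \<delta> where \<delta>: "\<delta> > 0" "ball x \<delta> \<subseteq> U" using U x by (meson open_contains_ball subsetD)
    have "\<exists>u v. a \<le> u \<and> u \<le> x \<and> x \<le> v \<and> v \<le> b \<and> u < v \<and> v - u < min d \<delta> \<and> P u v"
      using S x \<delta> by (intro frequently_nearD) auto
    then obtain u v where uv: "a \<le> u" "u \<le> x" "x \<le> v" "v \<le> b" "u < v" "v - u < min d \<delta>" "P u v"
      by (elim exE conjE) (rule that)
    then have "{u..v} \<subseteq> ball x \<delta>" by (auto simp: dist_real_def)
    with uv \<delta> have "{u..v} \<in> F" unfolding F_def by auto
    with uv show ?thesis by (intro bexI[of _ "{u..v}"]) auto
  qed
  ultimately obtain C W where CW: "C \<subseteq> F" "finite C" "pairwise disjnt C" "W \<in> lmeasurable" "measure lebesgue W < e"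
    "S \<subseteq> \<Union>C \<union> W"
    using \<open>e > 0\<close> by (rule vitali_finite_intervals)
  show ?thesis
    by (rule that[OF CW(2-6)]) (use CW(1) in \<open>auto simp: F_def\<close>)
qed

text \<open>On disjoint intervals of slope above \<open>n\<close> the increments exceed
  \<open>n\<close> times the total length. Absolute continuity keeps them below 1 once the total
  length is below \<open>d\<close>, so that length is less than \<open>1 / n\<close>, for every
  \<open>n\<close>. Negligibility is a local property, which allows restriction to short
  balls.\<close>

lemma negligible_steep:
  fixes f :: "real \<Rightarrow> real"
  assumes f: "ac_on a b f"
  shows "negligible {t. \<forall>n::nat. frequently_near a b (\<lambda>u v. \<bar>f v - f u\<bar> > real n * (v - u)) t}"
    (is "negligible ?E")
proof -
  obtain d where "d > 0" and d: "\<forall>D. D division_of \<Union>D \<and> \<Union>D \<subseteq> {a..b} \<and> sum (measure lborel) D < d \<longrightarrow>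
       (\<Sum>K\<in>D. \<bar>f (Sup K) - f (Inf K)\<bar>) < 1"
    using ac_on_division[OF f zero_less_one, unfolded real_norm_def] by (elim exE conjE) (rule that)
  \<comment> \<open>The ball has length \<open>2 * d / 3\<close>, so every disjoint family of
    intervals inside it satisfies the smallness condition.\<close>
  have loc: "negligible (?E \<inter> ball x (d / 3))" for x
    unfolding negligible_outer
  proof (intro allI impI)
    fix e :: real assume "e > 0"
    obtain n :: nat where n: "2 / e < n" using reals_Archimedean2 by blast
    have "0 < 2 / e" using \<open>e > 0\<close> by simp
    then have n0: "0 < real n" using n by (rule less_trans)
    have near: "frequently_near a b (\<lambda>u v. \<bar>f v - f u\<bar> > real n * (v - u)) t" if "t \<in> ?E \<inter> ball x (d / 3)" for t
      using that by simp
    obtain C W where CW: "finite C" "pairwise disjnt C" "W \<in> lmeasurable" "measure lebesgue W < e / 2"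
      "?E \<inter> ball x (d / 3) \<subseteq> \<Union>C \<union> W"
      and K: "\<forall>K\<in>C. \<exists>u v. u < v \<and> K = {u..v} \<and> K \<subseteq> {a..b} \<and> K \<subseteq> ball x (d / 3) \<and> \<bar>f v - f u\<bar> > real n * (v - u)"
      by (rule vitali_frequently_near[where S="?E \<inter> ball x (d / 3)" and P="\<lambda>u v. \<bar>f v - f u\<bar> > real n * (v - u)", OF near open_ball Int_lower2 half_gt_zero[OF \<open>e > 0\<close>]])
    have K': "\<exists>u v. u < v \<and> K = {u..v} \<and> K \<subseteq> {a..b}" if "K \<in> C" for K
      using bspec[OF K that] by (elim exE conjE) (intro exI conjI)
    have KB: "K \<subseteq> ball x (d / 3)" if "K \<in> C" for K
      using bspec[OF K that] by (elim exE conjE)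
    have div: "C division_of \<Union>C" by (rule disjnt_intervals_division_of[OF CW(1,2) K'])
    note seq = sum_measure_division(1)[OF div] and UC = sum_measure_division(2)[OF div]
    have "measure lebesgue (\<Union>C) \<le> measure lebesgue (ball x (d / 3))"
    proof (rule measure_mono_fmeasurable)
      show "\<Union>C \<subseteq> ball x (d / 3)" using KB by (rule Union_least)
    qed (use UC in \<open>simp_all add: fmeasurableD\<close>)
    also have "\<dots> < d" using \<open>d > 0\<close> by (simp add: ball_eq_greaterThanLessThan)
    finally have "sum (measure lborel) C < d" unfolding seq .
    then have "(\<Sum>K\<in>C. \<bar>f (Sup K) - f (Inf K)\<bar>) < 1"
    proof (intro d[rule_format] conjI div)
      show "\<Union>C \<subseteq> {a..b}"
      proof (rule Union_least)
        fix I assume "I \<in> C"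
        from K'[OF this] show "I \<subseteq> {a..b}" by (elim exE conjE)
      qed
    qed
    moreover have "(\<Sum>K\<in>C. real n * measure lborel K) \<le> (\<Sum>K\<in>C. \<bar>f (Sup K) - f (Inf K)\<bar>)"
    proof (rule sum_mono)
      fix I assume "I \<in> C"
      obtain u v where "u < v" "I = {u..v}" "\<bar>f v - f u\<bar> > real n * (v - u)"
        using bspec[OF K \<open>I \<in> C\<close>] by (elim exE conjE) (rule that)
      then show "real n * measure lborel I \<le> \<bar>f (Sup I) - f (Inf I)\<bar>" by simp
    qed
    ultimately have "real n * measure lebesgue (\<Union>C) < 1" unfolding seq[symmetric] sum_distrib_left by linarith
    then have "measure lebesgue (\<Union>C) < 1 / real n" using n0 by (simp add: field_simps)
    also have "\<dots> < e / 2"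
    proof -
      have "2 < real n * e" using n \<open>e > 0\<close> by (simp add: divide_less_eq)
      then show ?thesis using n0 by (simp add: divide_less_eq mult.commute)
    qed
    finally have "measure lebesgue (\<Union>C \<union> W) < e"
      using measure_Un_le[OF fmeasurableD[OF UC] fmeasurableD[OF CW(3)]] CW(4) by linarith
    moreover have "\<Union>C \<union> W \<in> lmeasurable" using UC CW(3) by (rule fmeasurable.Un)
    ultimately show "\<exists>T. ?E \<inter> ball x (d / 3) \<subseteq> T \<and> T \<in> lmeasurable \<and> measure lebesgue T < e"
      using CW(5) by (intro exI conjI)
  qed
  show "negligible ?E"
  proof (rule locally_negligible_alt[THEN iffD2], rule ballI)
    fix x assume "x \<in> ?E"
    show "\<exists>U. openin (top_of_set ?E) U \<and> x \<in> U \<and> negligible U"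
    proof (intro exI conjI)
      show "openin (top_of_set ?E) (?E \<inter> ball x (d / 3))" by (rule openin_open_Int) simp
      show "x \<in> ?E \<inter> ball x (d / 3)" using \<open>x \<in> ?E\<close> \<open>d > 0\<close> by (intro IntI) simp_all
    qed (rule loc)
  qed
qed


lemma frequently_near_localize:
  assumes "frequently_near a b P t" "ball t \<delta> \<subseteq> I" "\<delta> > 0"
  shows "frequently_near a b (\<lambda>u v. P u v \<and> {u..v} \<subseteq> I) t"
  unfolding frequently_near_def
proof (intro allI impI)
  fix d :: real assume "d > 0"
  then obtain u v where uv: "a \<le> u" "u \<le> t" "t \<le> v" "v \<le> b" "u < v" "v - u < min d \<delta>" "P u v"
    using frequently_nearD[OF assms(1), of "min d \<delta>"] assms(3) by auto
  then have "{u..v} \<subseteq> ball t \<delta>" by (auto simp: dist_real_def)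
  then have "{u..v} \<subseteq> I" using assms(2) by (rule subset_trans)
  with uv show "\<exists>u v. a \<le> u \<and> u \<le> t \<and> t \<le> v \<and> v \<le> b \<and> u < v \<and> v - u < d \<and> P u v \<and> {u..v} \<subseteq> I"
    by (intro exI[of _ u] exI[of _ v]) simp
qed

lemma frequently_near_in: "frequently_near a b P t \<Longrightarrow> t \<in> {a..b}"
  using frequently_nearD[of a b P t 1] by auto

text \<open>Cover the exceptional set efficiently by short intervals of slope below \<open>p\<close>, and inside
  these by intervals of slope above \<open>q\<close>. What is left of the first family has small total length,
  hence carries a small increment of \<open>f\<close>, and the two increments cannot be reconciled.\<close>
lemma negligible_oscillating:
  fixes f :: "real \<Rightarrow> real"
  assumes f: "ac_on a b f" and pq: "p < q"
  shows "negligible {t. frequently_near a b (\<lambda>u v. f v - f u < p * (v - u)) t \<and>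
                        frequently_near a b (\<lambda>u v. f v - f u > q * (v - u)) t}"
    (is "negligible ?E")
proof -
  define E where "E = ?E"
  have E1: "frequently_near a b (\<lambda>u v. f v - f u < p * (v - u)) t"
    and E2: "frequently_near a b (\<lambda>u v. f v - f u > q * (v - u)) t" if "t \<in> E" for t
    using that by (simp_all add: E_def)
  have Eab: "E \<subseteq> {a..b}" using frequently_near_in[OF E1] by blast
  \<comment> \<open>\<open>E\<close> is not known to be measurable, so it is enclosed in a
    measurable hull of equal outer measure; every measurable set containing \<open>E\<close> then
    has measure at least \<open>e0\<close>.\<close>
  obtain M where M: "M \<in> sets lebesgue" "E \<subseteq> M" "outer_measure_of lebesgue E = emeasure lebesgue M"
    using outer_measure_of_attain[of E lebesgue] by auto
  have "emeasure lebesgue M \<le> emeasure lebesgue {a..b}"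
    using outer_measure_of_mono[OF Eab, of lebesgue] M(3) by simp
  also have "\<dots> < \<infinity>" using fmeasurableD2[of "{a..b}" lebesgue] by (simp add: less_top)
  finally have Mm: "M \<in> lmeasurable" using M(1) by (simp add: fmeasurable_def)
  define e0 where "e0 = measure lebesgue M"
  have least: "e0 \<le> measure lebesgue S" if S: "S \<in> lmeasurable" "E \<subseteq> S" for S
  proof -
    have "emeasure lebesgue M \<le> emeasure lebesgue S"
      using outer_measure_of_mono[OF S(2), of lebesgue] M(3) S(1) by (simp add: fmeasurableD)
    then show ?thesis using Mm S(1) by (simp add: emeasure_eq_measure2 e0_def)
  qed
  have "e0 = 0"
  proof (rule ccontr)
    assume "e0 \<noteq> 0"
    then have e0: "e0 > 0" by (simp add: e0_def zero_less_measure_iff)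
    define h where "h = q - p"
    have h: "h > 0" using pq by (simp add: h_def)
    have he: "h * e0 / 2 > 0" using h e0 by simp
    obtain \<delta> where "\<delta> > 0" and \<delta>: "\<forall>D. D division_of \<Union>D \<and> \<Union>D \<subseteq> {a..b} \<and> sum (measure lborel) D < \<delta> \<longrightarrow>
       (\<Sum>K\<in>D. \<bar>f (Sup K) - f (Inf K)\<bar>) < h * e0 / 2"
      using ac_on_division[OF f he, unfolded real_norm_def] by (elim exE conjE) (rule that)
    \<comment> \<open>The remainder, of length below \<open>3 * \<epsilon>\<close>, must be shorter
      than \<open>\<delta>\<close>; the length covered by \<open>D\<close>, above
      \<open>e0 - 2 * \<epsilon>\<close>, must be at least \<open>3 / 4 * e0\<close>; and
      \<open>\<bar>p\<bar> * (3 * \<epsilon>)\<close> must be at most \<open>h * e0 / 8\<close>. The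
      final contradiction is then \<open>3 / 4 < 1 / 2 + 1 / 8\<close>, in units of
      \<open>h * e0\<close>.\<close>
    define \<epsilon> where "\<epsilon> = min (\<delta> / 4) (min (e0 / 8) (h * e0 / (24 * (\<bar>p\<bar> + 1))))"
    have eps: "\<epsilon> > 0" using \<open>\<delta> > 0\<close> e0 h by (simp add: \<epsilon>_def)
    have eps1: "\<epsilon> \<le> \<delta> / 4" "\<epsilon> \<le> e0 / 8" unfolding \<epsilon>_def by linarith+
    have "\<epsilon> \<le> h * e0 / (24 * (\<bar>p\<bar> + 1))" by (simp add: \<epsilon>_def)
    then have "\<epsilon> * (24 * (\<bar>p\<bar> + 1)) \<le> h * e0" by (simp add: pos_le_divide_eq)
    then have eps2: "24 * (\<bar>p\<bar> * \<epsilon>) \<le> h * e0" using eps by (simp add: algebra_simps)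
    obtain U where U: "open U" "M \<subseteq> U" "U - M \<in> lmeasurable" "emeasure lebesgue (U - M) < ennreal \<epsilon>"
      by (rule sets_lebesgue_outer_open[OF M(1) eps])
    have UM: "U = M \<union> (U - M)" using U(2) by blast
    have Um: "U \<in> lmeasurable" using fmeasurable.Un[OF Mm U(3)] UM by simp
    have "measure lebesgue (U - M) < \<epsilon>"
      using U(3,4) eps by (simp add: emeasure_eq_measure2 ennreal_less_iff)
    then have Ule: "measure lebesgue U < e0 + \<epsilon>"
      using measure_Un_le[OF M(1) fmeasurableD[OF U(3)]] UM by (simp add: e0_def)
    have EU: "E \<subseteq> U" using M(2) U(2) by (rule subset_trans)
    obtain C W1 where C: "finite C" "pairwise disjnt C" "W1 \<in> lmeasurable" "measure lebesgue W1 < \<epsilon>"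
      "E \<subseteq> \<Union>C \<union> W1"
      and CK: "\<forall>K\<in>C. \<exists>u v. u < v \<and> K = {u..v} \<and> K \<subseteq> {a..b} \<and> K \<subseteq> U \<and> f v - f u < p * (v - u)"
      by (rule vitali_frequently_near[OF E1 U(1) EU eps])
    have CI: "\<exists>u v. u < v \<and> K = {u..v} \<and> K \<subseteq> {a..b}" if "K \<in> C" for K
      using bspec[OF CK that] by (elim exE conjE) (intro exI conjI)
    have CU: "K \<subseteq> U" if "K \<in> C" for K
      using bspec[OF CK that] by (elim exE conjE)
    \<comment> \<open>Steep intervals around a point can be nested in a member of \<open>C\<close>
      if the point is interior to it; the finitely many endpoints of \<open>C\<close> are covered
      separately by the null set \<open>Z\<close>.\<close>
    define P2 where "P2 u v \<longleftrightarrow> f v - f u > q * (v - u) \<and> (\<exists>I\<in>C. {u..v} \<subseteq> I)" for u v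
    define E' where "E' = E \<inter> \<Union>(interior ` C)"
    have near2: "frequently_near a b P2 t" if "t \<in> E'" for t
    proof -
      obtain I where I: "I \<in> C" "t \<in> interior I" and "t \<in> E" using \<open>t \<in> E'\<close> by (auto simp: E'_def)
      obtain r where r: "r > 0" "ball t r \<subseteq> I" using I(2) by (auto simp: mem_interior)
      have "frequently_near a b (\<lambda>u v. f v - f u > q * (v - u) \<and> {u..v} \<subseteq> I) t"
        by (rule frequently_near_localize[OF E2[OF \<open>t \<in> E\<close>] r(2) r(1)])
      then show ?thesis
        unfolding frequently_near_def P2_def using I(1) by (meson)
    qed
    obtain D W2 where D: "finite D" "pairwise disjnt D" "W2 \<in> lmeasurable" "measure lebesgue W2 < \<epsilon>"
      "E' \<subseteq> \<Union>D \<union> W2"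
      and DK: "\<forall>K\<in>D. \<exists>u v. u < v \<and> K = {u..v} \<and> K \<subseteq> {a..b} \<and> K \<subseteq> UNIV \<and> P2 u v"
      by (rule vitali_frequently_near[OF near2 open_UNIV subset_UNIV eps])
    have DI: "\<exists>u v. u < v \<and> K = {u..v} \<and> K \<subseteq> {a..b}" if "K \<in> D" for K
      using bspec[OF DK that] by (elim exE conjE) (intro exI conjI)
    have DC: "\<exists>I\<in>C. K \<subseteq> I" if "K \<in> D" for K
      using bspec[OF DK that] unfolding P2_def by (elim exE conjE) simp
    note Cdiv = disjnt_intervals_division_of[OF C(1,2) CI]
    note Ddiv = disjnt_intervals_division_of[OF D(1,2) DI]
    define Z where "Z = \<Union>((\<lambda>K. {Inf K, Sup K}) ` C)"
    have "finite Z" using C(1) by (simp add: Z_def)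
    then have Z: "negligible Z" by (rule negligible_finite)
    have cov: "E \<subseteq> ((\<Union>D \<union> W2) \<union> W1) \<union> Z"
    proof
      fix t assume "t \<in> E"
      show "t \<in> ((\<Union>D \<union> W2) \<union> W1) \<union> Z"
      proof (cases "t \<in> W1 \<or> t \<in> Z")
        case False
        then obtain I where I: "I \<in> C" "t \<in> I" using C(5) \<open>t \<in> E\<close> by blast
        obtain u v where "u < v" "I = {u..v}" using CI[OF I(1)] by auto
        then have "t \<in> interior I" using I False by (auto simp: Z_def)
        then have "t \<in> E'" using I(1) \<open>t \<in> E\<close> by (auto simp: E'_def)
        then show ?thesis using D(5) by blast
      qed auto
    qed
    have m1: "\<Union>D \<union> W2 \<in> lmeasurable"
      using sum_measure_division(2)[OF Ddiv] D(3) by (rule fmeasurable.Un)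
    then have m2: "(\<Union>D \<union> W2) \<union> W1 \<in> lmeasurable" using C(3) by (rule fmeasurable.Un)
    have "e0 \<le> measure lebesgue (((\<Union>D \<union> W2) \<union> W1) \<union> Z)"
      using fmeasurable.Un[OF m2 negligible_imp_measurable[OF Z]] cov by (rule least)
    also have "\<dots> = measure lebesgue ((\<Union>D \<union> W2) \<union> W1)"
      using Z by (intro measure_Un_null_set) (simp_all add: negligible_iff_null_sets[symmetric] m2 fmeasurableD)
    also have "\<dots> \<le> measure lebesgue (\<Union>D) + measure lebesgue W2 + measure lebesgue W1"
      using measure_Un_le[OF fmeasurableD[OF m1] fmeasurableD[OF C(3)]]
        measure_Un_le[OF fmeasurableD[OF sum_measure_division(2)[OF Ddiv]] fmeasurableD[OF D(3)]] by linarith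
    finally have Dge: "(\<Sum>K\<in>D. measure lborel K) > e0 - 2 * \<epsilon>"
      using C(4) D(4) sum_measure_division(1)[OF Ddiv] by linarith
    have "measure lebesgue (\<Union>C) \<le> measure lebesgue U"
      by (rule measure_mono_fmeasurable[OF Union_least[OF CU] fmeasurableD[OF sum_measure_division(2)[OF Cdiv]] Um])
    then have Cle: "(\<Sum>K\<in>C. measure lborel K) < e0 + \<epsilon>"
      using Ule sum_measure_division(1)[OF Cdiv] by linarith
    \<comment> \<open>The intervals of \<open>D\<close> inside \<open>I\<close> are completed to a
      division of \<open>I\<close>. Telescoping over it splits the increment over \<open>I\<close>
      into those over \<open>D\<close> and those over the added intervals, which form
      \<open>R\<close>.\<close>
    have "\<exists>Q. {J \<in> D. J \<subseteq> I} \<subseteq> Q \<and> Q division_of I" if I: "I \<in> C" for I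
    proof -
      obtain u v where uv: "I = cbox u v" using CI[OF I] by (auto simp: cbox_interval)
      have "{J \<in> D. J \<subseteq> I} division_of \<Union>{J \<in> D. J \<subseteq> I}"
        by (rule division_of_subset[OF Ddiv Collect_subset])
      moreover have "\<Union>{J \<in> D. J \<subseteq> I} \<subseteq> cbox u v" using uv by auto
      ultimately obtain Q where "{J \<in> D. J \<subseteq> I} \<subseteq> Q" "Q division_of cbox u v"
        by (rule partial_division_extend_interval)
      then show ?thesis using uv by auto
    qed
    then obtain Q where Q: "\<And>I. I \<in> C \<Longrightarrow> {J \<in> D. J \<subseteq> I} \<subseteq> Q I" "\<And>I. I \<in> C \<Longrightarrow> Q I division_of I"
      by metis
    define R where "R = \<Union>(Q ` C) - D"
    have DQ: "D \<subseteq> \<Union>(Q ` C)"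
    proof
      fix J assume "J \<in> D"
      then obtain I where "I \<in> C" "J \<subseteq> I" using DC by blast
      then show "J \<in> \<Union>(Q ` C)" using Q(1)[of I] \<open>J \<in> D\<close> by blast
    qed
    have finQ: "finite (\<Union>(Q ` C))" using C(1) division_ofD(1)[OF Q(2)] by blast
    have Qdisj: "Q I \<inter> Q I' = {}" if "I \<in> C" "I' \<in> C" "I \<noteq> I'" for I I'
    proof -
      have "I \<inter> I' = {}" using C(2) that by (auto simp: pairwise_def disjnt_def)
      then show ?thesis
        using division_ofD(2,3)[OF Q(2)[OF \<open>I \<in> C\<close>]] division_ofD(2)[OF Q(2)[OF \<open>I' \<in> C\<close>]] by blast
    qed
    have sumQ: "(\<Sum>K\<in>\<Union>(Q ` C). g (Sup K) - g (Inf K)) = (\<Sum>I\<in>C. g (Sup I) - g (Inf I))"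
      for g :: "real \<Rightarrow> real"
    proof -
      have "(\<Sum>K\<in>\<Union>(Q ` C). g (Sup K) - g (Inf K)) = (\<Sum>I\<in>C. \<Sum>K\<in>Q I. g (Sup K) - g (Inf K))"
        using C(1) division_ofD(1)[OF Q(2)] Qdisj by (intro sum.UNION_disjoint) auto
      also have "\<dots> = (\<Sum>I\<in>C. g (Sup I) - g (Inf I))"
      proof (rule sum.cong[OF refl])
        fix I assume "I \<in> C"
        obtain u v where "u < v" "I = {u..v}" using CI[OF \<open>I \<in> C\<close>] by auto
        then show "(\<Sum>K\<in>Q I. g (Sup K) - g (Inf K)) = g (Sup I) - g (Inf I)"
          using division_telescope[of "Q I" u v g] Q(2)[OF \<open>I \<in> C\<close>] by simp
      qed
      finally show ?thesis .
    qed
    have sumR: "(\<Sum>K\<in>R. g (Sup K) - g (Inf K)) = (\<Sum>I\<in>C. g (Sup I) - g (Inf I)) - (\<Sum>I\<in>D. g (Sup I) - g (Inf I))"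
      for g :: "real \<Rightarrow> real"
      unfolding R_def sum_diff[OF finQ DQ] sumQ ..
    have QU: "\<Union>(Q ` C) division_of \<Union>(\<Union>(Q ` C))"
    proof (rule division_ofI[OF finQ])
      fix K assume "K \<in> \<Union>(Q ` C)"
      then obtain I where I: "I \<in> C" "K \<in> Q I" by blast
      then show "K \<noteq> {}" "\<exists>a b. K = cbox a b" using division_ofD(3,4)[OF Q(2)] by blast+
    next
      fix K1 K2 assume "K1 \<in> \<Union>(Q ` C)" "K2 \<in> \<Union>(Q ` C)" and ne: "K1 \<noteq> K2"
      then obtain I1 I2 where I: "I1 \<in> C" "K1 \<in> Q I1" "I2 \<in> C" "K2 \<in> Q I2" by blast
      show "interior K1 \<inter> interior K2 = {}"
      proof (cases "I1 = I2")
        case True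
        then show ?thesis using division_ofD(5)[OF Q(2)[OF I(1)]] I ne by blast
      next
        case False
        then have "I1 \<inter> I2 = {}" using C(2) I by (auto simp: pairwise_def disjnt_def)
        moreover have "interior K1 \<subseteq> I1" "interior K2 \<subseteq> I2"
          using division_ofD(2)[OF Q(2)] I interior_subset by (meson subset_trans)+
        ultimately show ?thesis by blast
      qed
    qed auto
    have RQ: "R \<subseteq> \<Union>(Q ` C)" by (auto simp: R_def)
    have Rdiv: "R division_of \<Union>R" by (rule division_of_subset[OF QU RQ])
    have Rab: "\<Union>R \<subseteq> {a..b}"
    proof (rule Union_least)
      fix K assume "K \<in> R"
      then obtain I where I: "I \<in> C" "K \<in> Q I" using RQ by blast
      then have "K \<subseteq> I" using division_ofD(2)[OF Q(2)] by blast
      also have "I \<subseteq> {a..b}" using CI[OF I(1)] by auto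
      finally show "K \<subseteq> {a..b}" .
    qed
    have content: "(\<Sum>K\<in>S. measure lborel K) = (\<Sum>K\<in>S. Sup K - Inf K)" if S: "S division_of \<Union>S" for S :: "real set set"
    proof (rule sum.cong[OF refl])
      fix K assume "K \<in> S"
      obtain u v where "K = cbox u v" "K \<noteq> {}" using division_ofD(3,4)[OF S \<open>K \<in> S\<close>] by auto
      then show "measure lborel K = Sup K - Inf K" by (auto simp: cbox_interval)
    qed
    have "sum (measure lborel) R = (\<Sum>I\<in>C. measure lborel I) - (\<Sum>J\<in>D. measure lborel J)"
      using sumR[of "\<lambda>x. x"] by (simp add: content[OF Rdiv] content[OF Cdiv] content[OF Ddiv])
    then have Rlt: "sum (measure lborel) R < 3 * \<epsilon>" using Dge Cle by linarith
    then have "sum (measure lborel) R < \<delta>" using eps1 \<open>\<delta> > 0\<close> by linarith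
    with \<delta> Rdiv Rab have Rsmall: "(\<Sum>K\<in>R. \<bar>f (Sup K) - f (Inf K)\<bar>) < h * e0 / 2" by blast
    have "\<bar>\<Sum>K\<in>R. f (Sup K) - f (Inf K)\<bar> \<le> (\<Sum>K\<in>R. \<bar>f (Sup K) - f (Inf K)\<bar>)" by (rule sum_abs)
    with Rsmall have R1: "(\<Sum>K\<in>R. f (Sup K) - f (Inf K)) > - (h * e0 / 2)" by linarith
    have C1: "(\<Sum>I\<in>C. f (Sup I) - f (Inf I)) \<le> (\<Sum>I\<in>C. p * measure lborel I)"
    proof (rule sum_mono)
      fix I assume "I \<in> C"
      obtain u v where "u < v" "I = {u..v}" "f v - f u < p * (v - u)"
        using bspec[OF CK \<open>I \<in> C\<close>] by (elim exE conjE) (rule that)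
      then show "f (Sup I) - f (Inf I) \<le> p * measure lborel I" by simp
    qed
    have D1: "(\<Sum>I\<in>D. q * measure lborel I) \<le> (\<Sum>I\<in>D. f (Sup I) - f (Inf I))"
    proof (rule sum_mono)
      fix I assume "I \<in> D"
      obtain u v where "u < v" "I = {u..v}" "P2 u v"
        using bspec[OF DK \<open>I \<in> D\<close>] by (elim exE conjE) (rule that)
      then show "q * measure lborel I \<le> f (Sup I) - f (Inf I)" by (simp add: P2_def)
    qed
    define c d where "c = (\<Sum>I\<in>C. measure lborel I)" and "d = (\<Sum>I\<in>D. measure lborel I)"
    \<comment> \<open>The increments over \<open>C\<close> are those over \<open>D\<close> plus
      those over \<open>R\<close>; the three sums are at most \<open>p * c\<close>, at least
      \<open>q * d\<close>, and above \<open>- (h * e0 / 2)\<close>.\<close>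
    have "q * d - p * c < h * e0 / 2"
      using R1 C1 D1 sumR[of f] by (simp add: c_def d_def sum_distrib_left[symmetric])
    moreover have "h * d = q * d - p * d" "p * (c - d) = p * c - p * d"
      by (simp_all add: h_def algebra_simps)
    ultimately have "h * d < h * e0 / 2 + p * (c - d)" by linarith
    also have "p * (c - d) \<le> \<bar>p\<bar> * (3 * \<epsilon>)"
    proof -
      have "0 \<le> sum (measure lborel) R" by (rule sum_nonneg) simp
      then have "0 \<le> c - d" "c - d \<le> 3 * \<epsilon>"
        using Rlt \<open>sum (measure lborel) R = _\<close> by (simp_all add: c_def d_def)
      then have "\<bar>p\<bar> * (c - d) \<le> \<bar>p\<bar> * (3 * \<epsilon>)" by (intro mult_left_mono) auto
      moreover have "p * (c - d) \<le> \<bar>p\<bar> * (c - d)" using \<open>0 \<le> c - d\<close> by (intro mult_right_mono) auto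
      ultimately show ?thesis by linarith
    qed
    finally have lt: "h * d < h * e0 / 2 + \<bar>p\<bar> * (3 * \<epsilon>)" by simp
    have "h * (3 / 4 * e0) \<le> h * d"
      using h Dge eps1 by (intro mult_left_mono) (auto simp: d_def)
    moreover have "0 < h * e0" using h e0 by simp
    ultimately show False using lt eps2 by (simp add: algebra_simps)
  qed
  then have "negligible M" using Mm by (simp add: negligible_iff_measure e0_def)
  then show ?thesis using M(2) unfolding E_def by (rule negligible_subset)
qed


text \<open>Outside \<open>N1\<close> the slopes near a point are bounded, and outside the sets
  \<open>N2\<close> they cannot keep oscillating across a gap between two rationals. Hence the
  infimum of the eventual upper bounds of the slopes is, up to any \<open>e\<close>, also an
  eventual lower bound.\<close>

lemma ac_on_differentiable_ae:
  fixes f :: "real \<Rightarrow> real"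
  assumes f: "ac_on a b f"
  shows "\<exists>N. negligible N \<and> (\<forall>t\<in>{a<..<b} - N. \<exists>L. (f has_real_derivative L) (at t))"
proof -
  define N1 where "N1 = {t. \<forall>n::nat. frequently_near a b (\<lambda>u v. \<bar>f v - f u\<bar> > real n * (v - u)) t}"
  define N2 where "N2 p q = {t. frequently_near a b (\<lambda>u v. f v - f u < p * (v - u)) t \<and>
                        frequently_near a b (\<lambda>u v. f v - f u > q * (v - u)) t}" for p q
  define N where "N = N1 \<union> \<Union>((\<lambda>(p, q). N2 p q) ` {(p, q) \<in> \<rat> \<times> \<rat>. p < q})"
  have neg1: "negligible N1" unfolding N1_def by (rule negligible_steep[OF f])
  have neg2: "negligible (\<Union>((\<lambda>(p, q). N2 p q) ` {(p, q) \<in> \<rat> \<times> \<rat>. p < q}))"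
  proof (rule negligible_countable_Union)
    have "countable ((\<rat> :: real set) \<times> (\<rat> :: real set))" using countable_rat by (intro countable_SIGMA) auto
    then have "countable {(p, q) \<in> (\<rat> :: real set) \<times> (\<rat> :: real set). p < q}" by (rule countable_subset[rotated]) auto
    then show "countable ((\<lambda>(p, q). N2 p q) ` {(p, q) \<in> \<rat> \<times> \<rat>. p < q})" by (rule countable_image)
    fix S assume "S \<in> (\<lambda>(p, q). N2 p q) ` {(p, q) \<in> \<rat> \<times> \<rat>. p < q}"
    then obtain p q where "p < q" "S = N2 p q" by auto
    then show "negligible S" unfolding N2_def using negligible_oscillating[OF f] by simp
  qed
  have negN: "negligible N" unfolding N_def using neg1 neg2 by (rule negligible_Un)
  have "\<exists>L. (f has_real_derivative L) (at t)" if t: "t \<in> {a<..<b} - N" for t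
  proof -
    have ab: "a < t" "t < b" using t by auto
    \<comment> \<open>The dual of \<open>frequently_near\<close>: a property of all sufficiently
      short intervals around \<open>t\<close>. Such properties can be combined, and they are not
      vacuous because \<open>t\<close> is interior.\<close>
    define near where "near P \<longleftrightarrow> (\<exists>d>0. \<forall>u v. a \<le> u \<and> u \<le> t \<and> t \<le> v \<and> v \<le> b \<and> u < v \<and> v - u < d \<longrightarrow> P u v)" for P
    have not_freq: "near (\<lambda>u v. \<not> P u v)" if "\<not> frequently_near a b P t" for P
      using that unfolding frequently_near_def near_def by meson
    have near_conj: "near (\<lambda>u v. P u v \<and> Q u v)" if PQ: "near P" "near Q" for P Q
    proof -
      obtain d where d: "d > 0" "\<forall>u v. a \<le> u \<and> u \<le> t \<and> t \<le> v \<and> v \<le> b \<and> u < v \<and> v - u < d \<longrightarrow> P u v"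
        using PQ(1) unfolding near_def by (elim exE conjE) (rule that)
      obtain d' where d': "d' > 0" "\<forall>u v. a \<le> u \<and> u \<le> t \<and> t \<le> v \<and> v \<le> b \<and> u < v \<and> v - u < d' \<longrightarrow> Q u v"
        using PQ(2) unfolding near_def by (elim exE conjE) (rule that)
      show ?thesis unfolding near_def using d d' by (intro exI[of _ "min d d'"]) simp
    qed
    have near_ex: "\<exists>u v. u < v \<and> P u v" if "near P" for P
    proof -
      obtain d where d: "d > 0" "\<forall>u v. a \<le> u \<and> u \<le> t \<and> t \<le> v \<and> v \<le> b \<and> u < v \<and> v - u < d \<longrightarrow> P u v"
        using \<open>near P\<close> unfolding near_def by (elim exE conjE) (rule that)
      define v where "v = t + min (d / 2) (b - t)"
      have "t < v" "v \<le> b" "v - t < d" using d(1) ab by (auto simp: v_def min_def)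
      then show ?thesis using d(2) ab by (intro exI[of _ t] exI[of _ v]) simp
    qed
    have "t \<notin> N1" using t by (auto simp: N_def)
    then obtain n :: nat where "\<not> frequently_near a b (\<lambda>u v. \<bar>f v - f u\<bar> > real n * (v - u)) t"
      by (auto simp: N1_def)
    from not_freq[OF this] have bdd: "near (\<lambda>u v. \<bar>f v - f u\<bar> \<le> real n * (v - u))" by (simp add: not_less)
    define A where "A = {q. near (\<lambda>u v. f v - f u \<le> q * (v - u))}"
    have "near (\<lambda>u v. f v - f u \<le> real n * (v - u))"
      using bdd unfolding near_def by (meson abs_le_D1)
    then have Ane: "A \<noteq> {}" by (auto simp: A_def)
    have Alow: "- real n \<le> q" if "q \<in> A" for q
    proof -
      have "near (\<lambda>u v. \<bar>f v - f u\<bar> \<le> real n * (v - u) \<and> f v - f u \<le> q * (v - u))"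
        using near_conj[OF bdd] that by (simp add: A_def)
      then obtain u v where uv: "u < v" "\<bar>f v - f u\<bar> \<le> real n * (v - u)" "f v - f u \<le> q * (v - u)"
        using near_ex by blast
      then have "0 \<le> (q + real n) * (v - u)" by (simp add: algebra_simps)
      with uv(1) have "0 \<le> q + real n" by (simp add: zero_le_mult_iff)
      then show ?thesis by simp
    qed
    then have Abdd: "bdd_below A" by (rule bdd_belowI)
    define L where "L = Inf A"
    have main: "near (\<lambda>u v. (L - e) * (v - u) \<le> f v - f u \<and> f v - f u \<le> (L + e) * (v - u))" if "e > 0" for e
    proof (rule near_conj)
      obtain q where "q \<in> A" "q < L + e" using cInf_less_iff[OF Ane Abdd, of "L + e"] \<open>e > 0\<close> by (auto simp: L_def)
      then have "near (\<lambda>u v. f v - f u \<le> q * (v - u))" by (simp add: A_def)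
      moreover have "q * (v - u) \<le> (L + e) * (v - u)" if "u < v" for u v
        using that \<open>q < L + e\<close> by (intro mult_right_mono) auto
      ultimately show "near (\<lambda>u v. f v - f u \<le> (L + e) * (v - u))"
        unfolding near_def by (meson order_trans)
      \<comment> \<open>Two rationals are squeezed below \<open>L\<close>:
        \<open>q \<notin> A\<close> yields arbitrarily short intervals of slope above
        \<open>q\<close>, and since \<open>t\<close> avoids \<open>N2 p q\<close>, slopes below
        \<open>p\<close> must stop occurring.\<close>
      obtain p where p: "p \<in> \<rat>" "L - e < p" "p < L" using Rats_dense_in_real[of "L - e" L] \<open>e > 0\<close> by auto
      obtain q where q: "q \<in> \<rat>" "p < q" "q < L" using Rats_dense_in_real[of p L] p by auto
      have "q \<notin> A" using cInf_lower[OF _ Abdd] q(3) by (force simp: L_def)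
      then have "\<not> near (\<lambda>u v. f v - f u \<le> q * (v - u))" by (simp add: A_def)
      then have "frequently_near a b (\<lambda>u v. f v - f u > q * (v - u)) t"
        using not_freq[of "\<lambda>u v. f v - f u > q * (v - u)"] by (auto simp: not_less)
      moreover have "t \<notin> N2 p q" using t p q by (auto simp: N_def)
      ultimately have "\<not> frequently_near a b (\<lambda>u v. f v - f u < p * (v - u)) t" by (auto simp: N2_def)
      from not_freq[OF this] have "near (\<lambda>u v. p * (v - u) \<le> f v - f u)" by (simp add: not_less)
      moreover have "(L - e) * (v - u) \<le> p * (v - u)" if "u < v" for u v
        using that p by (intro mult_right_mono) auto
      ultimately show "near (\<lambda>u v. (L - e) * (v - u) \<le> f v - f u)"
        unfolding near_def by (meson order_trans)
    qed
    have "(f has_real_derivative L) (at t)"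
      unfolding DERIV_def LIM_eq
    proof (intro allI impI)
      fix r :: real assume "r > 0"
      then have "r / 2 > 0" by simp
      from main[OF this] obtain d where d: "d > 0" "\<forall>u v. a \<le> u \<and> u \<le> t \<and> t \<le> v \<and> v \<le> b \<and> u < v \<and> v - u < d \<longrightarrow>
          (L - r / 2) * (v - u) \<le> f v - f u \<and> f v - f u \<le> (L + r / 2) * (v - u)"
        unfolding near_def by (elim exE conjE) (rule that)
      define s where "s = min d (min (t - a) (b - t))"
      show "\<exists>s>0. \<forall>x. x \<noteq> 0 \<and> norm (x - 0) < s \<longrightarrow> norm ((f (t + x) - f t) / x - L) < r"
      proof (intro exI[of _ s] conjI allI impI)
        show "s > 0" using d ab by (simp add: s_def)
        fix x :: real assume x: "x \<noteq> 0 \<and> norm (x - 0) < s"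
        have "\<bar>(f (t + x) - f t) / x - L\<bar> \<le> r / 2"
        proof (cases "x > 0")
          case True
          then have "(L - r / 2) * x \<le> f (t + x) - f t \<and> f (t + x) - f t \<le> (L + r / 2) * x"
            using d(2)[rule_format, of t "t + x"] x ab by (auto simp: s_def)
          then have "L - r / 2 \<le> (f (t + x) - f t) / x \<and> (f (t + x) - f t) / x \<le> L + r / 2"
            using True by (simp add: pos_le_divide_eq pos_divide_le_eq)
          then show ?thesis by linarith
        next
          case False
          then have x0: "x < 0" using x by simp
          then have "(L - r / 2) * (- x) \<le> f t - f (t + x) \<and> f t - f (t + x) \<le> (L + r / 2) * (- x)"
            using d(2)[rule_format, of "t + x" t] x ab by (auto simp: s_def)
          then have "L - r / 2 \<le> (f t - f (t + x)) / (- x) \<and> (f t - f (t + x)) / (- x) \<le> L + r / 2"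
            using pos_le_divide_eq[of "- x" "L - r / 2" "f t - f (t + x)"]
              pos_divide_le_eq[of "- x" "f t - f (t + x)" "L + r / 2"] x0 by simp
          moreover have "(f t - f (t + x)) / (- x) = (f (t + x) - f t) / x"
            using x0 by (simp add: field_simps)
          ultimately show ?thesis by linarith
        qed
        with \<open>r > 0\<close> show "norm ((f (t + x) - f t) / x - L) < r" by simp
      qed
    qed
    then show ?thesis ..
  qed
  with negN show ?thesis by blast
qed

text \<open>In a fine tagged division, the intervals tagged in the exceptional null set have small total length,
  so by absolute continuity they contribute little to the increment of \<open>f\<close>.\<close>
lemma ac_on_has_integral:
  fixes f :: "real \<Rightarrow> real"
  assumes f: "ac_on a b f" and ab: "a \<le> b" and N: "negligible N"
    and deriv: "\<And>t. t \<in> {a<..<b} - N \<Longrightarrow> (f has_real_derivative f' t) (at t)"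
  shows "(f' has_integral f b - f a) {a..b}"
proof -
  \<comment> \<open>The derivatives are given at interior points only, so the endpoints join the
    exceptional set, on which the integrand may be replaced by 0.\<close>
  define N' where "N' = N \<union> {a, b}"
  have N': "negligible N'" unfolding N'_def using N by (rule negligible_Un) (simp add: negligible_finite)
  define g where "g t = (if t \<in> N' then 0 else f' t)" for t
  have "(g has_integral f b - f a) {a..b}"
    unfolding has_integral_real
  proof (intro allI impI)
    fix e :: real assume "e > 0"
    then have e2: "e / 2 > 0" by simp
    obtain \<delta> where "\<delta> > 0" and \<delta>: "\<forall>D. D division_of \<Union>D \<and> \<Union>D \<subseteq> {a..b} \<and> sum (measure lborel) D < \<delta> \<longrightarrow>
       (\<Sum>K\<in>D. \<bar>f (Sup K) - f (Inf K)\<bar>) < e / 2"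
      using ac_on_division[OF f e2, unfolded real_norm_def] by (elim exE conjE) (rule that)
    have N'm: "N' \<in> sets lebesgue" "measure lebesgue N' = 0"
      using N' negligible_imp_sets negligible_imp_measure0 by blast+
    obtain U where U: "open U" "N' \<subseteq> U" "U - N' \<in> lmeasurable" "emeasure lebesgue (U - N') < ennreal \<delta>"
      by (rule sets_lebesgue_outer_open[OF N'm(1) \<open>\<delta> > 0\<close>])
    have UM: "U = (U - N') \<union> N'" using U(2) by blast
    have Um: "U \<in> lmeasurable" using fmeasurable.Un[OF U(3) negligible_imp_measurable[OF N']] UM by simp
    have "measure lebesgue (U - N') < \<delta>"
      using U(3,4) \<open>\<delta> > 0\<close> by (simp add: emeasure_eq_measure2 ennreal_less_iff)
    then have Ule: "measure lebesgue U < \<delta>"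
      using measure_Un_le[OF fmeasurableD[OF U(3)] N'm(1)] UM N'm(2) by simp
    \<comment> \<open>Adding 1 to the length keeps the denominator positive for
      \<open>a = b\<close>.\<close>
    define \<epsilon> where "\<epsilon> = e / (4 * (b - a + 1))"
    have eps: "\<epsilon> > 0" using \<open>e > 0\<close> ab by (simp add: \<epsilon>_def)
    have "\<epsilon> * (4 * (b - a + 1)) = e" using ab by (simp add: \<epsilon>_def)
    then have "\<epsilon> * (b - a) + \<epsilon> = e / 4" by (simp add: algebra_simps)
    then have eps2: "\<epsilon> * (b - a) < e / 2" using eps \<open>e > 0\<close> by linarith
    have "\<exists>d>0. \<forall>y. \<bar>y - t\<bar> < d \<longrightarrow> \<bar>f y - f t - f' t * (y - t)\<bar> \<le> \<epsilon> * \<bar>y - t\<bar>" if t: "t \<in> {a..b} - N'" for t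
    proof -
      have "(f has_derivative (*) (f' t)) (at t)"
        using deriv[of t] t by (auto simp: N'_def has_field_derivative_def)
      then show ?thesis using eps unfolding has_derivative_at_alt real_norm_def by blast
    qed
    then obtain r where r: "\<And>t. t \<in> {a..b} - N' \<Longrightarrow> r t > 0"
      "\<And>t y. t \<in> {a..b} - N' \<Longrightarrow> \<bar>y - t\<bar> < r t \<Longrightarrow> \<bar>f y - f t - f' t * (y - t)\<bar> \<le> \<epsilon> * \<bar>y - t\<bar>"
      by metis
    \<comment> \<open>A tag in the null set forces its interval into \<open>U\<close>, of measure
      below \<open>\<delta>\<close>; at any other tag in \<open>{a..b}\<close> the interval stays
      within the radius where the linear approximation has relative error at most
      \<open>\<epsilon>\<close>.\<close>
    define G where "G t = (if t \<in> N' then U else if t \<in> {a..b} then ball t (r t) else ball t 1)" for t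
    have "gauge G"
      using U(1,2) r(1) by (intro gaugeI) (auto simp: G_def)
    moreover have "norm ((\<Sum>(x, K)\<in>p. measure lborel K *\<^sub>R g x) - (f b - f a)) < e"
      if p: "p tagged_division_of {a..b}" "G fine p" for p
    proof -
      note p' = tagged_division_ofD[OF p(1)]
      have int: "\<exists>u v. K = {u..v} \<and> u \<le> x \<and> x \<le> v \<and> a \<le> u \<and> v \<le> b" if xK: "(x, K) \<in> p" for x K
      proof -
        obtain u v where "K = cbox u v" using p'(4)[OF xK] by blast
        with p'(2,3)[OF xK] show ?thesis by (auto simp: cbox_interval)
      qed
      have fineG: "K \<subseteq> G x" if "(x, K) \<in> p" for x K using p(2) that by (auto simp: fine_def)
      define pN where "pN = {z \<in> p. fst z \<in> N'}"
      define pD where "pD = {z \<in> p. fst z \<notin> N'}"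
      have fin: "finite pN" "finite pD" using p'(1) by (simp_all add: pN_def pD_def)
      have split: "p = pN \<union> pD" "pN \<inter> pD = {}" by (auto simp: pN_def pD_def)
      define F where "F = (\<lambda>(x, K). measure lborel K *\<^sub>R g x - (f (Sup K) - f (Inf K)))"
      have "(\<Sum>(x, K)\<in>p. f (Sup K) - f (Inf K)) = f b - f a"
        by (rule additive_tagged_division_1[OF ab p(1)])
      then have "(\<Sum>(x, K)\<in>p. measure lborel K *\<^sub>R g x) - (f b - f a) = sum F p"
        by (simp add: F_def sum_subtractf split_def)
      also have "\<dots> = sum F pN + sum F pD"
        unfolding split(1) using fin split(2) by (intro sum.union_disjoint) auto
      finally have eq: "(\<Sum>(x, K)\<in>p. measure lborel K *\<^sub>R g x) - (f b - f a) = sum F pN + sum F pD" .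
      have partN: "pN tagged_partial_division_of {a..b}"
        using p(1) unfolding tagged_division_of_def by (auto intro: tagged_partial_division_subset simp: pN_def)
      have divN: "(snd ` pN) division_of \<Union>(snd ` pN)"
        by (rule partial_division_of_tagged_division[OF partN])
      have subU: "\<Union>(snd ` pN) \<subseteq> U"
        using fineG by (fastforce simp: pN_def G_def)
      have "measure lebesgue (\<Union>(snd ` pN)) \<le> measure lebesgue U"
        by (rule measure_mono_fmeasurable[OF subU fmeasurableD[OF sum_measure_division(2)[OF divN]] Um])
      then have "sum (measure lborel) (snd ` pN) < \<delta>"
        using Ule sum_measure_division(1)[OF divN] by linarith
      moreover have "\<Union>(snd ` pN) \<subseteq> {a..b}" using p'(3) by (fastforce simp: pN_def)
      ultimately have smallN: "(\<Sum>K\<in>snd ` pN. \<bar>f (Sup K) - f (Inf K)\<bar>) < e / 2"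
        using \<delta> divN by blast
      \<comment> \<open>One interval may carry two tags, but then its interior is empty, so it is a
        single point with zero increment and the two sums agree.\<close>
      have "(\<Sum>K\<in>snd ` pN. \<bar>f (Sup K) - f (Inf K)\<bar>) = (\<Sum>z\<in>pN. \<bar>f (Sup (snd z)) - f (Inf (snd z))\<bar>)"
      proof (subst sum.reindex_nontrivial[OF fin(1)])
        fix z w assume zw: "z \<in> pN" "w \<in> pN" "z \<noteq> w" "snd z = snd w"
        obtain x y K where zw': "z = (x, K)" "w = (y, K)" using zw(4) by (metis prod.collapse)
        have "interior K \<inter> interior K = {}"
          using p'(5)[of x K y K] zw by (auto simp: zw' pN_def)
        moreover obtain u v where "K = {u..v}" "u \<le> v" using int[of x K] zw(1) by (auto simp: zw' pN_def)
        ultimately have "K = {u..v}" "u = v" by auto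
        then show "\<bar>f (Sup (snd z)) - f (Inf (snd z))\<bar> = 0" by (simp add: zw')
      qed (simp add: o_def)
      moreover have "\<bar>sum F pN\<bar> \<le> (\<Sum>z\<in>pN. \<bar>f (Sup (snd z)) - f (Inf (snd z))\<bar>)"
        by (rule order_trans[OF sum_abs], rule sum_mono) (auto simp: F_def pN_def g_def)
      ultimately have bN: "\<bar>sum F pN\<bar> < e / 2" using smallN by linarith
      have "\<bar>sum F pD\<bar> \<le> (\<Sum>z\<in>pD. \<epsilon> * measure lborel (snd z))"
      proof (rule order_trans[OF sum_abs], rule sum_mono)
        fix z assume "z \<in> pD"
        then obtain x K where z: "z = (x, K)" "(x, K) \<in> p" "x \<notin> N'" by (cases z) (auto simp: pD_def)
        obtain u v where K: "K = {u..v}" "u \<le> x" "x \<le> v" "a \<le> u" "v \<le> b" using int[OF z(2)] by auto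
        have x: "x \<in> {a..b} - N'" using K z by auto
        have "K \<subseteq> ball x (r x)" using fineG[OF z(2)] z(3) x by (simp add: G_def)
        then have "\<bar>u - x\<bar> < r x" "\<bar>v - x\<bar> < r x"
          using subsetD[of K "ball x (r x)" u] subsetD[of K "ball x (r x)" v] K by (auto simp: dist_real_def)
        then have "\<bar>f u - f x - f' x * (u - x)\<bar> \<le> \<epsilon> * \<bar>u - x\<bar>" "\<bar>f v - f x - f' x * (v - x)\<bar> \<le> \<epsilon> * \<bar>v - x\<bar>"
          using r(2)[OF x] by blast+
        moreover have "\<epsilon> * \<bar>u - x\<bar> = \<epsilon> * (x - u)" "\<epsilon> * \<bar>v - x\<bar> = \<epsilon> * (v - x)" using K by auto
        ultimately have "\<bar>(v - u) * f' x - (f v - f u)\<bar> \<le> \<epsilon> * (v - u)"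
          by (simp add: algebra_simps abs_le_iff)
        then show "\<bar>F z\<bar> \<le> \<epsilon> * measure lborel (snd z)"
          using K z by (simp add: F_def g_def)
      qed
      also have "\<dots> \<le> (\<Sum>z\<in>p. \<epsilon> * measure lborel (snd z))"
        using p'(1) eps by (intro sum_mono2) (auto simp: pD_def)
      also have "\<dots> = \<epsilon> * (\<Sum>(x, K)\<in>p. measure lborel K)" by (simp add: sum_distrib_left split_def)
      also have "\<dots> = \<epsilon> * (b - a)"
        using additive_content_tagged_division[of p a b] p(1) ab by (simp add: cbox_interval)
      also have "\<dots> < e / 2" by (rule eps2)
      finally show ?thesis using eq bN by (simp add: abs_le_iff)
    qed
    ultimately show "\<exists>G. gauge G \<and> (\<forall>p. p tagged_division_of {a..b} \<and> G fine p \<longrightarrow>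
        norm ((\<Sum>(x, K)\<in>p. measure lborel K *\<^sub>R g x) - (f b - f a)) < e)"
      by (intro exI[of _ G] conjI allI impI) auto
  qed
  moreover have "f' x = g x" if "x \<in> {a..b} - N'" for x using that by (simp add: g_def)
  ultimately show ?thesis using has_integral_spike[OF N'] by blast
qed

section \<open>Lower integrals over intervals\<close>

text \<open>Lower integrals of arbitrary functions are in general only superadditive. Equality holds
  here because the measurable set \<open>A\<close> cuts any simple function below \<open>f\<close>
  into one below each summand.\<close>

lemma nn_integral_split:
  assumes A: "A \<in> sets M"
  shows "(\<integral>\<^sup>+x. f x \<partial>M) = (\<integral>\<^sup>+x. f x * indicator A x \<partial>M) + (\<integral>\<^sup>+x. f x * indicator (- A) x \<partial>M)"
proof (rule antisym)
  \<comment> \<open>\<open>- A\<close> is the complement in the whole type and may fail to be in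
    \<open>sets M\<close>; on \<open>space M\<close> it coincides with
    \<open>space M - A\<close>.\<close>
  have ind: "(\<lambda>x. indicator (- A) x :: ennreal) \<in> borel_measurable M"
  proof -
    have "(\<lambda>x. indicator (space M - A) x :: ennreal) \<in> borel_measurable M" using A by measurable
    moreover have "(\<lambda>x. indicator (space M - A) x :: ennreal) \<in> borel_measurable M
        \<longleftrightarrow> (\<lambda>x. indicator (- A) x :: ennreal) \<in> borel_measurable M"
      by (intro measurable_cong) (auto simp: indicator_def)
    ultimately show ?thesis by simp
  qed
  show "(\<integral>\<^sup>+x. f x \<partial>M) \<le> (\<integral>\<^sup>+x. f x * indicator A x \<partial>M) + (\<integral>\<^sup>+x. f x * indicator (- A) x \<partial>M)"
    unfolding nn_integral_def[of M f]
  proof (rule SUP_least)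
    fix g assume "g \<in> {g. simple_function M g \<and> g \<le> f}"
    then have g: "simple_function M g" "\<And>x. g x \<le> f x" by (auto simp: le_fun_def)
    have gm[measurable]: "g \<in> borel_measurable M" using g(1) by (rule borel_measurable_simple_function)
    have "integral\<^sup>S M g = (\<integral>\<^sup>+x. g x \<partial>M)" using g(1) by (simp add: nn_integral_eq_simple_integral)
    also have "\<dots> = (\<integral>\<^sup>+x. g x * indicator A x + g x * indicator (- A) x \<partial>M)"
      by (intro nn_integral_cong) (auto simp: indicator_def)
    also have "\<dots> = (\<integral>\<^sup>+x. g x * indicator A x \<partial>M) + (\<integral>\<^sup>+x. g x * indicator (- A) x \<partial>M)"
      using A ind by (intro nn_integral_add) auto
    also have "\<dots> \<le> (\<integral>\<^sup>+x. f x * indicator A x \<partial>M) + (\<integral>\<^sup>+x. f x * indicator (- A) x \<partial>M)"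
      using g(2) by (intro add_mono nn_integral_mono mult_right_mono) auto
    finally show "integral\<^sup>S M g \<le> (\<integral>\<^sup>+x. f x * indicator A x \<partial>M) + (\<integral>\<^sup>+x. f x * indicator (- A) x \<partial>M)" .
  qed
  let ?S = "\<lambda>f. {g. simple_function M g \<and> g \<le> f}"
  have ne: "?S h \<noteq> {}" for h :: "'a \<Rightarrow> ennreal"
    by (auto intro!: exI[of _ "\<lambda>_. 0"] simp: le_fun_def)
  have "(\<integral>\<^sup>+x. f x * indicator A x \<partial>M) + (\<integral>\<^sup>+x. f x * indicator (- A) x \<partial>M)
      = (SUP g\<in>?S (\<lambda>x. f x * indicator A x). SUP h\<in>?S (\<lambda>x. f x * indicator (- A) x). integral\<^sup>S M g + integral\<^sup>S M h)"
    unfolding nn_integral_def by (subst ennreal_SUP_add_left[OF ne, symmetric], intro SUP_cong refl ennreal_SUP_add_right[OF ne])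
  also have "\<dots> \<le> (\<integral>\<^sup>+x. f x \<partial>M)"
  proof (intro SUP_least)
    fix g h assume "g \<in> ?S (\<lambda>x. f x * indicator A x)" "h \<in> ?S (\<lambda>x. f x * indicator (- A) x)"
    then have gh: "simple_function M g" "simple_function M h"
      "\<And>x. g x \<le> f x * indicator A x" "\<And>x. h x \<le> f x * indicator (- A) x" by (auto simp: le_fun_def)
    have "integral\<^sup>S M g + integral\<^sup>S M h = (\<integral>\<^sup>+x. g x + h x \<partial>M)"
      using gh(1,2) by (simp add: nn_integral_add borel_measurable_simple_function nn_integral_eq_simple_integral[symmetric])
    also have "\<dots> \<le> (\<integral>\<^sup>+x. f x \<partial>M)"
    proof (rule nn_integral_mono)
      fix x
      have "g x + h x \<le> f x * indicator A x + f x * indicator (- A) x" using gh by (intro add_mono)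
      also have "\<dots> = f x" by (auto simp: indicator_def)
      finally show "g x + h x \<le> f x" .
    qed
    finally show "integral\<^sup>S M g + integral\<^sup>S M h \<le> (\<integral>\<^sup>+x. f x \<partial>M)" .
  qed
  finally show "(\<integral>\<^sup>+x. f x * indicator A x \<partial>M) + (\<integral>\<^sup>+x. f x * indicator (- A) x \<partial>M) \<le> (\<integral>\<^sup>+x. f x \<partial>M)" .
qed

text \<open>One inequality is proved on simple minorants, which are measurable; the other is the
  same inequality for the translated function and the shift \<open>- c\<close>.\<close>

lemma nn_integral_lborel_shift:
  fixes f :: "real \<Rightarrow> ennreal"
  shows "(\<integral>\<^sup>+x. f (x + c) \<partial>lborel) = (\<integral>\<^sup>+x. f x \<partial>lborel)"
proof -
  have le: "(\<integral>\<^sup>+x. f x \<partial>lborel) \<le> (\<integral>\<^sup>+x. f (x + c) \<partial>lborel)" for f :: "real \<Rightarrow> ennreal" and c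
    unfolding nn_integral_def[of lborel f]
  proof (rule SUP_least)
    fix g :: "real \<Rightarrow> ennreal" assume "g \<in> {g. simple_function lborel g \<and> g \<le> f}"
    then have g: "simple_function lborel g" "\<And>x. g x \<le> f x" by (auto simp: le_fun_def)
    have gm[measurable]: "g \<in> borel_measurable borel"
      using borel_measurable_simple_function[OF g(1)] by simp
    have "integral\<^sup>S lborel g = (\<integral>\<^sup>+x. g x \<partial>lborel)" using g(1) by (simp add: nn_integral_eq_simple_integral)
    also have "\<dots> = (\<integral>\<^sup>+x. g x \<partial>distr lborel borel ((+) c))" by (simp add: lborel_distr_plus)
    also have "\<dots> = (\<integral>\<^sup>+x. g (c + x) \<partial>lborel)" by (subst nn_integral_distr) auto
    also have "\<dots> \<le> (\<integral>\<^sup>+x. f (x + c) \<partial>lborel)" using g(2) by (intro nn_integral_mono) (simp add: add.commute)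
    finally show "integral\<^sup>S lborel g \<le> (\<integral>\<^sup>+x. f (x + c) \<partial>lborel)" .
  qed
  show ?thesis using le[of f c] le[of "\<lambda>x. f (x + c)" "- c"] by (simp add: antisym)
qed

text \<open>No measurability is assumed of the integrand; \<open>nn_integral\<close> is then the lower integral, which
  is still additive over intervals and translation invariant.\<close>
definition ival_integral :: "(real \<Rightarrow> ennreal) \<Rightarrow> real \<Rightarrow> real \<Rightarrow> ennreal" where
  "ival_integral F a b = (\<integral>\<^sup>+t. F t * indicator {a<..<b} t \<partial>lborel)"

lemma ival_integral_cong:
  "(\<And>t. t \<in> {a<..<b} \<Longrightarrow> F t = G t) \<Longrightarrow> ival_integral F a b = ival_integral G a b"
  unfolding ival_integral_def by (intro nn_integral_cong) (auto simp: indicator_def)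

lemma ival_integral_split:
  assumes "a \<le> b" "b \<le> c"
  shows "ival_integral F a c = ival_integral F a b + ival_integral F b c"
proof -
  have "ival_integral F a c = (\<integral>\<^sup>+t. F t * indicator {a<..<c} t * indicator {..<b} t \<partial>lborel) +
      (\<integral>\<^sup>+t. F t * indicator {a<..<c} t * indicator (- {..<b}) t \<partial>lborel)"
    unfolding ival_integral_def by (rule nn_integral_split) simp
  also have "(\<integral>\<^sup>+t. F t * indicator {a<..<c} t * indicator {..<b} t \<partial>lborel) = ival_integral F a b"
    unfolding ival_integral_def using assms by (intro nn_integral_cong) (auto simp: indicator_def)
  also have "(\<integral>\<^sup>+t. F t * indicator {a<..<c} t * indicator (- {..<b}) t \<partial>lborel) = ival_integral F b c"
    unfolding ival_integral_def
  proof (rule nn_integral_cong_AE)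
    show "AE t in lborel. F t * indicator {a<..<c} t * indicator (- {..<b}) t = F t * indicator {b<..<c} t"
      using AE_lborel_singleton[of b] by eventually_elim (use assms in \<open>auto simp: indicator_def\<close>)
  qed
  finally show ?thesis .
qed

lemma ival_integral_shift: "ival_integral (\<lambda>t. F (t - e)) (a + e) (b + e) = ival_integral F a b"
proof -
  have "ival_integral F a b = (\<integral>\<^sup>+t. F (t + - e) * indicator {a<..<b} (t + - e) \<partial>lborel)"
    unfolding ival_integral_def by (rule nn_integral_lborel_shift[symmetric])
  also have "\<dots> = ival_integral (\<lambda>t. F (t - e)) (a + e) (b + e)"
    unfolding ival_integral_def by (intro nn_integral_cong) (auto simp: indicator_def)
  finally show ?thesis ..
qed

lemma ival_integral_le_const:
  assumes "a \<le> b" "0 \<le> C" "\<And>t. t \<in> {a<..<b} \<Longrightarrow> F t \<le> ennreal C"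
  shows "ival_integral F a b \<le> ennreal (C * (b - a))"
proof -
  have "ival_integral F a b \<le> (\<integral>\<^sup>+t. ennreal C * indicator {a<..<b} t \<partial>lborel)"
    unfolding ival_integral_def using assms(3) by (intro nn_integral_mono) (auto simp: indicator_def)
  also have "\<dots> = ennreal (C * (b - a))"
    using assms(1,2) by (simp add: nn_integral_cmult_indicator ennreal_mult)
  finally show ?thesis .
qed

text \<open>\<open>F\<close> is compared with the positive part of \<open>w = p * s' - m\<close>.
  Gauge integrability of \<open>w\<close> gives its measurability but no finite integral of the
  positive part; if that integral is infinite nothing remains to be shown, otherwise the positive
  part is integrable and dominates \<open>w\<close>.\<close>

lemma ival_integral_ge_increment:
  fixes s :: "real \<Rightarrow> real"
  assumes s: "ac_on a b s" and ab: "a \<le> b" and N: "negligible N"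
    and deriv: "\<And>t. t \<in> {a<..<b} - N \<Longrightarrow> (s has_real_derivative s' t) (at t)"
    and F: "\<And>t. t \<in> {a<..<b} - N \<Longrightarrow> ennreal (p * s' t - m) \<le> F t"
  shows "ennreal (p * (s b - s a) - m * (b - a)) \<le> ival_integral F a b"
proof -
  define w where "w t = p * s' t - m" for t
  have "(s' has_integral s b - s a) {a..b}" by (rule ac_on_has_integral[OF s ab N deriv])
  then have "((\<lambda>t. p * s' t) has_integral p * (s b - s a)) {a..b}" by (rule has_integral_mult_right)
  moreover have "((\<lambda>t. m) has_integral m * (b - a)) {a..b}"
    using has_integral_const_real[of m a b] ab by (simp add: mult.commute)
  ultimately have w: "(w has_integral p * (s b - s a) - m * (b - a)) {a..b}"
    unfolding w_def by (rule has_integral_diff)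
  then have "w integrable_on {a..b}" by blast
  then have wm[measurable]: "w \<in> borel_measurable (lebesgue_on {a..b})" by (rule integrable_imp_measurable)
  define I where "I = (\<integral>\<^sup>+t. ennreal (max 0 (w t)) \<partial>lebesgue_on {a..b})"
  have "ennreal (p * (s b - s a) - m * (b - a)) \<le> I"
  proof (cases "I = \<infinity>")
    case False
    have int: "integrable (lebesgue_on {a..b}) (\<lambda>t. max 0 (w t))"
    proof (rule integrableI_nonneg)
      show "(\<integral>\<^sup>+t. ennreal (max 0 (w t)) \<partial>lebesgue_on {a..b}) < \<infinity>" using False by (simp add: I_def top.not_eq_extremum)
    qed auto
    then have eq: "I = ennreal (integral\<^sup>L (lebesgue_on {a..b}) (\<lambda>t. max 0 (w t)))"
      unfolding I_def by (intro nn_integral_eq_integral) auto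
    have "integral\<^sup>L (lebesgue_on {a..b}) (\<lambda>t. max 0 (w t)) = integral {a..b} (\<lambda>t. max 0 (w t))"
      using int by (intro lebesgue_integral_eq_integral) auto
    moreover have "(\<lambda>t. max 0 (w t)) integrable_on {a..b}"
      using int by (intro integrable_on_lebesgue_on) auto
    then have "p * (s b - s a) - m * (b - a) \<le> integral {a..b} (\<lambda>t. max 0 (w t))"
      by (intro has_integral_le[OF w integrable_integral]) auto
    ultimately show ?thesis unfolding eq by (intro ennreal_leI) simp
  qed simp
  also have "I = (\<integral>\<^sup>+t. ennreal (max 0 (w t)) * indicator {a..b} t \<partial>lebesgue)"
    unfolding I_def by (rule nn_integral_restrict_space) simp
  also have "\<dots> \<le> (\<integral>\<^sup>+t. F t * indicator {a<..<b} t \<partial>lebesgue)"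
  proof (rule nn_integral_mono_AE)
    have "negligible (N \<union> {a, b})" using N by (intro negligible_Un) (simp_all add: negligible_finite)
    then have "AE t in lebesgue. t \<notin> N \<union> {a, b}" by (intro AE_not_in) (simp add: negligible_iff_null_sets)
    then show "AE t in lebesgue. ennreal (max 0 (w t)) * indicator {a..b} t \<le> F t * indicator {a<..<b} t"
      by eventually_elim (use F in \<open>auto simp: indicator_def w_def max_def\<close>)
  qed
  also have "\<dots> = ival_integral F a b"
    unfolding ival_integral_def by (rule nn_integral_completion)
  finally show ?thesis .
qed

section \<open>Arcs, Hamiltonians and Lagrangians\<close>

lemma regular_C1_reversepath:
  assumes "regular_C1 g"
  shows "regular_C1 (reversepath g)"
proof -
  obtain D where D: "continuous_on {0..1} D"
    "\<And>s. s \<in> {0..1} \<Longrightarrow> (g has_vector_derivative D s) (at s within {0..1}) \<and> D s \<noteq> 0"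
    using assms unfolding regular_C1_def by blast
  show ?thesis unfolding regular_C1_def
  proof (intro exI[of _ "\<lambda>s. - D (1 - s)"] conjI ballI)
    have "continuous_on {0..1} (D \<circ> (\<lambda>s. 1 - s))"
      by (intro continuous_on_compose continuous_intros) (use D(1) in simp)
    then show "continuous_on {0..1} (\<lambda>s. - D (1 - s))" by (simp add: o_def continuous_on_minus)
    fix s :: real assume s: "s \<in> {0..1}"
    then have s': "1 - s \<in> {0..1}" by auto
    have "(g has_vector_derivative D (1 - s)) (at (1 - s) within (\<lambda>x. 1 - x) ` {0..1})"
      using D(2)[OF s'] by simp
    then have "((g \<circ> (\<lambda>x. 1 - x)) has_vector_derivative (-1) *\<^sub>R D (1 - s)) (at s within {0..1})"
      by (intro vector_diff_chain_within) (auto intro!: derivative_eq_intros)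
    then show "(reversepath g has_vector_derivative - D (1 - s)) (at s within {0..1})"
      by (simp add: reversepath_def o_def)
    show "- D (1 - s) \<noteq> 0" using D(2)[OF s'] by simp
  qed
qed

section \<open>Geometry of arcs: bi-Lipschitz bounds and confinement of curves\<close>

context
  fixes E :: "(real \<Rightarrow> real ^ 'n) set"
  assumes net: "network E"
begin

lemma arcs_regular_C1: "\<gamma> \<in> arcs E \<Longrightarrow> regular_C1 \<gamma>"
  using net regular_C1_reversepath by (auto simp: arcs_def network_def)

lemma arc_has_deriv:
  assumes "\<gamma> \<in> arcs E"
  shows "continuous_on {0..1} (arc_deriv \<gamma>)"
    and "\<And>s. s \<in> {0..1} \<Longrightarrow> (\<gamma> has_vector_derivative arc_deriv \<gamma> s) (at s within {0..1})"
    and "\<And>s. s \<in> {0..1} \<Longrightarrow> arc_deriv \<gamma> s \<noteq> 0"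
proof -
  obtain D where D: "continuous_on {0..1} D"
    "\<And>s. s \<in> {0..1} \<Longrightarrow> (\<gamma> has_vector_derivative D s) (at s within {0..1}) \<and> D s \<noteq> 0"
    using arcs_regular_C1[OF assms] unfolding regular_C1_def by blast
  have eq: "arc_deriv \<gamma> s = D s" if "s \<in> {0..1}" for s
    unfolding arc_deriv_def
    using vector_derivative_within_closed_interval[of 0 1 s \<gamma> "D s"] D(2)[OF that] that by simp
  show "continuous_on {0..1} (arc_deriv \<gamma>)"
    using D(1) by (rule continuous_on_eq) (simp add: eq)
  show "(\<gamma> has_vector_derivative arc_deriv \<gamma> s) (at s within {0..1})" "arc_deriv \<gamma> s \<noteq> 0"
    if "s \<in> {0..1}" for s using D(2)[OF that] eq[OF that] by simp_all
qed

lemma arc_continuous: "\<gamma> \<in> arcs E \<Longrightarrow> continuous_on {0..1} \<gamma>"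
  using arc_has_deriv(2) by (meson continuous_on_eq_continuous_within has_vector_derivative_continuous)

lemma arc_lipschitz:
  assumes "\<gamma> \<in> arcs E"
  shows "\<exists>B. B-lipschitz_on {0..1} \<gamma>"
proof -
  have "compact (arc_deriv \<gamma> ` {0..1})"
    using arc_has_deriv(1)[OF assms] by (intro compact_continuous_image) auto
  then have "bounded (arc_deriv \<gamma> ` {0..1})" by (rule compact_imp_bounded)
  then obtain B where B: "B > 0" "\<And>s. s \<in> {0..1} \<Longrightarrow> norm (arc_deriv \<gamma> s) \<le> B"
    unfolding bounded_pos by auto
  have "B-lipschitz_on {0..1} \<gamma>"
  proof (rule bounded_derivative_imp_lipschitz)
    fix s :: real assume s: "s \<in> {0..1}"
    show "(\<gamma> has_derivative (\<lambda>h. h *\<^sub>R arc_deriv \<gamma> s)) (at s within {0..1})"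
      using arc_has_deriv(2)[OF assms s] by (simp add: has_vector_derivative_def)
    show "onorm (\<lambda>h. h *\<^sub>R arc_deriv \<gamma> s) \<le> B"
    proof (rule onorm_le)
      fix h :: real
      show "norm (h *\<^sub>R arc_deriv \<gamma> s) \<le> B * norm h"
        using mult_left_mono[OF B(2)[OF s], of "\<bar>h\<bar>"] by (simp add: mult.commute)
    qed
  qed (use B(1) in auto)
  then show ?thesis ..
qed

text \<open>Close to \<open>l\<close> the derivative differs from
  \<open>arc_deriv \<gamma> l\<close> by less than half the norm of the latter, so the linear part
  outweighs the linearization error. Neighbourhoods relative to \<open>{0..1}\<close> include the
  endpoints of the arc.\<close>

lemma arc_locally_expanding:
  assumes \<gamma>: "\<gamma> \<in> arcs E" and l: "l \<in> {0..1}"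
  shows "\<exists>r>0. \<exists>k>0. \<forall>x\<in>{0..1} \<inter> ball l r. \<forall>y\<in>{0..1} \<inter> ball l r. k * \<bar>x - y\<bar> \<le> norm (\<gamma> x - \<gamma> y)"
proof -
  define d where "d = norm (arc_deriv \<gamma> l)"
  have d: "d > 0" using arc_has_deriv(3)[OF \<gamma> l] by (simp add: d_def)
  then have "d / 2 > 0" by simp
  then obtain r where r: "r > 0" "\<And>s. s \<in> {0..1} \<Longrightarrow> dist s l < r \<Longrightarrow> dist (arc_deriv \<gamma> s) (arc_deriv \<gamma> l) < d / 2"
    using arc_has_deriv(1)[OF \<gamma>] l unfolding continuous_on_iff by metis
  define S where "S = {0..1} \<inter> ball l r"
  have convS: "convex S" unfolding S_def by (intro convex_Int convex_ball) simp
  have lS: "l \<in> S" using l r(1) by (simp add: S_def)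
  have "d / 2 * \<bar>x - y\<bar> \<le> norm (\<gamma> x - \<gamma> y)" if xy: "x \<in> S" "y \<in> S" for x y
  proof -
    have "norm (\<gamma> x - \<gamma> y - (x - y) *\<^sub>R arc_deriv \<gamma> l) \<le> norm (x - y) * (d / 2)"
    proof (rule differentiable_bound_linearization[where S=S and f'="\<lambda>s h. h *\<^sub>R arc_deriv \<gamma> s"])
      show "y + t *\<^sub>R (x - y) \<in> S" if "t \<in> {0..1}" for t
      proof -
        have "(1 - t) *\<^sub>R y + t *\<^sub>R x \<in> S" using convS xy that by (intro convexD) auto
        then show ?thesis by (simp add: algebra_simps)
      qed
      fix s assume s: "s \<in> S"
      then have s01: "s \<in> {0..1}" by (simp add: S_def)
      show "(\<gamma> has_derivative (\<lambda>h. h *\<^sub>R arc_deriv \<gamma> s)) (at s within S)"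
        using arc_has_deriv(2)[OF \<gamma> s01] has_derivative_subset[of \<gamma> _ s "{0..1}" S]
        by (simp add: has_vector_derivative_def S_def)
      have le: "norm (arc_deriv \<gamma> s - arc_deriv \<gamma> l) \<le> d / 2"
        using r(2)[OF s01] s by (simp add: S_def dist_norm abs_minus_commute)
      show "onorm ((\<lambda>h. h *\<^sub>R arc_deriv \<gamma> s) - (\<lambda>h. h *\<^sub>R arc_deriv \<gamma> l)) \<le> d / 2"
      proof (intro onorm_le)
        fix h :: real
        show "norm (((\<lambda>h. h *\<^sub>R arc_deriv \<gamma> s) - (\<lambda>h. h *\<^sub>R arc_deriv \<gamma> l)) h) \<le> d / 2 * norm h"
          using mult_left_mono[OF le, of "\<bar>h\<bar>"] by (simp add: scaleR_diff_right[symmetric] mult.commute)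
      qed
    qed (rule lS)
    moreover have "norm ((x - y) *\<^sub>R arc_deriv \<gamma> l) = \<bar>x - y\<bar> * d" by (simp add: d_def)
    moreover have "norm ((x - y) *\<^sub>R arc_deriv \<gamma> l) \<le> norm (\<gamma> x - \<gamma> y) + norm (\<gamma> x - \<gamma> y - (x - y) *\<^sub>R arc_deriv \<gamma> l)"
      using norm_triangle_sub[of "(x - y) *\<^sub>R arc_deriv \<gamma> l" "\<gamma> x - \<gamma> y"] by (simp add: norm_minus_commute)
    ultimately show ?thesis by (simp add: algebra_simps)
  qed
  then show ?thesis using r(1) d by (intro exI[of _ r] conjI exI[of _ "d / 2"]) (auto simp: S_def)
qed

text \<open>Compactness joins two reasons: pairs violating the bound have a convergent subsequence,
  injectivity makes the two limits coincide, and the local bound at the common limit excludes this.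
  The bound says that the inverse of the arc is Lipschitz.\<close>

lemma arc_expanding:
  assumes \<gamma>: "\<gamma> \<in> arcs E"
  shows "\<exists>k>0. \<forall>x\<in>{0..1}. \<forall>y\<in>{0..1}. k * \<bar>x - y\<bar> \<le> norm (\<gamma> x - \<gamma> y)"
proof (rule ccontr)
  assume no: "\<not> ?thesis"
  have "\<exists>x\<in>{0..1}. \<exists>y\<in>{0..1}. norm (\<gamma> x - \<gamma> y) < 1 / real (Suc n) * \<bar>x - y\<bar>" for n
  proof -
    have "0 < 1 / real (Suc n)" by simp
    with no have "\<not> (\<forall>x\<in>{0..1}. \<forall>y\<in>{0..1}. 1 / real (Suc n) * \<bar>x - y\<bar> \<le> norm (\<gamma> x - \<gamma> y))" by blast
    then show ?thesis by (simp only: not_le ball_simps bex_simps not_all)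
  qed
  then obtain x y where xy: "\<And>n. x n \<in> {0..1}" "\<And>n. y n \<in> {0..1}"
    "\<And>n. norm (\<gamma> (x n) - \<gamma> (y n)) < 1 / real (Suc n) * \<bar>x n - y n\<bar>" by metis
  have "seq_compact ({0..1::real} \<times> {0..1::real})"
    by (intro compact_imp_seq_compact compact_Times) auto
  then obtain lm \<phi> where lm: "lm \<in> {0..1} \<times> {0..1}" "strict_mono (\<phi> :: nat \<Rightarrow> nat)" "((\<lambda>n. (x n, y n)) \<circ> \<phi>) \<longlonglongrightarrow> lm"
    by (rule seq_compactE[where f="\<lambda>n. (x n, y n)"]) (use xy in auto)
  obtain l m where lm_eq: "lm = (l, m)" by (cases lm)
  have l: "l \<in> {0..1}" "m \<in> {0..1}" using lm(1) by (auto simp: lm_eq)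
  have xl: "(\<lambda>n. x (\<phi> n)) \<longlonglongrightarrow> l" and ym: "(\<lambda>n. y (\<phi> n)) \<longlonglongrightarrow> m"
    using tendsto_fst[OF lm(3)] tendsto_snd[OF lm(3)] by (simp_all add: o_def lm_eq)
  have cont: "continuous_on {0..1} \<gamma>" by (rule arc_continuous[OF \<gamma>])
  have "(\<lambda>n. \<gamma> (x (\<phi> n))) \<longlonglongrightarrow> \<gamma> l" "(\<lambda>n. \<gamma> (y (\<phi> n))) \<longlonglongrightarrow> \<gamma> m"
    using continuous_on_tendsto_compose[OF cont xl l(1)] continuous_on_tendsto_compose[OF cont ym l(2)] xy by simp_all
  then have lim: "(\<lambda>n. norm (\<gamma> (x (\<phi> n)) - \<gamma> (y (\<phi> n)))) \<longlonglongrightarrow> norm (\<gamma> l - \<gamma> m)"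
    by (intro tendsto_norm tendsto_diff)
  have inv0: "(\<lambda>n. 1 / real (Suc (\<phi> n))) \<longlonglongrightarrow> 0"
    using LIMSEQ_subseq_LIMSEQ[OF lim_1_over_n[THEN LIMSEQ_Suc] lm(2)] by (simp add: o_def)
  have "norm (\<gamma> l - \<gamma> m) \<le> 0"
  proof (rule LIMSEQ_le[OF lim inv0], intro exI[of _ 0] allI impI)
    fix n :: nat
    have "\<bar>x (\<phi> n) - y (\<phi> n)\<bar> \<le> 1" using xy(1)[of "\<phi> n"] xy(2)[of "\<phi> n"] by auto
    then have "1 / real (Suc (\<phi> n)) * \<bar>x (\<phi> n) - y (\<phi> n)\<bar> \<le> 1 / real (Suc (\<phi> n)) * 1"
      by (intro mult_left_mono) auto
    with xy(3)[of "\<phi> n"] show "norm (\<gamma> (x (\<phi> n)) - \<gamma> (y (\<phi> n))) \<le> 1 / real (Suc (\<phi> n))" by linarith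
  qed
  then have "\<gamma> l = \<gamma> m" by simp
  then have "m = l" using inj_onD[OF arcs_inj_on[OF net \<gamma>]] l by metis
  obtain r k where rk: "r > 0" "k > 0"
    "\<forall>x\<in>{0..1} \<inter> ball l r. \<forall>y\<in>{0..1} \<inter> ball l r. k * \<bar>x - y\<bar> \<le> norm (\<gamma> x - \<gamma> y)"
    using arc_locally_expanding[OF \<gamma> l(1)] by blast
  have "\<forall>\<^sub>F n in sequentially. dist (x (\<phi> n)) l < r \<and> dist (y (\<phi> n)) l < r \<and> 1 / real (Suc (\<phi> n)) < k"
    using tendstoD[OF xl rk(1)] tendstoD[OF ym rk(1)] order_tendstoD(2)[OF inv0 rk(2)] \<open>m = l\<close>
    by (simp add: eventually_conj_iff)
  then obtain n where n: "dist (x (\<phi> n)) l < r" "dist (y (\<phi> n)) l < r" "1 / real (Suc (\<phi> n)) < k"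
    using eventually_happens'[OF sequentially_bot] by blast
  have "k * \<bar>x (\<phi> n) - y (\<phi> n)\<bar> \<le> norm (\<gamma> (x (\<phi> n)) - \<gamma> (y (\<phi> n)))"
    using rk(3) n xy by (simp add: dist_commute)
  also have "\<dots> < 1 / real (Suc (\<phi> n)) * \<bar>x (\<phi> n) - y (\<phi> n)\<bar>" by (rule xy(3))
  also have "\<dots> \<le> k * \<bar>x (\<phi> n) - y (\<phi> n)\<bar>" using n(3) by (intro mult_right_mono) auto
  finally show False by simp
qed

lemma nonvertex_in_interior:
  assumes "\<gamma> \<in> arcs E" "x \<in> \<gamma> ` {0..1}" "x \<notin> vertices E"
  shows "x \<in> \<gamma> ` {0<..<1}"
proof -
  obtain s where s: "s \<in> {0..1}" "x = \<gamma> s" using assms(2) by auto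
  have "s \<noteq> 0" "s \<noteq> 1" using assms(1,3) s(2) by (auto simp: vertices_def pathstart_def pathfinish_def)
  with s show ?thesis by force
qed

text \<open>The image of the open interval is connected and covered by two closed sets, one arc and
  the union of the others. Different arcs meet in vertices only, which the image avoids, so only one
  of the two sets is met. The endpoints follow by closure.\<close>

lemma curve_in_single_arc:
  fixes \<xi> :: "real \<Rightarrow> real ^ 'n"
  assumes cont: "continuous_on {a..b} \<xi>" and ab: "a < b" and sub: "\<xi> ` {a..b} \<subseteq> network_support E"
    and nv: "\<xi> ` {a<..<b} \<inter> vertices E = {}"
  shows "\<exists>\<gamma>\<in>arcs E. (\<forall>t\<in>{a..b}. \<xi> t \<in> \<gamma> ` {0..1}) \<and> (\<forall>t\<in>{a<..<b}. \<xi> t \<in> \<gamma> ` {0<..<1})"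
proof -
  define X where "X = \<xi> ` {a<..<b}"
  have contI: "continuous_on {a<..<b} \<xi>" using cont by (rule continuous_on_subset) auto
  have conn: "connected X" unfolding X_def using contI by (rule connected_continuous_image) simp
  define t0 where "t0 = (a + b) / 2"
  have t0: "t0 \<in> {a<..<b}" "t0 \<in> {a..b}" using ab by (auto simp: t0_def)
  have "\<xi> t0 \<in> network_support E" using sub t0(2) by blast
  then obtain \<gamma> where \<gamma>E: "\<gamma> \<in> E" and t0\<gamma>: "\<xi> t0 \<in> \<gamma> ` {0..1}" by (auto simp: network_support_def)
  have arcI: "g \<in> arcs E" if "g \<in> E" for g using that by (simp add: arcs_def)
  have closed_arc: "closed (g ` {0..1})" if "g \<in> E" for g
    using arc_continuous[OF arcI[OF that]] by (intro compact_imp_closed compact_continuous_image) auto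
  \<comment> \<open>The network may contain an arc together with its reverse, which has the same
    image; such a \<open>g\<close> must not count as another arc.\<close>
  define F where "F = \<Union>((\<lambda>g. g ` {0..1}) ` {g \<in> E. \<gamma> \<noteq> g \<and> \<gamma> \<noteq> reversepath g})"
  have "finite E" using net by (simp add: network_def)
  then have closedF: "closed F" unfolding F_def using closed_arc by (intro closed_Union) auto
  have "X \<subseteq> network_support E" using sub by (force simp: X_def)
  also have "network_support E \<subseteq> \<gamma> ` {0..1} \<union> F"
  proof
    fix x assume "x \<in> network_support E"
    then obtain g where g: "g \<in> E" "x \<in> g ` {0..1}" by (auto simp: network_support_def)
    consider "\<gamma> = g" | "\<gamma> = reversepath g" | "\<gamma> \<noteq> g \<and> \<gamma> \<noteq> reversepath g" by blast
    then show "x \<in> \<gamma> ` {0..1} \<union> F"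
    proof cases
      case 2
      then have "\<gamma> ` {0..1} = g ` {0..1}" using path_image_reversepath[of g] by (simp add: path_image_def)
      then show ?thesis using g by simp
    qed (use g in \<open>auto simp: F_def\<close>)
  qed
  finally have cover: "X \<subseteq> \<gamma> ` {0..1} \<union> F" .
  have disj: "\<gamma> ` {0..1} \<inter> F \<inter> X = {}"
  proof (rule ccontr)
    assume "\<gamma> ` {0..1} \<inter> F \<inter> X \<noteq> {}"
    then obtain x where x: "x \<in> \<gamma> ` {0..1}" "x \<in> F" "x \<in> X" by blast
    have "x \<in> \<gamma> ` {0<..<1}"
      using x nv by (intro nonvertex_in_interior[OF arcI[OF \<gamma>E]]) (auto simp: X_def)
    moreover obtain g where g: "g \<in> E" "\<gamma> \<noteq> g" "\<gamma> \<noteq> reversepath g" "x \<in> g ` {0..1}" using x(2) by (auto simp: F_def)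
    moreover have "\<gamma> ` {0<..<1} \<inter> g ` {0..1} = {}"
      using net arcI[OF \<gamma>E] arcI[OF g(1)] g(2,3) unfolding network_def by blast
    ultimately show False by blast
  qed
  have "F \<inter> X = {}"
  proof (rule ccontr)
    assume "F \<inter> X \<noteq> {}"
    moreover have "\<xi> t0 \<in> X" using t0(1) unfolding X_def by (rule imageI)
    then have "\<gamma> ` {0..1} \<inter> X \<noteq> {}" using t0\<gamma> by blast
    ultimately show False
      using conn closed_arc[OF \<gamma>E] closedF cover disj unfolding connected_closed by blast
  qed
  with cover have XX: "X \<subseteq> \<gamma> ` {0..1}" by blast
  have "\<xi> ` closure {a<..<b} \<subseteq> \<gamma> ` {0..1}"
    using XX closed_arc[OF \<gamma>E] cont ab by (intro image_closure_subset) (auto simp: X_def)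
  then have all: "\<xi> t \<in> \<gamma> ` {0..1}" if "t \<in> {a..b}" for t using that ab by (auto simp: image_subset_iff)
  show ?thesis
  proof (intro bexI[OF _ arcI[OF \<gamma>E]] conjI ballI all)
    fix t assume t: "t \<in> {a<..<b}"
    then have "\<xi> t \<in> \<gamma> ` {0..1}" using all by auto
    then show "\<xi> t \<in> \<gamma> ` {0<..<1}"
      using nv t by (intro nonvertex_in_interior[OF arcI[OF \<gamma>E]]) blast+
  qed
qed

end

section \<open>Bounds for Hamiltonians and Lagrangians\<close>

context
  fixes E :: "(real \<Rightarrow> real ^ 'n) set" and H :: "(real \<Rightarrow> real ^ 'n) \<Rightarrow> real \<Rightarrow> real \<Rightarrow> real"
  assumes net: "network E" and ham: "hamiltonians E H"
begin

lemma hamiltonian_bounded: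
  assumes \<gamma>: "\<gamma> \<in> arcs E" and S: "compact S"
  shows "\<exists>M\<ge>0. \<forall>s\<in>{0..1}. \<forall>\<mu>\<in>S. \<bar>H \<gamma> s \<mu>\<bar> \<le> M"
proof -
  have "continuous_on ({0..1} \<times> UNIV) (\<lambda>(s, \<mu>). H \<gamma> s \<mu>)" using ham \<gamma> by (simp add: hamiltonians_def)
  then have "continuous_on ({0..1} \<times> S) (\<lambda>(s, \<mu>). H \<gamma> s \<mu>)" by (rule continuous_on_subset) auto
  then have "compact ((\<lambda>(s, \<mu>). H \<gamma> s \<mu>) ` ({0..1} \<times> S))"
    using S by (intro compact_continuous_image compact_Times) auto
  then have "bounded ((\<lambda>(s, \<mu>). H \<gamma> s \<mu>) ` ({0..1} \<times> S))" by (rule compact_imp_bounded)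
  then obtain M where "M > 0" "\<And>s \<mu>. s \<in> {0..1} \<Longrightarrow> \<mu> \<in> S \<Longrightarrow> \<bar>H \<gamma> s \<mu>\<bar> \<le> M"
    unfolding bounded_pos by fastforce
  then show ?thesis by (intro exI[of _ M]) auto
qed

text \<open>Superlinearity takes care of large momenta and compactness of the others. This affine
  form makes the suprema defining the Lagrangian finite, and bounded for bounded speeds.\<close>

lemma hamiltonian_growth:
  assumes \<gamma>: "\<gamma> \<in> arcs E" and "A \<ge> 0"
  shows "\<exists>C\<ge>0. \<forall>s\<in>{0..1}. \<forall>\<mu>. A * \<bar>\<mu>\<bar> - C \<le> H \<gamma> s \<mu>"
proof -
  have "filterlim (\<lambda>\<mu>. INF s\<in>{0..1}. H \<gamma> s \<mu> / \<bar>\<mu>\<bar>) at_top at_infinity"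
    using ham \<gamma> by (simp add: hamiltonians_def)
  then have "eventually (\<lambda>\<mu>. A \<le> (INF s\<in>{0..1}. H \<gamma> s \<mu> / \<bar>\<mu>\<bar>)) at_infinity"
    by (simp add: filterlim_at_top)
  then obtain r where r: "\<And>\<mu>. r \<le> \<bar>\<mu>\<bar> \<Longrightarrow> A \<le> (INF s\<in>{0..1}. H \<gamma> s \<mu> / \<bar>\<mu>\<bar>)"
    by (auto simp: eventually_at_infinity)
  define R where "R = max r 1"
  obtain M where M: "M \<ge> 0" "\<And>s \<mu>. s \<in> {0..1} \<Longrightarrow> \<mu> \<in> {-R..R} \<Longrightarrow> \<bar>H \<gamma> s \<mu>\<bar> \<le> M"
    using hamiltonian_bounded[OF \<gamma>, of "{-R..R}"] by auto
  have "A * \<bar>\<mu>\<bar> - (M + A * R) \<le> H \<gamma> s \<mu>" if s: "s \<in> {0..1}" for s \<mu>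
  proof (cases "\<bar>\<mu>\<bar> \<le> R")
    case True
    then have "\<mu> \<in> {-R..R}" by auto
    with s have "\<bar>H \<gamma> s \<mu>\<bar> \<le> M" by (rule M(2))
    moreover have "A * \<bar>\<mu>\<bar> \<le> A * R" using True \<open>A \<ge> 0\<close> by (rule mult_left_mono)
    ultimately show ?thesis by linarith
  next
    case False
    then have \<mu>: "\<bar>\<mu>\<bar> > 0" "r \<le> \<bar>\<mu>\<bar>" by (auto simp: R_def)
    obtain M' where M': "\<And>s. s \<in> {0..1} \<Longrightarrow> \<bar>H \<gamma> s \<mu>\<bar> \<le> M'"
      using hamiltonian_bounded[OF \<gamma>, of "{\<mu>}"] by (meson compact_sing singletonI)
    \<comment> \<open>A real \<open>INF\<close> is a lower bound of its family only if the family is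
      bounded below; at fixed \<open>\<mu>\<close> this comes from continuity in
      \<open>s\<close>.\<close>
    have "bdd_below ((\<lambda>s. H \<gamma> s \<mu> / \<bar>\<mu>\<bar>) ` {0..1})"
    proof (rule bdd_belowI2)
      fix s :: real assume "s \<in> {0..1}"
      then have "- M' \<le> H \<gamma> s \<mu>" using M'[of s] by (auto simp: abs_le_iff)
      then show "- M' / \<bar>\<mu>\<bar> \<le> H \<gamma> s \<mu> / \<bar>\<mu>\<bar>" using \<mu>(1) by (intro divide_right_mono) auto
    qed
    then have "(INF s\<in>{0..1}. H \<gamma> s \<mu> / \<bar>\<mu>\<bar>) \<le> H \<gamma> s \<mu> / \<bar>\<mu>\<bar>" using s by (rule cINF_lower)
    then have "A \<le> H \<gamma> s \<mu> / \<bar>\<mu>\<bar>" using r[OF \<mu>(2)] by linarith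
    then have "A * \<bar>\<mu>\<bar> \<le> H \<gamma> s \<mu>" using \<mu>(1) by (simp add: pos_le_divide_eq)
    moreover have "0 \<le> A * R" using \<open>A \<ge> 0\<close> by (simp add: R_def)
    ultimately show ?thesis using M(1) by linarith
  qed
  moreover have "0 \<le> M + A * R" using M(1) \<open>A \<ge> 0\<close> by (simp add: R_def)
  ultimately show ?thesis by blast
qed

text \<open>Fenchel's inequality. Growth with slope \<open>\<bar>l\<bar>\<close> ensures that the
  real \<open>SUP\<close> is a genuine upper bound.\<close>

lemma arc_lagrangian_ge:
  assumes \<gamma>: "\<gamma> \<in> arcs E" and s: "s \<in> {0..1}"
  shows "p * l - H \<gamma> s p \<le> arc_lagrangian H \<gamma> s l"
proof -
  obtain C where C: "\<And>\<mu>. \<bar>l\<bar> * \<bar>\<mu>\<bar> - C \<le> H \<gamma> s \<mu>"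
    using hamiltonian_growth[OF \<gamma>, of "\<bar>l\<bar>"] s by (meson abs_ge_zero)
  have "bdd_above (range (\<lambda>\<mu>. l * \<mu> - H \<gamma> s \<mu>))"
  proof (rule bdd_aboveI2)
    fix \<mu>
    have "l * \<mu> \<le> \<bar>l\<bar> * \<bar>\<mu>\<bar>" by (metis abs_ge_self abs_mult)
    with C[of \<mu>] show "l * \<mu> - H \<gamma> s \<mu> \<le> C" by linarith
  qed
  then have "l * p - H \<gamma> s p \<le> arc_lagrangian H \<gamma> s l"
    unfolding arc_lagrangian_def by (intro cSUP_upper) auto
  then show ?thesis by (simp add: mult.commute)
qed

lemma arc_lagrangian_bounded_above:
  assumes \<gamma>: "\<gamma> \<in> arcs E" and "R \<ge> 0"
  shows "\<exists>C\<ge>0. \<forall>s\<in>{0..1}. \<forall>l. \<bar>l\<bar> \<le> R \<longrightarrow> arc_lagrangian H \<gamma> s l \<le> C"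
proof -
  obtain C where C: "C \<ge> 0" "\<And>s \<mu>. s \<in> {0..1} \<Longrightarrow> R * \<bar>\<mu>\<bar> - C \<le> H \<gamma> s \<mu>"
    using hamiltonian_growth[OF assms] by auto
  have "arc_lagrangian H \<gamma> s l \<le> C" if s: "s \<in> {0..1}" and l: "\<bar>l\<bar> \<le> R" for s l
    unfolding arc_lagrangian_def
  proof (rule cSUP_least)
    fix \<mu>
    have "l * \<mu> \<le> \<bar>l\<bar> * \<bar>\<mu>\<bar>" by (metis abs_ge_self abs_mult)
    also have "\<dots> \<le> R * \<bar>\<mu>\<bar>" using l by (rule mult_right_mono) simp
    finally show "l * \<mu> - H \<gamma> s \<mu> \<le> C" using C(2)[OF s, of \<mu>] by linarith
  qed simp
  with C(1) show ?thesis by blast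
qed

lemma lagrangian_along_arc_deriv:
  assumes "\<gamma> \<in> arcs E" "s \<in> {0..1}"
  shows "lagrangian_along H \<gamma> s (l *\<^sub>R arc_deriv \<gamma> s) = arc_lagrangian H \<gamma> s l"
  using arc_has_deriv(3)[OF net assms]
  by (simp add: lagrangian_along_def power2_norm_eq_inner)

text \<open>Testing with momentum 0 bounds every arc Lagrangian from below by
  \<open>- H \<gamma> s 0\<close>; at rest in a vertex only finitely many values \<open>c x\<close>
  occur. The bound keeps the negative part of an action finite.\<close>

lemma lagrangian_bounded_below: "\<exists>K\<ge>0. \<forall>x q. ereal (- K) \<le> lagrangian E H c x q"
proof -
  have finE: "finite (arcs E)" using net by (simp add: arcs_def network_def)
  have finV: "finite (vertices E)" using finE by (simp add: vertices_def)
  have "\<forall>\<gamma>\<in>arcs E. \<exists>M\<ge>0. \<forall>s\<in>{0..1}. \<bar>H \<gamma> s 0\<bar> \<le> M"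
    using hamiltonian_bounded[of _ "{0}"] by auto
  then obtain M where M: "\<And>\<gamma>. \<gamma> \<in> arcs E \<Longrightarrow> M \<gamma> \<ge> 0" "\<And>\<gamma> s. \<gamma> \<in> arcs E \<Longrightarrow> s \<in> {0..1} \<Longrightarrow> \<bar>H \<gamma> s 0\<bar> \<le> M \<gamma>"
    by metis
  define K where "K = (\<Sum>\<gamma>\<in>arcs E. M \<gamma>) + (\<Sum>x\<in>vertices E. \<bar>c x\<bar>)"
  have K1: "M \<gamma> \<le> K" if "\<gamma> \<in> arcs E" for \<gamma>
    using member_le_sum[of \<gamma> "arcs E" M] that finE M(1) by (simp add: K_def add_increasing2 sum_nonneg)
  have K2: "\<bar>c x\<bar> \<le> K" if "x \<in> vertices E" for x
  proof -
    have "\<bar>c x\<bar> \<le> (\<Sum>x\<in>vertices E. \<bar>c x\<bar>)" using that finV by (intro member_le_sum) auto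
    moreover have "0 \<le> (\<Sum>\<gamma>\<in>arcs E. M \<gamma>)" using M(1) by (rule sum_nonneg)
    ultimately show ?thesis by (simp add: K_def)
  qed
  have K0: "K \<ge> 0" unfolding K_def using M(1) by (intro add_nonneg_nonneg sum_nonneg) auto
  have along: "- K \<le> lagrangian_along H \<gamma> s q" if "\<gamma> \<in> arcs E" "s \<in> {0..1}" for \<gamma> s q
  proof -
    have "- H \<gamma> s 0 \<le> lagrangian_along H \<gamma> s q"
      unfolding lagrangian_along_def using arc_lagrangian_ge[OF that, of 0] by simp
    moreover have "\<bar>H \<gamma> s 0\<bar> \<le> K" using M(2)[OF that] K1[OF that(1)] by linarith
    ultimately show ?thesis by linarith
  qed
  have "ereal (- K) \<le> lagrangian E H c x q" for x q
  proof (cases "(x, q) \<in> tangent_bundle E")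
    case True
    then obtain \<gamma> s l where g: "\<gamma> \<in> arcs E" "s \<in> {0..1}" "x = \<gamma> s" "q = l *\<^sub>R arc_deriv \<gamma> s"
      unfolding tangent_bundle_def by blast
    show ?thesis
    proof (cases "x \<in> vertices E")
      case False
      then have "s \<noteq> 0" "s \<noteq> 1" using g by (auto simp: vertices_def pathstart_def pathfinish_def)
      then have "s \<in> {0<..<1}" using g(2) by auto
      then have "lagrangian E H c x q = ereal (lagrangian_along H \<gamma> s q)"
        using lagrangian_interior[OF net ham g(1), of s q c] True g(3) by simp
      then show ?thesis using along[OF g(1,2)] by simp
    next
      case V: True
      show ?thesis
      proof (cases "q = 0")
        case True
        then show ?thesis using V \<open>(x, q) \<in> _\<close> K2[OF V] by (simp add: lagrangian_def abs_le_iff)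
      next
        case False
        define S where "S = {lagrangian_along H \<gamma> 1 q | \<gamma>. \<gamma> \<in> arcs_to E x \<and> (\<exists>l. q = l *\<^sub>R arc_deriv \<gamma> 1)}"
        have "S \<subseteq> (\<lambda>\<gamma>. lagrangian_along H \<gamma> 1 q) ` arcs E" by (auto simp: S_def arcs_to_def)
        then have finS: "finite S" using finE finite_surj by blast
        have "s = 0 \<or> s = 1"
        proof (rule ccontr)
          assume "\<not> ?thesis"
          then have "s \<in> {0<..<1}" using g(2) by auto
          then show False using interior_not_vertex[OF net g(1)] V g(3) by blast
        qed
        then have "S \<noteq> {}"
        proof
          assume "s = 1"
          then have "lagrangian_along H \<gamma> 1 q \<in> S" using g by (auto simp: S_def arcs_to_def)
          then show ?thesis by blast
        next
          \<comment> \<open>\<open>arcs_to\<close> collects the arcs ending at \<open>x\<close>; a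
            vector tangent to a departing arc is seen by the reverse of that arc, so the set under
            \<open>Min\<close> is nonempty.\<close>
          assume s0: "s = 0"
          have rev: "reversepath \<gamma> \<in> arcs E"
            using g(1) by (auto simp: arcs_def)
          have "q = (- l) *\<^sub>R arc_deriv (reversepath \<gamma>) 1"
            using arc_deriv_reversepath[OF net g(1), of 1] g(4) s0 by simp
          moreover have "reversepath \<gamma> \<in> arcs_to E x"
            using rev g(3) s0 by (simp add: arcs_to_def reversepath_def)
          ultimately have "lagrangian_along H (reversepath \<gamma>) 1 q \<in> S"
            unfolding S_def by blast
          then show ?thesis by blast
        qed
        then have "Min S \<in> S" using finS by (intro Min_in)
        then have "- K \<le> Min S" using along by (auto simp: S_def arcs_to_def)
        moreover have "lagrangian E H c x q = ereal (Min S)"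
          using \<open>(x, q) \<in> _\<close> V False by (simp add: lagrangian_def S_def)
        ultimately show ?thesis by simp
      qed
    qed
  qed (simp add: lagrangian_def)
  with K0 show ?thesis by blast
qed

text \<open>Since \<open>\<sigma> t\<close> is interior, \<open>\<zeta> t\<close> is no vertex, and
  neither the minimum over arcs nor the flux limiter enters. The factorization through
  \<open>\<gamma>\<close> is required around \<open>t\<close> because \<open>\<zeta>\<close> is
  differentiated there.\<close>

lemma lagrangian_on_arc:
  assumes \<gamma>: "\<gamma> \<in> arcs E" and t: "t \<in> {a<..<b}" and \<sigma>t: "\<sigma> t \<in> {0<..<1}"
    and eq: "\<And>r. r \<in> {a<..<b} \<Longrightarrow> \<sigma> r \<in> {0..1} \<and> \<zeta> r = \<gamma> (\<sigma> r)"
    and \<sigma>: "(\<sigma> has_real_derivative l) (at t)"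
  shows "lagrangian E H c (\<zeta> t) (vector_derivative \<zeta> (at t)) = ereal (arc_lagrangian H \<gamma> (\<sigma> t) l)"
proof -
  have s01: "\<sigma> t \<in> {0..1}" using \<sigma>t by auto
  have "(\<gamma> has_vector_derivative arc_deriv \<gamma> (\<sigma> t)) (at (\<sigma> t))"
    using arc_has_deriv(2)[OF net \<gamma> s01] \<sigma>t by (simp add: at_within_Icc_at)
  then have "(\<gamma> \<circ> \<sigma> has_vector_derivative l *\<^sub>R arc_deriv \<gamma> (\<sigma> t)) (at t)"
    using \<sigma> by (intro vector_diff_chain_at) (simp_all add: has_real_derivative_iff_has_vector_derivative)
  then have "(\<zeta> has_vector_derivative l *\<^sub>R arc_deriv \<gamma> (\<sigma> t)) (at t)"
    by (rule has_vector_derivative_transform_within_open[of _ _ _ "{a<..<b}"]) (use t eq in auto)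
  then have vd: "vector_derivative \<zeta> (at t) = l *\<^sub>R arc_deriv \<gamma> (\<sigma> t)" by (rule vector_derivative_at)
  have supp: "\<gamma> (\<sigma> t) \<in> network_support E"
  proof -
    consider "\<gamma> \<in> E" | g where "g \<in> E" "\<gamma> = reversepath g" using \<gamma> by (auto simp: arcs_def)
    then show ?thesis
    proof cases
      case 1 then show ?thesis using s01 unfolding network_support_def by blast
    next
      case 2
      have "1 - \<sigma> t \<in> {0..1}" using s01 by auto
      moreover have "\<gamma> (\<sigma> t) = g (1 - \<sigma> t)" using 2(2) by (simp add: reversepath_def)
      ultimately show ?thesis using 2(1) unfolding network_support_def by (simp only:) blast
    qed
  qed
  then have "(\<gamma> (\<sigma> t), l *\<^sub>R arc_deriv \<gamma> (\<sigma> t)) \<in> tangent_bundle E"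
    using \<gamma> s01 unfolding tangent_bundle_def by blast
  then have "lagrangian E H c (\<gamma> (\<sigma> t)) (l *\<^sub>R arc_deriv \<gamma> (\<sigma> t)) = ereal (arc_lagrangian H \<gamma> (\<sigma> t) l)"
    using lagrangian_interior[OF net ham \<gamma> \<sigma>t] lagrangian_along_arc_deriv[OF \<gamma> s01] by simp
  then show ?thesis using eq[OF t] vd by simp
qed

end

section \<open>Costs of curves and competitors\<close>

lemma vector_derivative_eq_on_open:
  fixes f g :: "real \<Rightarrow> 'a::real_normed_vector"
  assumes "t \<in> {a<..<b}" "\<And>r. r \<in> {a<..<b} \<Longrightarrow> f r = g r"
  shows "vector_derivative f (at t) = vector_derivative g (at t)"
proof -
  have "(f has_vector_derivative D) (at t) \<longleftrightarrow> (g has_vector_derivative D) (at t)" for D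
    using has_vector_derivative_transform_within_open[of f D t "{a<..<b}" g]
      has_vector_derivative_transform_within_open[of g D t "{a<..<b}" f] assms by auto
  then show ?thesis by (simp add: vector_derivative_def)
qed

lemma vector_derivative_shift:
  fixes f :: "real \<Rightarrow> 'a::real_normed_vector"
  shows "vector_derivative (\<lambda>t. f (t - e)) (at t) = vector_derivative f (at (t - e))"
proof -
  have shift: "((\<lambda>t. g (t - e)) has_vector_derivative D) (at t)"
    if "(g has_vector_derivative D) (at (t - e))" for g :: "real \<Rightarrow> 'a" and D t e
  proof -
    have "((\<lambda>t. t - e) has_vector_derivative 1) (at t)" by (auto intro!: derivative_eq_intros)
    from vector_diff_chain_at[OF this that] show ?thesis by (simp add: o_def)
  qed
  have "((\<lambda>t. f (t - e)) has_vector_derivative D) (at t) \<longleftrightarrow> (f has_vector_derivative D) (at (t - e))" for D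
    using shift[of f D t e] shift[of "\<lambda>t. f (t - e)" D "t - e" "- e"] by auto
  then show ?thesis by (simp add: vector_derivative_def)
qed

text \<open>The third hypothesis excludes a motion at rest in an endpoint of the arc. Any other
  constant-speed motion is off the vertices at intermediate times, so its cost can be read off the
  Lagrangian of the arc.\<close>

lemma between_interior:
  fixes x y w :: real
  assumes "x \<in> {0..1}" "y \<in> {0..1}" "x \<noteq> y \<or> x \<in> {0<..<1}" "w \<in> {0<..<1}"
  shows "x + (y - x) * w \<in> {0<..<1}"
proof -
  consider "x < y" | "y < x" | "x = y" by linarith
  then show ?thesis
  proof cases
    case 1
    then have "0 < (y - x) * w" "(y - x) * w < (y - x) * 1"
      using assms(4) by (simp, intro mult_strict_left_mono) auto
    then show ?thesis using assms by auto
  next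
    case 2
    then have "0 < (x - y) * w" "(x - y) * w < (x - y) * 1"
      using assms(4) by (simp, intro mult_strict_left_mono) auto
    moreover have "(y - x) * w = - ((x - y) * w)" by (simp add: algebra_simps)
    ultimately show ?thesis using assms by auto
  next
    case 3
    then show ?thesis using assms by simp
  qed
qed

lemma between_closed:
  fixes x y w :: real
  assumes "x \<in> {0..1}" "y \<in> {0..1}" "w \<in> {0..1}"
  shows "x + (y - x) * w \<in> {0..1}"
proof -
  have "(1 - w) *\<^sub>R x + w *\<^sub>R y \<in> {0..1}"
    using assms by (intro convexD[OF convex_real_interval(5)]) auto
  then show ?thesis by (simp add: algebra_simps)
qed

definition segment_motion :: "(real \<Rightarrow> 'a) \<Rightarrow> real \<Rightarrow> real \<Rightarrow> real \<Rightarrow> real \<Rightarrow> real \<Rightarrow> 'a" where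
  "segment_motion \<gamma> x y u v t = \<gamma> (x + (y - x) * ((t - u) / (v - u)))"

lemma segment_motion_start [simp]: "segment_motion \<gamma> x y u v u = \<gamma> x"
  by (simp add: segment_motion_def)

lemma segment_motion_end: "u < v \<Longrightarrow> segment_motion \<gamma> x y u v v = \<gamma> y"
  by (simp add: segment_motion_def)

lemma ac_on_segment_motion:
  assumes net: "network E" and \<gamma>: "\<gamma> \<in> arcs E" and "u < v" and x: "x \<in> {0..1}" and y: "y \<in> {0..1}"
  shows "ac_on u v (segment_motion \<gamma> x y u v)"
proof -
  obtain B where B: "B-lipschitz_on {0..1} \<gamma>" using arc_lipschitz[OF net \<gamma>] by blast
  have in01: "x + (y - x) * ((t - u) / (v - u)) \<in> {0..1}" if "t \<in> {u..v}" for t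
    using that \<open>u < v\<close> x y by (intro between_closed) auto
  show ?thesis
  proof (rule ac_on_dominated[OF ac_on_id, where B="B * \<bar>y - x\<bar> / (v - u)"])
    fix t r assume tr: "t \<in> {u..v}" "r \<in> {u..v}"
    have "norm (segment_motion \<gamma> x y u v t - segment_motion \<gamma> x y u v r) \<le>
        B * \<bar>(x + (y - x) * ((t - u) / (v - u))) - (x + (y - x) * ((r - u) / (v - u)))\<bar>"
      using lipschitz_onD[OF B in01[OF tr(1)] in01[OF tr(2)]] by (simp add: segment_motion_def dist_norm)
    also have "(x + (y - x) * ((t - u) / (v - u))) - (x + (y - x) * ((r - u) / (v - u))) = (y - x) * ((t - r) / (v - u))"
      by (simp add: diff_divide_distrib algebra_simps)
    finally show "norm (segment_motion \<gamma> x y u v t - segment_motion \<gamma> x y u v r) \<le> B * \<bar>y - x\<bar> / (v - u) * norm (t - r)"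
      using \<open>u < v\<close> by (simp add: abs_mult)
  qed
qed

section \<open>Cost of a curve over a time interval\<close>

context
  fixes E :: "(real \<Rightarrow> real ^ 'n) set" and H :: "(real \<Rightarrow> real ^ 'n) \<Rightarrow> real \<Rightarrow> real \<Rightarrow> real"
    and c :: "real ^ 'n \<Rightarrow> real"
begin

text \<open>With the two-sided derivative, the quantity depends only on the curve near
  \<open>t\<close> and commutes with time translation. It can differ from the integrand of
  \<open>action\<close> only at the ends of the time interval.\<close>

definition curve_lagrangian :: "(real \<Rightarrow> real ^ 'n) \<Rightarrow> real \<Rightarrow> ereal" where
  "curve_lagrangian \<zeta> t = lagrangian E H c (\<zeta> t) (vector_derivative \<zeta> (at t))"

text \<open>The parameter \<open>\<Phi>\<close> extracts the positive or the negative part, so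
  splitting, locality and translation are proved once for both.\<close>

definition part_cost :: "(ereal \<Rightarrow> ennreal) \<Rightarrow> (real \<Rightarrow> real ^ 'n) \<Rightarrow> real \<Rightarrow> real \<Rightarrow> ennreal" where
  "part_cost \<Phi> \<zeta> a b = ival_integral (\<lambda>t. \<Phi> (curve_lagrangian \<zeta> t)) a b"

abbreviation "pos_cost \<equiv> part_cost e2ennreal"
abbreviation "neg_cost \<equiv> part_cost (\<lambda>l. e2ennreal (- l))"

lemma action_eq_costs: "action E H c T \<zeta> = enn2ereal (pos_cost \<zeta> 0 T) - enn2ereal (neg_cost \<zeta> 0 T)"
proof -
  have "(\<integral>\<^sup>+t. \<Phi> (lagrangian E H c (\<zeta> t) (vector_derivative \<zeta> (at t within {0..T}))) \<partial>lebesgue_on {0..T}) = part_cost \<Phi> \<zeta> 0 T"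
    for \<Phi> :: "ereal \<Rightarrow> ennreal"
  proof -
    let ?F = "\<lambda>t. \<Phi> (lagrangian E H c (\<zeta> t) (vector_derivative \<zeta> (at t within {0..T})))"
    have "(\<integral>\<^sup>+t. ?F t \<partial>lebesgue_on {0..T}) = (\<integral>\<^sup>+t. ?F t * indicator {0..T} t \<partial>lebesgue)"
      by (rule nn_integral_restrict_space) simp
    also have "\<dots> = (\<integral>\<^sup>+t. ?F t * indicator {0..T} t \<partial>lborel)" by (rule nn_integral_completion)
    also have "\<dots> = part_cost \<Phi> \<zeta> 0 T"
      unfolding part_cost_def ival_integral_def
    proof (rule nn_integral_cong_AE)
      show "AE t in lborel. ?F t * indicator {0..T} t = \<Phi> (curve_lagrangian \<zeta> t) * indicator {0<..<T} t"
        using AE_lborel_singleton[of 0] AE_lborel_singleton[of T]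
        by eventually_elim (auto simp: indicator_def curve_lagrangian_def at_within_Icc_at)
    qed
    finally show ?thesis .
  qed
  from this[of e2ennreal] this[of "\<lambda>l. e2ennreal (- l)"] show ?thesis
    unfolding action_def ereal_integral_def by simp
qed

lemma part_cost_split: "a \<le> b \<Longrightarrow> b \<le> d \<Longrightarrow> part_cost \<Phi> \<zeta> a d = part_cost \<Phi> \<zeta> a b + part_cost \<Phi> \<zeta> b d"
  unfolding part_cost_def by (rule ival_integral_split)

lemma curve_lagrangian_local:
  "t \<in> {a<..<b} \<Longrightarrow> (\<And>r. r \<in> {a<..<b} \<Longrightarrow> \<zeta> r = \<xi> r) \<Longrightarrow> curve_lagrangian \<zeta> t = curve_lagrangian \<xi> t"
  unfolding curve_lagrangian_def using vector_derivative_eq_on_open[of t a b \<zeta> \<xi>] by simp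

lemma part_cost_local:
  "(\<And>r. r \<in> {a<..<b} \<Longrightarrow> \<zeta> r = \<xi> r) \<Longrightarrow> part_cost \<Phi> \<zeta> a b = part_cost \<Phi> \<xi> a b"
  unfolding part_cost_def by (intro ival_integral_cong) (metis curve_lagrangian_local)

lemma part_cost_shift:
  assumes "\<And>r. r \<in> {a + e<..<b + e} \<Longrightarrow> \<zeta> r = \<xi> (r - e)"
  shows "part_cost \<Phi> \<zeta> (a + e) (b + e) = part_cost \<Phi> \<xi> a b"
proof -
  have "part_cost \<Phi> \<zeta> (a + e) (b + e) = part_cost \<Phi> (\<lambda>t. \<xi> (t - e)) (a + e) (b + e)"
    by (rule part_cost_local) (rule assms)
  also have "\<dots> = ival_integral (\<lambda>t. \<Phi> (curve_lagrangian \<xi> (t - e))) (a + e) (b + e)"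
    unfolding part_cost_def curve_lagrangian_def vector_derivative_shift ..
  also have "\<dots> = part_cost \<Phi> \<xi> a b"
    unfolding part_cost_def by (rule ival_integral_shift)
  finally show ?thesis .
qed

lemma pos_cost_le:
  assumes "a \<le> b" "0 \<le> C" "\<And>t. t \<in> {a<..<b} \<Longrightarrow> curve_lagrangian \<zeta> t \<le> ereal C"
  shows "pos_cost \<zeta> a b \<le> ennreal (C * (b - a))"
  unfolding part_cost_def using assms(1,2)
proof (rule ival_integral_le_const)
  fix t assume "t \<in> {a<..<b}"
  from e2ennreal_mono[OF assms(3)[OF this]] show "e2ennreal (curve_lagrangian \<zeta> t) \<le> ennreal C" by simp
qed

lemma neg_cost_le:
  assumes "a \<le> b" "0 \<le> K" "\<And>x q. ereal (- K) \<le> lagrangian E H c x q"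
  shows "neg_cost \<zeta> a b \<le> ennreal (K * (b - a))"
  unfolding part_cost_def using assms(1,2)
proof (rule ival_integral_le_const)
  fix t assume "t \<in> {a<..<b}"
  have "- curve_lagrangian \<zeta> t \<le> ereal K"
    using assms(3)[of "\<zeta> t" "vector_derivative \<zeta> (at t)"]
    unfolding curve_lagrangian_def by (simp add: ereal_uminus_le_reorder)
  from e2ennreal_mono[OF this] show "e2ennreal (- curve_lagrangian \<zeta> t) \<le> ennreal K" by simp
qed

context
  assumes net: "network E" and ham: "hamiltonians E H"
begin

lemma segment_motion_cost:
  assumes \<gamma>: "\<gamma> \<in> arcs E" and uv: "u < v" and x: "x \<in> {0..1}" and y: "y \<in> {0..1}"
    and int: "x \<noteq> y \<or> x \<in> {0<..<1}" and slope: "\<bar>y - x\<bar> \<le> R * (v - u)"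
    and C: "0 \<le> C" "\<And>s l. s \<in> {0..1} \<Longrightarrow> \<bar>l\<bar> \<le> R \<Longrightarrow> arc_lagrangian H \<gamma> s l \<le> C"
    and \<zeta>: "\<And>t. t \<in> {u<..<v} \<Longrightarrow> \<zeta> t = segment_motion \<gamma> x y u v t"
  shows "pos_cost \<zeta> u v \<le> ennreal (C * (v - u))"
proof (rule pos_cost_le)
  fix t assume t: "t \<in> {u<..<v}"
  define \<sigma> where "\<sigma> t = x + (y - x) * ((t - u) / (v - u))" for t
  have int01: "\<sigma> t \<in> {0<..<1}" if "t \<in> {u<..<v}" for t
    unfolding \<sigma>_def using that x y int by (intro between_interior) auto
  have d: "(\<sigma> has_real_derivative (y - x) / (v - u)) (at t)"
    unfolding \<sigma>_def using uv by (auto intro!: derivative_eq_intros)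
  have "curve_lagrangian \<zeta> t = ereal (arc_lagrangian H \<gamma> (\<sigma> t) ((y - x) / (v - u)))"
    unfolding curve_lagrangian_def
  proof (rule lagrangian_on_arc[OF net ham \<gamma> t int01[OF t] _ d])
    fix r assume r: "r \<in> {u<..<v}"
    then show "\<sigma> r \<in> {0..1} \<and> \<zeta> r = \<gamma> (\<sigma> r)"
      using int01[OF r] \<zeta>[OF r] by (auto simp: segment_motion_def \<sigma>_def)
  qed
  moreover have "\<bar>(y - x) / (v - u)\<bar> \<le> R" using slope uv by (simp add: pos_divide_le_eq)
  moreover have "\<sigma> t \<in> {0..1}" using int01[OF t] by auto
  ultimately show "curve_lagrangian \<zeta> t \<le> ereal C" using C(2) by simp
qed (use uv C in auto)

section \<open>Exchanging time between two intervals of a minimizer\<close>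

context
  fixes T :: real and \<xi> :: "real \<Rightarrow> real ^ 'n" and \<gamma> :: "real \<Rightarrow> real ^ 'n" and s :: "real \<Rightarrow> real" and a b :: real
    and K :: real
  assumes ac\<xi>: "ac_on 0 T \<xi>"
    and minimal: "\<And>\<zeta>. ac_on 0 T \<zeta> \<Longrightarrow> \<zeta> 0 = \<xi> 0 \<Longrightarrow> \<zeta> T = \<xi> T \<Longrightarrow> action E H c T \<xi> \<le> action E H c T \<zeta>"
    and fin: "pos_cost \<xi> 0 T < \<infinity>"
    and K: "0 \<le> K" "\<And>x q. ereal (- K) \<le> lagrangian E H c x q"
    and \<gamma>: "\<gamma> \<in> arcs E" and ab: "0 \<le> a" "a < b" "b \<le> T"
    and s01: "\<And>t. t \<in> {a..b} \<Longrightarrow> s t \<in> {0..1}" and \<xi>_eq: "\<And>t. t \<in> {a..b} \<Longrightarrow> \<xi> t = \<gamma> (s t)"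
    and s_int: "\<And>t. t \<in> {a<..<b} \<Longrightarrow> s t \<in> {0<..<1}"
    and ac_s: "ac_on a b s"
begin

text \<open>Replace \<open>\<xi>\<close> on \<open>[p0,p1]\<close> and on \<open>[p2,p3]\<close> by motions of constant speed in the parameter of the
  arc, the former lengthened and the latter shortened by the time \<open>e\<close> (or conversely if \<open>e < 0\<close>), and
  translate \<open>\<xi>\<close> in between.\<close>
lemma exchange_inequality:
  assumes p: "a \<le> p0" "p0 < p1" "p1 \<le> p2" "p2 < p3" "p3 \<le> b" and e: "p0 < p1 + e" "p2 + e < p3"
    and slope: "\<bar>s p1 - s p0\<bar> \<le> R * (p1 + e - p0)" "\<bar>s p3 - s p2\<bar> \<le> R * (p3 - (p2 + e))"
    and C: "0 \<le> C" "\<And>r l. r \<in> {0..1} \<Longrightarrow> \<bar>l\<bar> \<le> R \<Longrightarrow> arc_lagrangian H \<gamma> r l \<le> C"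
  shows "pos_cost \<xi> p0 p1 + pos_cost \<xi> p2 p3 \<le> ennreal ((C + K) * ((p1 - p0) + (p3 - p2)))"
proof -
  define \<zeta> where "\<zeta> t = (if t \<le> p0 \<or> p3 \<le> t then \<xi> t
      else if t \<le> p1 + e then segment_motion \<gamma> (s p0) (s p1) p0 (p1 + e) t
      else if t \<le> p2 + e then \<xi> (t - e)
      else segment_motion \<gamma> (s p2) (s p3) (p2 + e) p3 t)" for t
  have ends: "s p0 \<in> {0..1}" "s p1 \<in> {0..1}" "s p2 \<in> {0..1}" "s p3 \<in> {0..1}"
    using p by (intro s01; simp)+
  have \<xi>p: "\<xi> p0 = \<gamma> (s p0)" "\<xi> p1 = \<gamma> (s p1)" "\<xi> p2 = \<gamma> (s p2)" "\<xi> p3 = \<gamma> (s p3)"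
    using p by (intro \<xi>_eq; simp)+
  have p1int: "s p1 \<in> {0<..<1}" and p2int: "s p2 \<in> {0<..<1}" using p by (intro s_int; simp)+
  have order: "0 \<le> p0" "p0 < p1 + e" "p1 + e \<le> p2 + e" "p2 + e < p3" "p3 \<le> T" using p e ab by auto
  have "ac_on 0 p0 \<zeta>"
    by (rule ac_on_cong[OF ac_on_subset[OF ac\<xi>]]) (use p ab in \<open>auto simp: \<zeta>_def\<close>)
  moreover have "ac_on p0 (p1 + e) \<zeta>"
    by (rule ac_on_cong[OF ac_on_segment_motion[OF net \<gamma> e(1) ends(1,2)]])
       (use order \<xi>p in \<open>auto simp: \<zeta>_def\<close>)
  moreover have "ac_on (p1 + e) (p2 + e) \<zeta>"
  proof (rule ac_on_cong[OF ac_on_shift[OF ac_on_subset[OF ac\<xi>]]])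
    fix t assume "t \<in> {p1 + e..p2 + e}"
    then show "\<zeta> t = \<xi> (t - e)"
      using order \<xi>p segment_motion_end[OF e(1), of \<gamma> "s p0" "s p1"] by (auto simp: \<zeta>_def)
  qed (use p ab in auto)
  moreover have "ac_on (p2 + e) p3 \<zeta>"
  proof (rule ac_on_cong[OF ac_on_segment_motion[OF net \<gamma> e(2) ends(3,4)]])
    fix t assume t: "t \<in> {p2 + e..p3}"
    show "\<zeta> t = segment_motion \<gamma> (s p2) (s p3) (p2 + e) p3 t"
    proof (cases "t = p2 + e")
      case True
      have "\<zeta> t = \<gamma> (s p2)"
      \<comment> \<open>If \<open>p1 = p2\<close>, the translated stretch is a single instant, and
        the value at \<open>p2 + e\<close> is assigned by the first motion.\<close>
      proof (cases "p1 = p2")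
        case True
        then show ?thesis
          using order \<open>t = p2 + e\<close> segment_motion_end[OF e(1), of \<gamma> "s p0" "s p1"] by (simp add: \<zeta>_def)
      next
        case False
        then show ?thesis using order \<open>t = p2 + e\<close> \<xi>p by (simp add: \<zeta>_def)
      qed
      then show ?thesis using True by simp
    next
      case False
      then show ?thesis
        using t order \<xi>p segment_motion_end[OF e(2), of \<gamma> "s p2" "s p3"] by (auto simp: \<zeta>_def)
    qed
  qed
  moreover have "ac_on p3 T \<zeta>"
    by (rule ac_on_cong[OF ac_on_subset[OF ac\<xi>]]) (use p ab in \<open>auto simp: \<zeta>_def\<close>)
  ultimately have ac\<zeta>: "ac_on 0 T \<zeta>"
    using order by (meson ac_on_join less_imp_le order_trans)
  have ends\<zeta>: "\<zeta> 0 = \<xi> 0" "\<zeta> T = \<xi> T" using order by (auto simp: \<zeta>_def)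
  have split\<xi>: "part_cost \<Phi> \<xi> 0 T = part_cost \<Phi> \<xi> 0 p0 + part_cost \<Phi> \<xi> p0 p1 + part_cost \<Phi> \<xi> p1 p2 +
      part_cost \<Phi> \<xi> p2 p3 + part_cost \<Phi> \<xi> p3 T" for \<Phi>
    using part_cost_split[of 0 p3 T \<Phi> \<xi>] part_cost_split[of 0 p2 p3 \<Phi> \<xi>] part_cost_split[of 0 p1 p2 \<Phi> \<xi>]
      part_cost_split[of 0 p0 p1 \<Phi> \<xi>] p ab by simp
  have split\<zeta>: "part_cost \<Phi> \<zeta> 0 T = part_cost \<Phi> \<xi> 0 p0 + part_cost \<Phi> \<zeta> p0 (p1 + e) + part_cost \<Phi> \<xi> p1 p2 +
      part_cost \<Phi> \<zeta> (p2 + e) p3 + part_cost \<Phi> \<xi> p3 T" for \<Phi>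
  proof -
    have "part_cost \<Phi> \<zeta> 0 T = part_cost \<Phi> \<zeta> 0 p0 + part_cost \<Phi> \<zeta> p0 (p1 + e) + part_cost \<Phi> \<zeta> (p1 + e) (p2 + e) +
      part_cost \<Phi> \<zeta> (p2 + e) p3 + part_cost \<Phi> \<zeta> p3 T"
      using part_cost_split[of 0 p3 T \<Phi> \<zeta>] part_cost_split[of 0 "p2 + e" p3 \<Phi> \<zeta>]
        part_cost_split[of 0 "p1 + e" "p2 + e" \<Phi> \<zeta>] part_cost_split[of 0 p0 "p1 + e" \<Phi> \<zeta>] order by simp
    moreover have "part_cost \<Phi> \<zeta> 0 p0 = part_cost \<Phi> \<xi> 0 p0" by (rule part_cost_local) (simp add: \<zeta>_def)
    moreover have "part_cost \<Phi> \<zeta> p3 T = part_cost \<Phi> \<xi> p3 T" by (rule part_cost_local) (simp add: \<zeta>_def)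
    moreover have "part_cost \<Phi> \<zeta> (p1 + e) (p2 + e) = part_cost \<Phi> \<xi> p1 p2"
      by (rule part_cost_shift) (use order in \<open>auto simp: \<zeta>_def\<close>)
    ultimately show ?thesis by simp
  qed
  have I': "pos_cost \<zeta> p0 (p1 + e) \<le> ennreal (C * (p1 + e - p0))"
  proof (rule segment_motion_cost[OF \<gamma> e(1) ends(1,2) _ slope(1) C])
    \<comment> \<open>The time \<open>p1\<close> lies strictly between \<open>a\<close> and
      \<open>b\<close>; if \<open>s\<close> has the same value at \<open>p0\<close>, that value is
      interior as well, even for \<open>p0 = a\<close>.\<close>
    show "s p0 \<noteq> s p1 \<or> s p0 \<in> {0<..<1}" using p1int by auto
  qed (use order in \<open>auto simp: \<zeta>_def\<close>)
  have J': "pos_cost \<zeta> (p2 + e) p3 \<le> ennreal (C * (p3 - (p2 + e)))"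
  proof (rule segment_motion_cost[OF \<gamma> e(2) ends(3,4) _ slope(2) C])
    show "s p2 \<noteq> s p3 \<or> s p2 \<in> {0<..<1}" using p2int by auto
  qed (use order in \<open>auto simp: \<zeta>_def\<close>)
  have NI: "neg_cost \<xi> p0 p1 \<le> ennreal (K * (p1 - p0))" and NJ: "neg_cost \<xi> p2 p3 \<le> ennreal (K * (p3 - p2))"
    using p K by (intro neg_cost_le; simp)+
  have Nfin: "neg_cost \<eta> u v < \<infinity>" if "u \<le> v" for \<eta> u v
    using neg_cost_le[OF that K, of \<eta>] by (rule order_le_less_trans) simp
  \<comment> \<open>Finite costs are turned into real numbers so that the contributions of the
    unchanged and the translated stretches cancel.\<close>
  define P where "P u v = enn2real (pos_cost \<xi> u v)" for u v
  define N where "N u v = enn2real (neg_cost \<xi> u v)" for u v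
  define P' where "P' u v = enn2real (pos_cost \<zeta> u v)" for u v
  define N' where "N' u v = enn2real (neg_cost \<zeta> u v)" for u v
  have Pfin: "pos_cost \<xi> 0 p0 < \<infinity>" "pos_cost \<xi> p0 p1 < \<infinity>" "pos_cost \<xi> p1 p2 < \<infinity>" "pos_cost \<xi> p2 p3 < \<infinity>" "pos_cost \<xi> p3 T < \<infinity>"
    using fin unfolding split\<xi>[of e2ennreal] by auto
  have P: "pos_cost \<xi> 0 p0 = ennreal (P 0 p0)" "pos_cost \<xi> p0 p1 = ennreal (P p0 p1)" "pos_cost \<xi> p1 p2 = ennreal (P p1 p2)"
    "pos_cost \<xi> p2 p3 = ennreal (P p2 p3)" "pos_cost \<xi> p3 T = ennreal (P p3 T)"
    using Pfin by (simp_all add: P_def)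
  have N: "neg_cost \<xi> 0 p0 = ennreal (N 0 p0)" "neg_cost \<xi> p0 p1 = ennreal (N p0 p1)" "neg_cost \<xi> p1 p2 = ennreal (N p1 p2)"
    "neg_cost \<xi> p2 p3 = ennreal (N p2 p3)" "neg_cost \<xi> p3 T = ennreal (N p3 T)"
    using Nfin[of 0 p0 \<xi>] Nfin[of p0 p1 \<xi>] Nfin[of p1 p2 \<xi>] Nfin[of p2 p3 \<xi>] Nfin[of p3 T \<xi>] p ab by (simp_all add: N_def)
  have P': "pos_cost \<zeta> p0 (p1 + e) = ennreal (P' p0 (p1 + e))" "pos_cost \<zeta> (p2 + e) p3 = ennreal (P' (p2 + e) p3)"
    using order_le_less_trans[OF I', of \<infinity>] order_le_less_trans[OF J', of \<infinity>] by (simp_all add: P'_def)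
  have N': "neg_cost \<zeta> p0 (p1 + e) = ennreal (N' p0 (p1 + e))" "neg_cost \<zeta> (p2 + e) p3 = ennreal (N' (p2 + e) p3)"
    using Nfin[of p0 "p1 + e" \<zeta>] Nfin[of "p2 + e" p3 \<zeta>] order by (simp_all add: N'_def)
  have nn: "0 \<le> P u v" "0 \<le> N u v" "0 \<le> P' u v" "0 \<le> N' u v" for u v
    by (simp_all add: P_def N_def P'_def N'_def)
  have "action E H c T \<xi> = ereal ((P 0 p0 + P p0 p1 + P p1 p2 + P p2 p3 + P p3 T) - (N 0 p0 + N p0 p1 + N p1 p2 + N p2 p3 + N p3 T))"
    unfolding action_eq_costs split\<xi> P N using nn by (simp add: ennreal_plus[symmetric] del: ennreal_plus)
  moreover have "action E H c T \<zeta> = ereal ((P 0 p0 + P' p0 (p1 + e) + P p1 p2 + P' (p2 + e) p3 + P p3 T) -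
      (N 0 p0 + N' p0 (p1 + e) + N p1 p2 + N' (p2 + e) p3 + N p3 T))"
    unfolding action_eq_costs split\<zeta> P N P' N' using nn by (simp add: ennreal_plus[symmetric] del: ennreal_plus)
  \<comment> \<open>The negative costs of the competitor have the favourable sign and are dropped;
    those of \<open>\<xi>\<close> remain and are the source of \<open>K\<close> in the
    bound.\<close>
  ultimately have "P p0 p1 + P p2 p3 \<le> P' p0 (p1 + e) + P' (p2 + e) p3 + N p0 p1 + N p2 p3"
    using minimal[OF ac\<zeta> ends\<zeta>] nn[of p0 "p1 + e"] nn[of "p2 + e" p3] by simp
  moreover have "P' p0 (p1 + e) \<le> C * (p1 + e - p0)" "P' (p2 + e) p3 \<le> C * (p3 - (p2 + e))"
    using I' J' C(1) e unfolding P' by (simp_all add: ennreal_le_iff)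
  moreover have "N p0 p1 \<le> K * (p1 - p0)" "N p2 p3 \<le> K * (p3 - p2)"
    using NI NJ K(1) p unfolding N by (simp_all add: ennreal_le_iff)
  ultimately have "P p0 p1 + P p2 p3 \<le> (C + K) * ((p1 - p0) + (p3 - p2))"
    by (simp add: algebra_simps)
  then show ?thesis
    unfolding P using nn by (simp add: ennreal_plus[symmetric] ennreal_leI del: ennreal_plus)
qed

text \<open>For a fixed momentum, Fenchel's inequality converts cost into increment of the
  parameter; the sign of \<open>p\<close> is to be matched with the direction of motion.\<close>

lemma pos_cost_ge_increment:
  assumes uv: "a \<le> u" "u \<le> v" "v \<le> b" and M: "\<And>r. r \<in> {0..1} \<Longrightarrow> H \<gamma> r p \<le> M"
  shows "ennreal (p * (s v - s u) - M * (v - u)) \<le> pos_cost \<xi> u v"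
proof -
  have ac: "ac_on u v s" using ac_on_subset[OF ac_s uv(1,3)] .
  obtain N where N: "negligible N" "\<forall>t\<in>{u<..<v} - N. \<exists>L. (s has_real_derivative L) (at t)"
    using ac_on_differentiable_ae[OF ac] by blast
  then obtain s' where s': "\<And>t. t \<in> {u<..<v} - N \<Longrightarrow> (s has_real_derivative s' t) (at t)" by metis
  show ?thesis
    unfolding part_cost_def
  proof (rule ival_integral_ge_increment[OF ac uv(2) N(1) s'])
    fix t assume t: "t \<in> {u<..<v} - N"
    then have tab: "t \<in> {a<..<b}" using uv by auto
    have st: "s t \<in> {0..1}" using s_int[OF tab] by auto
    have "curve_lagrangian \<xi> t = ereal (arc_lagrangian H \<gamma> (s t) (s' t))"
      unfolding curve_lagrangian_def
    proof (rule lagrangian_on_arc[OF net ham \<gamma> tab s_int[OF tab] _ s'[OF t]])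
      fix r assume "r \<in> {a<..<b}"
      then have "r \<in> {a..b}" by auto
      then show "s r \<in> {0..1} \<and> \<xi> r = \<gamma> (s r)" using s01 \<xi>_eq by blast
    qed
    moreover have "p * s' t - M \<le> arc_lagrangian H \<gamma> (s t) (s' t)"
      using arc_lagrangian_ge[OF net ham \<gamma> st, of p "s' t"] M[OF st] by linarith
    ultimately show "ennreal (p * s' t - M) \<le> e2ennreal (curve_lagrangian \<xi> t)"
      by (simp add: ennreal_leI)
  qed auto
qed

text \<open>If \<open>s\<close> is steep on a short interval \<open>[u,v]\<close>, then running through it at unit speed saves much action,
  while making up for the time lost costs little where \<open>s\<close> is not steep.\<close>
lemma lipschitz_beside_tame_interval:
  assumes J: "a < t0" "0 < r0" "t0 + r0 < b"
    and tame: "0 \<le> M" "\<And>t. t \<in> {t0..t0 + r0} \<Longrightarrow> \<bar>s t - s t0\<bar> \<le> M * (t - t0)"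
    and I: "a \<le> a1" "b1 \<le> b" "b1 \<le> t0 \<or> t0 + r0 \<le> a1"
  shows "\<exists>L. L-lipschitz_on {a1..b1} s"
proof -
  \<comment> \<open>Unit speed is needed on the steep interval. On the tame one an increment of at
    most \<open>M * (2 * \<Delta>)\<close> is covered in a time greater than
    \<open>\<Delta>\<close>, which asks for speed \<open>2 * M\<close>.\<close>
  define R where "R = max 1 (2 * M)"
  have R: "1 \<le> R" "2 * M \<le> R" by (auto simp: R_def)
  obtain C where C: "0 \<le> C" "\<And>r l. r \<in> {0..1} \<Longrightarrow> \<bar>l\<bar> \<le> R \<Longrightarrow> arc_lagrangian H \<gamma> r l \<le> C"
    using arc_lagrangian_bounded_above[OF net ham \<gamma>, of R] R by fastforce
  \<comment> \<open>Chosen so that \<open>(P - 2 * (C + K)) * \<Delta>\<close> is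
    \<open>\<Delta>\<close>; the factor 2 stems from the compensating interval of length
    \<open>2 * \<Delta>\<close>.\<close>
  define P where "P = 1 + 2 * (C + K)"
  have "compact {-P, P}" by simp
  from hamiltonian_bounded[OF net ham \<gamma> this]
  obtain M' where M': "0 \<le> M'" "\<forall>r\<in>{0..1}. \<forall>p\<in>{-P, P}. \<bar>H \<gamma> r p\<bar> \<le> M'"
    by (elim exE conjE) (rule that)
  have M'P: "H \<gamma> r P \<le> M'" "H \<gamma> r (- P) \<le> M'" if "r \<in> {0..1}" for r
    using M'(2) that by (auto simp: abs_le_iff)
  \<comment> \<open>Collects the coefficients of \<open>v - u\<close> left over in the comparison,
    plus 1 for strictness. Being at least 1, it also makes a violating interval shorter than
    \<open>\<Delta>\<close>, so that unit speed really loses time there.\<close>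
  define Q where "Q = M' + C + K + 1"
  have Q: "1 \<le> Q" using M' C K by (simp add: Q_def)
  \<comment> \<open>Half of \<open>r0\<close>, so that the compensating interval fits into the tame
    one.\<close>
  define \<eta> where "\<eta> = r0 / 2"
  have \<eta>: "\<eta> > 0" using J by (simp add: \<eta>_def)
  have flat: "\<bar>s v - s u\<bar> \<le> Q * (v - u)" if uv: "a1 \<le> u" "u < v" "v \<le> b1" "\<bar>s v - s u\<bar> < \<eta>" for u v
  proof (rule ccontr)
    assume steep: "\<not> \<bar>s v - s u\<bar> \<le> Q * (v - u)"
    define \<Delta> where "\<Delta> = \<bar>s v - s u\<bar>"
    have \<Delta>: "Q * (v - u) < \<Delta>" "\<Delta> < \<eta>" using steep uv by (auto simp: \<Delta>_def)
    have "v - u \<le> Q * (v - u)" using mult_right_mono[of 1 Q "v - u"] Q uv by simp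
    then have vu: "v - u < \<Delta>" using \<Delta>(1) by (rule order_le_less_trans)
    define e where "e = \<Delta> - (v - u)"
    have e: "0 < e" "e < \<Delta>" using vu uv by (auto simp: e_def)
    have fits: "t0 + 2 * \<Delta> \<le> t0 + r0" using \<Delta>(2) by (simp add: \<eta>_def)
    have RD: "\<Delta> \<le> R * \<Delta>" using R e mult_right_mono[of 1 R \<Delta>] by auto
    have "\<bar>s (t0 + 2 * \<Delta>) - s t0\<bar> \<le> M * (t0 + 2 * \<Delta> - t0)" using fits e by (intro tame(2)) auto
    also have "\<dots> = (2 * M) * \<Delta>" by simp
    also have "\<dots> \<le> R * \<Delta>" using R(2) e by (intro mult_right_mono) auto
    also have "\<dots> \<le> R * (2 * \<Delta> - e)" using R e by (intro mult_left_mono) auto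
    finally have slopeJ: "\<bar>s (t0 + 2 * \<Delta>) - s t0\<bar> \<le> R * (2 * \<Delta> - e)" .
    \<comment> \<open>The exchange inequality orders its two intervals in time, so the sign of the
      shift depends on the side on which the tame interval lies.\<close>
    have "pos_cost \<xi> u v \<le> ennreal ((C + K) * ((v - u) + 2 * \<Delta>))"
      using I(3)
    proof
      assume "b1 \<le> t0"
      have "pos_cost \<xi> u v + pos_cost \<xi> t0 (t0 + 2 * \<Delta>) \<le> ennreal ((C + K) * ((v - u) + (t0 + 2 * \<Delta> - t0)))"
      proof (rule exchange_inequality[where e=e and R=R])
        show "\<bar>s v - s u\<bar> \<le> R * (v + e - u)" using RD by (simp add: e_def \<Delta>_def[symmetric])
        show "\<bar>s (t0 + 2 * \<Delta>) - s t0\<bar> \<le> R * (t0 + 2 * \<Delta> - (t0 + e))" using slopeJ by (simp add: algebra_simps)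
      qed (use I uv J fits e \<open>b1 \<le> t0\<close> C in auto)
      moreover have "pos_cost \<xi> u v \<le> pos_cost \<xi> u v + pos_cost \<xi> t0 (t0 + 2 * \<Delta>)" by simp
      ultimately have "pos_cost \<xi> u v \<le> ennreal ((C + K) * ((v - u) + (t0 + 2 * \<Delta> - t0)))" by (rule order_trans[rotated])
      then show ?thesis by simp
    next
      assume "t0 + r0 \<le> a1"
      have "pos_cost \<xi> t0 (t0 + 2 * \<Delta>) + pos_cost \<xi> u v \<le> ennreal ((C + K) * ((t0 + 2 * \<Delta> - t0) + (v - u)))"
      proof (rule exchange_inequality[where e="- e" and R=R])
        show "\<bar>s v - s u\<bar> \<le> R * (v - (u + - e))" using RD by (simp add: e_def \<Delta>_def[symmetric])
        show "\<bar>s (t0 + 2 * \<Delta>) - s t0\<bar> \<le> R * (t0 + 2 * \<Delta> + - e - t0)" using slopeJ by (simp add: algebra_simps)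
      qed (use I uv J fits e \<open>t0 + r0 \<le> a1\<close> C in auto)
      moreover have "pos_cost \<xi> u v \<le> pos_cost \<xi> t0 (t0 + 2 * \<Delta>) + pos_cost \<xi> u v" by simp
      ultimately have "pos_cost \<xi> u v \<le> ennreal ((C + K) * ((t0 + 2 * \<Delta> - t0) + (v - u)))" by (rule order_trans[rotated])
      then show ?thesis by (simp add: add.commute)
    qed
    moreover have "ennreal (P * \<Delta> - M' * (v - u)) \<le> pos_cost \<xi> u v"
    proof (cases "s u \<le> s v")
      case True
      have "ennreal (P * (s v - s u) - M' * (v - u)) \<le> pos_cost \<xi> u v"
        by (rule pos_cost_ge_increment) (use uv I M'P(1) in auto)
      then show ?thesis using True by (simp add: \<Delta>_def)
    next
      case False
      have "ennreal (- P * (s v - s u) - M' * (v - u)) \<le> pos_cost \<xi> u v"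
        by (rule pos_cost_ge_increment) (use uv I M'P(2) in auto)
      moreover have "- P * (s v - s u) = P * \<Delta>" using False by (simp add: \<Delta>_def algebra_simps)
      ultimately show ?thesis by simp
    qed
    ultimately have "ennreal (P * \<Delta> - M' * (v - u)) \<le> ennreal ((C + K) * ((v - u) + 2 * \<Delta>))" by (rule order_trans[rotated])
    moreover have "0 \<le> (C + K) * ((v - u) + 2 * \<Delta>)" using C K uv e by simp
    ultimately have "P * \<Delta> - M' * (v - u) \<le> (C + K) * ((v - u) + 2 * \<Delta>)" by (simp add: ennreal_le_iff)
    then have "\<Delta> \<le> Q * (v - u) - (v - u)" by (simp add: P_def Q_def algebra_simps)
    then show False using \<Delta>(1) uv by linarith
  qed
  have cont: "continuous_on {a1..b1} s"
    using ac_on_imp_continuous_on[OF ac_on_subset[OF ac_s I(1,2)]] .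
  then have "uniformly_continuous_on {a1..b1} s" by (rule compact_uniformly_continuous) simp
  then obtain d where d: "d > 0" "\<And>x y. x \<in> {a1..b1} \<Longrightarrow> y \<in> {a1..b1} \<Longrightarrow> dist y x < d \<Longrightarrow> dist (s y) (s x) < \<eta>"
    using \<eta> unfolding uniformly_continuous_on_def by metis
  \<comment> \<open>Over times of at least \<open>d\<close> the trivial bound
    \<open>\<bar>s v - s u\<bar> \<le> 1\<close> suffices, with slope \<open>1 / d\<close>.\<close>
  define L where "L = max Q (1 / d)"
  have bound: "\<bar>s v - s u\<bar> \<le> L * (v - u)" if uv: "a1 \<le> u" "u < v" "v \<le> b1" for u v
  proof (cases "v - u < d")
    case True
    then have "\<bar>s v - s u\<bar> < \<eta>" using d(2)[of u v] uv by (simp add: dist_real_def)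
    with uv have "\<bar>s v - s u\<bar> \<le> Q * (v - u)" by (intro flat)
    also have "\<dots> \<le> L * (v - u)" using uv by (intro mult_right_mono) (auto simp: L_def)
    finally show ?thesis .
  next
    case False
    have "s u \<in> {0..1}" "s v \<in> {0..1}" using uv I by (intro s01; simp)+
    then have "\<bar>s v - s u\<bar> \<le> 1" by auto
    also have "1 \<le> 1 / d * (v - u)" using False d(1) by (simp add: field_simps)
    also have "\<dots> \<le> L * (v - u)" using uv by (intro mult_right_mono) (auto simp: L_def)
    finally show ?thesis .
  qed
  have "L-lipschitz_on {a1..b1} s"
  proof (rule lipschitz_onI)
    show "0 \<le> L" using Q by (simp add: L_def)
    fix x y assume "x \<in> {a1..b1}" "y \<in> {a1..b1}"
    then show "dist (s x) (s y) \<le> L * dist x y"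
      using bound[of x y] bound[of y x] by (cases x y rule: linorder_cases) (auto simp: dist_real_def abs_minus_commute)
  qed
  then show ?thesis ..
qed

text \<open>The compensating interval must not overlap the steep one, so each half of
  \<open>{a..b}\<close> is treated with a tame interval taken from the other half.\<close>

lemma arc_parameter_lipschitz: "\<exists>L. L-lipschitz_on {a..b} s"
proof -
  define m where "m = (a + b) / 2"
  have m: "a < m" "m < b" using ab by (auto simp: m_def)
  have tame: "\<exists>t0 r0 M. x < t0 \<and> 0 < r0 \<and> t0 + r0 < y \<and> 0 \<le> M \<and> (\<forall>t\<in>{t0..t0 + r0}. \<bar>s t - s t0\<bar> \<le> M * (t - t0))"
    if xy: "a \<le> x" "x < y" "y \<le> b" for x y
  proof -
    obtain N where N: "negligible N" "\<forall>t\<in>{x<..<y} - N. \<exists>L. (s has_real_derivative L) (at t)"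
      using ac_on_differentiable_ae[OF ac_on_subset[OF ac_s xy(1,3)]] by blast
    have "\<not> negligible {x<..<y}" using xy(2) open_not_negligible[of "{x<..<y}"] by simp
    then have "\<not> {x<..<y} \<subseteq> N" using negligible_subset[OF N(1)] by blast
    then obtain t0 where t0: "t0 \<in> {x<..<y}" "t0 \<notin> N" by blast
    with N(2) obtain L where "(s has_real_derivative L) (at t0)" by blast
    then have "(s has_derivative (*) L) (at t0)" by (simp add: has_field_derivative_def)
    then have "\<exists>d>0. \<forall>y. norm (y - t0) < d \<longrightarrow> norm (s y - s t0 - L * (y - t0)) \<le> 1 * norm (y - t0)"
      unfolding has_derivative_at_alt by (metis zero_less_one)
    then obtain d where d: "d > 0" "\<And>y. norm (y - t0) < d \<Longrightarrow> norm (s y - s t0 - L * (y - t0)) \<le> 1 * norm (y - t0)"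
      by blast
    define r0 where "r0 = min (d / 2) ((y - t0) / 2)"
    have "r0 \<le> d / 2" "r0 \<le> (y - t0) / 2" unfolding r0_def by (rule min.cobounded1 min.cobounded2)+
    moreover have "0 < r0" using d(1) t0 by (simp add: r0_def)
    ultimately have r0: "0 < r0" "r0 < d" "t0 + r0 < y" using d(1) t0 by (simp_all add: field_simps)
    have "\<bar>s t - s t0\<bar> \<le> (\<bar>L\<bar> + 1) * (t - t0)" if t: "t \<in> {t0..t0 + r0}" for t
    proof -
      have "\<bar>s t - s t0 - L * (t - t0)\<bar> \<le> t - t0" using d(2)[of t] t r0 by auto
      moreover have "\<bar>L * (t - t0)\<bar> = \<bar>L\<bar> * (t - t0)" using t by (simp add: abs_mult)
      ultimately show ?thesis by (simp add: algebra_simps abs_le_iff) 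
    qed
    then show ?thesis using t0 r0 by (intro exI[of _ t0] exI[of _ r0] exI[of _ "\<bar>L\<bar> + 1"]) auto
  qed
  obtain t0 r0 M where J: "m < t0" "0 < r0" "t0 + r0 < b" "0 \<le> M" "\<And>t. t \<in> {t0..t0 + r0} \<Longrightarrow> \<bar>s t - s t0\<bar> \<le> M * (t - t0)"
    using tame[of m b] m by auto
  have "\<exists>L. L-lipschitz_on {a..m} s"
    by (rule lipschitz_beside_tame_interval[where ?t0.0=t0 and ?r0.0=r0 and M=M]) (use J m in auto)
  then obtain L1 where L1: "L1-lipschitz_on {a..m} s" ..
  obtain t1 r1 M1 where J1: "a < t1" "0 < r1" "t1 + r1 < m" "0 \<le> M1" "\<And>t. t \<in> {t1..t1 + r1} \<Longrightarrow> \<bar>s t - s t1\<bar> \<le> M1 * (t - t1)"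
    using tame[of a m] m by auto
  have "\<exists>L. L-lipschitz_on {m..b} s"
    by (rule lipschitz_beside_tame_interval[where ?t0.0=t1 and ?r0.0=r1 and M=M1]) (use J1 m in auto)
  then obtain L2 where L2: "L2-lipschitz_on {m..b} s" ..
  show ?thesis using lipschitz_on_concat_max[OF L1 L2] by auto
qed

end

end

end

section \<open>Pieces of admissible curves\<close>

text \<open>Injectivity of the arc defines \<open>s\<close>, and the expansion bound transfers
  absolute continuity from the curve to it.\<close>

lemma arc_parametrization:
  fixes \<xi> :: "real \<Rightarrow> real ^ 'n"
  assumes net: "network E" and ac: "ac_on a b \<xi>" and ab: "a < b" and sub: "\<xi> ` {a..b} \<subseteq> network_support E"
    and nv: "\<xi> ` {a<..<b} \<inter> vertices E = {}"
  shows "\<exists>\<gamma> s. \<gamma> \<in> arcs E \<and> (\<forall>t\<in>{a..b}. s t \<in> {0..1}) \<and> (\<forall>t\<in>{a..b}. \<xi> t = \<gamma> (s t)) \<and>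
    (\<forall>t\<in>{a<..<b}. s t \<in> {0<..<1}) \<and> ac_on a b s"
proof -
  from curve_in_single_arc[OF net ac_on_imp_continuous_on[OF ac] ab sub nv]
  obtain \<gamma> where \<gamma>: "\<gamma> \<in> arcs E" and im0: "\<forall>t\<in>{a..b}. \<xi> t \<in> \<gamma> ` {0..1}"
    and im0': "\<forall>t\<in>{a<..<b}. \<xi> t \<in> \<gamma> ` {0<..<1}"
    by (elim bexE conjE) (rule that)
  note im = bspec[OF im0] and im' = bspec[OF im0']
  define s where "s t = inv_into {0..1} \<gamma> (\<xi> t)" for t
  have s01: "s t \<in> {0..1}" and eq: "\<xi> t = \<gamma> (s t)" if "t \<in> {a..b}" for t
    unfolding s_def using inv_into_into[OF im[OF that]] f_inv_into_f[OF im[OF that]] by simp_all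
  have int: "s t \<in> {0<..<1}" if t: "t \<in> {a<..<b}" for t
  proof -
    obtain r where r: "r \<in> {0<..<1}" "\<xi> t = \<gamma> r" using im'[OF t] by blast
    then have "s t = r"
      unfolding s_def using inv_into_f_f[OF arcs_inj_on[OF net \<gamma>], of r] by simp
    with r show ?thesis by simp
  qed
  obtain k where k: "k > 0" "\<And>x y. x \<in> {0..1} \<Longrightarrow> y \<in> {0..1} \<Longrightarrow> k * \<bar>x - y\<bar> \<le> norm (\<gamma> x - \<gamma> y)"
    using arc_expanding[OF net \<gamma>] by blast
  have "ac_on a b s"
  proof (rule ac_on_dominated[OF ac, where B="1 / k"])
    fix x y assume "x \<in> {a..b}" "y \<in> {a..b}"
    then have "k * \<bar>s x - s y\<bar> \<le> norm (\<xi> x - \<xi> y)" using k(2)[OF s01 s01] eq by simp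
    then show "norm (s x - s y) \<le> 1 / k * norm (\<xi> x - \<xi> y)" using k(1) by (simp add: field_simps)
  qed
  with \<gamma> s01 eq int show ?thesis by (intro exI conjI ballI)
qed

lemma curve_lagrangian_constant:
  assumes x: "x \<in> vertices E" and t: "t \<in> {a<..<b}" and \<xi>: "\<And>r. r \<in> {a<..<b} \<Longrightarrow> \<xi> r = x"
  shows "curve_lagrangian E H c \<xi> t = ereal (c x)"
proof -
  have "vector_derivative \<xi> (at t) = vector_derivative (\<lambda>_. x) (at t)"
    using t \<xi> by (rule vector_derivative_eq_on_open)
  then have vd: "vector_derivative \<xi> (at t) = 0" by simp
  obtain \<gamma> s where g: "\<gamma> \<in> arcs E" "s \<in> {0..1}" "x = \<gamma> s"
  proof -
    from x obtain g where "g \<in> arcs E" "x = g 0 \<or> x = g 1"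
      by (auto simp: vertices_def pathstart_def pathfinish_def)
    then show ?thesis using that[of g 0] that[of g 1] by auto
  qed
  have "x \<in> network_support E"
    using g(1)
    unfolding arcs_def
  proof
    assume "\<gamma> \<in> E"
    then show ?thesis using g(2,3) unfolding network_support_def by blast
  next
    assume "\<gamma> \<in> reversepath ` E"
    then obtain g' where "g' \<in> E" "x = g' (1 - s)" using g(3) by (auto simp: reversepath_def)
    moreover have "1 - s \<in> {0..1}" using g(2) by auto
    ultimately show ?thesis unfolding network_support_def by blast
  qed
  moreover have "0 = 0 *\<^sub>R arc_deriv \<gamma> s" by simp
  ultimately have "(x, 0) \<in> tangent_bundle E" using g unfolding tangent_bundle_def by blast
  then show ?thesis using x \<xi>[OF t] vd by (simp add: curve_lagrangian_def lagrangian_def)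
qed

text \<open>The two alternatives of admissibility are used here. Off the vertices the piece is rerun
  at constant speed, and distinct endpoints keep this motion from degenerating to rest at a vertex;
  a piece at rest is kept, its cost being governed by \<open>c x\<close>.\<close>

lemma finite_cost_piece:
  fixes \<xi> :: "real \<Rightarrow> real ^ 'n"
  assumes net: "network E" and ham: "hamiltonians E H"
    and ac: "ac_on a b \<xi>" and ab: "a < b" and sub: "\<xi> ` {a..b} \<subseteq> network_support E"
    and piece: "(\<xi> ` {a<..<b} \<inter> vertices E = {} \<and> \<xi> a \<noteq> \<xi> b) \<or> (\<exists>x\<in>vertices E. \<forall>s\<in>{a<..<b}. \<xi> s = x)"
  shows "\<exists>\<eta>. ac_on a b \<eta> \<and> \<eta> a = \<xi> a \<and> \<eta> b = \<xi> b \<and> pos_cost E H c \<eta> a b < \<infinity>"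
  using piece
proof
  assume "\<xi> ` {a<..<b} \<inter> vertices E = {} \<and> \<xi> a \<noteq> \<xi> b"
  then have nv: "\<xi> ` {a<..<b} \<inter> vertices E = {}" and ne: "\<xi> a \<noteq> \<xi> b" by auto
  from arc_parametrization[OF net ac ab sub nv]
  obtain \<gamma> s where s: "\<gamma> \<in> arcs E" "\<forall>t\<in>{a..b}. s t \<in> {0..1}" "\<forall>t\<in>{a..b}. \<xi> t = \<gamma> (s t)"
    "\<forall>t\<in>{a<..<b}. s t \<in> {0<..<1}" "ac_on a b s"
    by (elim exE conjE) (rule that)
  have ends: "s a \<in> {0..1}" "s b \<in> {0..1}" "\<xi> a = \<gamma> (s a)" "\<xi> b = \<gamma> (s b)"
    using bspec[OF s(2), of a] bspec[OF s(2), of b] bspec[OF s(3), of a] bspec[OF s(3), of b] ab by auto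
  define R where "R = \<bar>s b - s a\<bar> / (b - a)"
  have "0 \<le> R" using ab by (simp add: R_def)
  from arc_lagrangian_bounded_above[OF net ham s(1) this]
  obtain C where C0: "0 \<le> C" and C1: "\<forall>r\<in>{0..1}. \<forall>l. \<bar>l\<bar> \<le> R \<longrightarrow> arc_lagrangian H \<gamma> r l \<le> C"
    by (elim exE conjE) (rule that)
  have "pos_cost E H c (segment_motion \<gamma> (s a) (s b) a b) a b \<le> ennreal (C * (b - a))"
  proof (rule segment_motion_cost[OF net ham s(1) ab ends(1,2) _ _ C0])
    show "s a \<noteq> s b \<or> s a \<in> {0<..<1}" using ne ends(3,4) by auto
    show "\<bar>s b - s a\<bar> \<le> R * (b - a)" using ab by (simp add: R_def)
    show "arc_lagrangian H \<gamma> r l \<le> C" if "r \<in> {0..1}" "\<bar>l\<bar> \<le> R" for r l using C1 that by blast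
  qed simp
  then have "pos_cost E H c (segment_motion \<gamma> (s a) (s b) a b) a b < \<infinity>"
    by (rule order_le_less_trans) simp
  moreover have "ac_on a b (segment_motion \<gamma> (s a) (s b) a b)"
    by (rule ac_on_segment_motion[OF net s(1) ab ends(1,2)])
  ultimately show ?thesis
    using ends(3,4) segment_motion_end[OF ab, of \<gamma> "s a" "s b"]
    by (intro exI[of _ "segment_motion \<gamma> (s a) (s b) a b"]) simp
next
  assume "\<exists>x\<in>vertices E. \<forall>s\<in>{a<..<b}. \<xi> s = x"
  then obtain x where x: "x \<in> vertices E" "\<And>s. s \<in> {a<..<b} \<Longrightarrow> \<xi> s = x" by blast
  have "pos_cost E H c \<xi> a b \<le> ennreal (\<bar>c x\<bar> * (b - a))"
  proof (rule pos_cost_le)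
    fix t assume "t \<in> {a<..<b}"
    from curve_lagrangian_constant[OF x(1) this x(2)]
    show "curve_lagrangian E H c \<xi> t \<le> ereal \<bar>c x\<bar>" by simp
  qed (use ab in simp_all)
  then have "pos_cost E H c \<xi> a b < \<infinity>" by (rule order_le_less_trans) simp
  with ac show ?thesis by blast
qed

lemma finite_cost_join:
  assumes f: "ac_on p q f" "pos_cost E H c f p q < \<infinity>" and g: "ac_on q r g" "pos_cost E H c g q r < \<infinity>"
    and eq: "f q = g q" and order: "p \<le> q" "q < r"
  shows "\<exists>h. ac_on p r h \<and> h p = f p \<and> h r = g r \<and> pos_cost E H c h p r < \<infinity>"
proof -
  define h where "h t = (if t \<le> q then f t else g t)" for t
  have "ac_on p q h" by (rule ac_on_cong[OF f(1)]) (simp add: h_def)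
  moreover have "ac_on q r h" by (rule ac_on_cong[OF g(1)]) (use eq in \<open>auto simp: h_def\<close>)
  ultimately have "ac_on p r h" by (rule ac_on_join) (use order in simp_all)
  moreover have "pos_cost E H c h p r = pos_cost E H c f p q + pos_cost E H c g q r"
  proof -
    have "pos_cost E H c h p q = pos_cost E H c f p q" by (rule part_cost_local) (simp add: h_def)
    moreover have "pos_cost E H c h q r = pos_cost E H c g q r" by (rule part_cost_local) (simp add: h_def)
    ultimately show ?thesis using part_cost_split[of p q r E H c e2ennreal h] order by simp
  qed
  ultimately show ?thesis using f g order by (intro exI[of _ h]) (auto simp: h_def)
qed

section \<open>Gluing the pieces of the partition\<close>

theorem theorem5p3:
  fixes E :: "(real \<Rightarrow> real ^ 'n) set"
    and H :: "(real \<Rightarrow> real ^ 'n) \<Rightarrow> real \<Rightarrow> real \<Rightarrow> real"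
    and c :: "real ^ 'n \<Rightarrow> real"
    and z1 z2 :: "real ^ 'n" and T :: real
    and \<xi> :: "real \<Rightarrow> real ^ 'n"
  assumes "network E" and "hamiltonians E H" and "flux_limiter E H c"
    and "z1 \<in> network_support E" and "z2 \<in> network_support E" and "T > 0"
    and "admissible E T \<xi>" and "\<xi> 0 = z1" and "\<xi> T = z2"
    and "\<And>\<zeta>. absolutely_continuous_curve 0 T \<zeta> \<Longrightarrow> \<zeta> 0 = z1 \<Longrightarrow> \<zeta> T = z2 \<Longrightarrow>
           action E H c T \<xi> \<le> action E H c T \<zeta>"
  shows "\<exists>C. C-lipschitz_on {0..T} \<xi>"
proof -
  note net = assms(1) and ham = assms(2)
  have ac: "ac_on 0 T \<xi>"
    using assms(7) unfolding admissible_def absolutely_continuous_curve_iff_ac_on by (elim conjE)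
  have sub: "\<xi> ` {0..T} \<subseteq> network_support E"
    using assms(7) unfolding admissible_def by (elim conjE)
  let ?partition = "\<lambda>(m::nat) \<tau>. m \<ge> 2 \<and> \<tau> 1 = 0 \<and> \<tau> m = T \<and> (\<forall>i\<in>{1..<m}. \<tau> i < \<tau> (Suc i)) \<and>
        (\<forall>i\<in>{2..<m}. \<xi> (\<tau> i) \<in> vertices E) \<and>
        (\<forall>i\<in>{1..<m}.
           (\<xi> ` {\<tau> i<..<\<tau> (Suc i)} \<inter> vertices E = {} \<and> \<xi> (\<tau> i) \<noteq> \<xi> (\<tau> (Suc i))) \<or>
           (\<exists>x\<in>vertices E. \<forall>s\<in>{\<tau> i<..<\<tau> (Suc i)}. \<xi> s = x))"
  have "\<exists>m \<tau>. ?partition m \<tau>" using assms(7) unfolding admissible_def by (elim conjE)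
  then obtain m \<tau> where part: "?partition m \<tau>" by (elim exE) (rule that)
  have m: "m \<ge> 2" "\<tau> 1 = 0" "\<tau> m = T" "\<forall>i\<in>{1..<m}. \<tau> i < \<tau> (Suc i)"
    using part by simp_all
  have pieces: "\<forall>i\<in>{1..<m}. (\<xi> ` {\<tau> i<..<\<tau> (Suc i)} \<inter> vertices E = {} \<and> \<xi> (\<tau> i) \<noteq> \<xi> (\<tau> (Suc i))) \<or>
           (\<exists>x\<in>vertices E. \<forall>s\<in>{\<tau> i<..<\<tau> (Suc i)}. \<xi> s = x)"
    using part by (elim conjE)
  have mono: "\<tau> i \<le> \<tau> j" if "1 \<le> i" "i \<le> j" "j \<le> m" for i j
    using that(2,3,1)
  proof (induction j rule: dec_induct)
    case (step n)
    then have "\<tau> n < \<tau> (Suc n)" using m(4) by simp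
    with step show ?case by simp
  qed simp
  have bounds: "0 \<le> \<tau> i" "\<tau> i \<le> T" if "1 \<le> i" "i \<le> m" for i
    using mono[of 1 i] mono[of i m] that m by simp_all
  have piece_ac: "ac_on (\<tau> i) (\<tau> (Suc i)) \<xi>" and piece_sub: "\<xi> ` {\<tau> i..\<tau> (Suc i)} \<subseteq> network_support E"
    and piece_lt: "\<tau> i < \<tau> (Suc i)" and piece_bounds: "0 \<le> \<tau> i" "\<tau> (Suc i) \<le> T" if i: "i \<in> {1..<m}" for i
  proof -
    show b: "0 \<le> \<tau> i" "\<tau> (Suc i) \<le> T" using bounds[of i] bounds[of "Suc i"] i by simp_all
    show "ac_on (\<tau> i) (\<tau> (Suc i)) \<xi>" by (rule ac_on_subset[OF ac b])
    have "{\<tau> i..\<tau> (Suc i)} \<subseteq> {0..T}" using b by auto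
    then show "\<xi> ` {\<tau> i..\<tau> (Suc i)} \<subseteq> network_support E" using sub by blast
    show "\<tau> i < \<tau> (Suc i)" using m(4) i by blast
  qed
  \<comment> \<open>Pieces of finite cost with the same endpoints as \<open>\<xi>\<close> are
    concatenated up to the partition point \<open>\<tau> k\<close>; for \<open>k = m\<close> this is
    a competitor.\<close>
  have "\<exists>\<zeta>. ac_on 0 (\<tau> k) \<zeta> \<and> \<zeta> 0 = \<xi> 0 \<and> \<zeta> (\<tau> k) = \<xi> (\<tau> k) \<and> pos_cost E H c \<zeta> 0 (\<tau> k) < \<infinity>"
    if "1 \<le> k" "k \<le> m" for k
    using that
  proof (induction k rule: dec_induct)
    case base
    have "pos_cost E H c \<xi> 0 0 = 0" by (simp add: part_cost_def ival_integral_def)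
    then show ?case using m(2) ac_on_subset[OF ac, of 0 0] \<open>T > 0\<close> by (intro exI[of _ \<xi>]) simp
  next
    case (step n)
    then have n: "n \<in> {1..<m}" by simp
    obtain f where f: "ac_on 0 (\<tau> n) f" "f 0 = \<xi> 0" "f (\<tau> n) = \<xi> (\<tau> n)" "pos_cost E H c f 0 (\<tau> n) < \<infinity>"
      using step by auto
    obtain g where g: "ac_on (\<tau> n) (\<tau> (Suc n)) g" "g (\<tau> n) = \<xi> (\<tau> n)" "g (\<tau> (Suc n)) = \<xi> (\<tau> (Suc n))"
      "pos_cost E H c g (\<tau> n) (\<tau> (Suc n)) < \<infinity>"
      using finite_cost_piece[OF net ham piece_ac[OF n] piece_lt[OF n] piece_sub[OF n] bspec[OF pieces n]] by blast
    show ?case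
      using finite_cost_join[OF f(1,4) g(1,4) _ piece_bounds(1)[OF n] piece_lt[OF n]] f g by simp
  qed
  then obtain \<zeta> where \<zeta>: "ac_on 0 T \<zeta>" "\<zeta> 0 = \<xi> 0" "\<zeta> T = \<xi> T" "pos_cost E H c \<zeta> 0 T < \<infinity>"
    using m by (metis one_le_numeral order_trans order_refl)
  have minimal: "action E H c T \<xi> \<le> action E H c T \<zeta>" if "ac_on 0 T \<zeta>" "\<zeta> 0 = \<xi> 0" "\<zeta> T = \<xi> T" for \<zeta>
    using assms(8-10) that by (simp add: absolutely_continuous_curve_iff_ac_on)
  obtain K where K: "0 \<le> K" "\<And>x q. ereal (- K) \<le> lagrangian E H c x q"
    using lagrangian_bounded_below[OF net ham] by blast
  \<comment> \<open>Were the positive cost infinite, the action of \<open>\<xi>\<close> would be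
    \<open>\<infinity>\<close>, because its negative cost is finite, and minimality would pass this
    on to the competitor \<open>\<zeta>\<close>.\<close>
  have fin: "pos_cost E H c \<xi> 0 T < \<infinity>"
  proof (rule ccontr)
    assume "\<not> ?thesis"
    then have "pos_cost E H c \<xi> 0 T = \<infinity>" by (simp add: less_top[symmetric])
    moreover have "neg_cost E H c \<xi> 0 T \<noteq> \<infinity>"
      using neg_cost_le[of 0 T K E H c \<xi>] K \<open>T > 0\<close> by (auto simp: top_unique)
    ultimately have "action E H c T \<xi> = \<infinity>"
      by (simp add: action_eq_costs enn2ereal_eq_top_iff)
    then have "action E H c T \<zeta> = \<infinity>" using minimal[OF \<zeta>(1-3)] by simp
    then have "enn2ereal (pos_cost E H c \<zeta> 0 T) = \<infinity>"
      unfolding action_eq_costs by (cases "enn2ereal (pos_cost E H c \<zeta> 0 T)"; cases "enn2ereal (neg_cost E H c \<zeta> 0 T)") (auto simp: enn2ereal_eq_top_iff)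
    with \<zeta>(4) show False by (simp add: enn2ereal_eq_top_iff)
  qed
  have piece_lip: "\<exists>L. L-lipschitz_on {\<tau> i..\<tau> (Suc i)} \<xi>" if i: "i \<in> {1..<m}" for i
    using bspec[OF pieces i]
  proof
    assume "\<xi> ` {\<tau> i<..<\<tau> (Suc i)} \<inter> vertices E = {} \<and> \<xi> (\<tau> i) \<noteq> \<xi> (\<tau> (Suc i))"
    then have nv: "\<xi> ` {\<tau> i<..<\<tau> (Suc i)} \<inter> vertices E = {}" by simp
    from arc_parametrization[OF net piece_ac[OF i] piece_lt[OF i] piece_sub[OF i] nv]
    obtain \<gamma> s where s: "\<gamma> \<in> arcs E" "\<forall>t\<in>{\<tau> i..\<tau> (Suc i)}. s t \<in> {0..1}"
      "\<forall>t\<in>{\<tau> i..\<tau> (Suc i)}. \<xi> t = \<gamma> (s t)" "\<forall>t\<in>{\<tau> i<..<\<tau> (Suc i)}. s t \<in> {0<..<1}"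
      "ac_on (\<tau> i) (\<tau> (Suc i)) s"
      by (elim exE conjE) (rule that)
    obtain L where L: "L-lipschitz_on {\<tau> i..\<tau> (Suc i)} s"
      using arc_parameter_lipschitz[OF net ham ac minimal fin K s(1) piece_bounds(1)[OF i] piece_lt[OF i] piece_bounds(2)[OF i] bspec[OF s(2)] bspec[OF s(3)] bspec[OF s(4)] s(5)]
      by blast
    obtain B where B: "B-lipschitz_on {0..1} \<gamma>" using arc_lipschitz[OF net s(1)] by blast
    have "(B * L)-lipschitz_on {\<tau> i..\<tau> (Suc i)} (\<lambda>t. \<gamma> (s t))"
      by (rule lipschitz_on_compose2[OF L lipschitz_on_subset[OF B]]) (use s(2) in blast)
    then have "(B * L)-lipschitz_on {\<tau> i..\<tau> (Suc i)} \<xi>"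
      by (rule lipschitz_on_transform) (use s(3) in simp)
    then show ?thesis ..
  next
    assume "\<exists>x\<in>vertices E. \<forall>s\<in>{\<tau> i<..<\<tau> (Suc i)}. \<xi> s = x"
    then obtain x where x: "\<And>s. s \<in> {\<tau> i<..<\<tau> (Suc i)} \<Longrightarrow> \<xi> s = x" by blast
    \<comment> \<open>Rest is known on the open interval only; continuity extends it to the
      endpoints.\<close>
    have cl: "closure {\<tau> i<..<\<tau> (Suc i)} = {\<tau> i..\<tau> (Suc i)}" using piece_lt[OF i] by simp
    have "\<xi> t = x" if "t \<in> {\<tau> i..\<tau> (Suc i)}" for t
      using continuous_constant_on_closure[of "{\<tau> i<..<\<tau> (Suc i)}" \<xi> x t]
        ac_on_imp_continuous_on[OF piece_ac[OF i]] x that cl by simp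
    then have "0-lipschitz_on {\<tau> i..\<tau> (Suc i)} \<xi>" by (intro lipschitz_onI) auto
    then show ?thesis ..
  qed
  have "\<exists>L. L-lipschitz_on {0..\<tau> k} \<xi>" if "1 \<le> k" "k \<le> m" for k
    using that
  proof (induction k rule: dec_induct)
    case base
    have "0-lipschitz_on {0..\<tau> 1} \<xi>" using m(2) by (intro lipschitz_onI) auto
    then show ?case ..
  next
    case (step n)
    then obtain L1 where "L1-lipschitz_on {0..\<tau> n} \<xi>" by auto
    moreover obtain L2 where "L2-lipschitz_on {\<tau> n..\<tau> (Suc n)} \<xi>" using piece_lip[of n] step by auto
    ultimately have "(max L1 L2)-lipschitz_on {0..\<tau> (Suc n)} (\<lambda>x. if x \<le> \<tau> n then \<xi> x else \<xi> x)"
      by (rule lipschitz_on_concat_max) simp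
    then show ?case by auto
  qed
  from this[of m] show ?thesis using m by simp
qed

end
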